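(* In the message-passing model with $s$ players and edge duplication allowed, the optimal communication cost of computing an additive $2$-spanner of an $n$-vertex input graph is $\tilde{\Theta}(s n^{3/2})$ bits.
   Context: Message-passing model: there are $s$ players $P^1,\dots,P^s$ and a coordinator. All parties know the vertex set $V$, $|V|=n$; player $P^i$ holds an edge set $E_i$ on $V$, and the input graph is $G=(V,\bigcup_i E_i)$ (unweighted, undirected). Communication is only between the coordinator and individual players (point-to-point, private); the coordinator must output the answer. The communication cost is the total number of bits exchanged (worst case over inputs); randomized protocols must succeed with probability at least $2/3$ on every input. "With duplication" means the sets $E_i$ may overlap; "without duplication" means they are pairwise disjoint. An additive $\beta$-spanner of $G$ is a subgraph $H$ on $V$ with $d_G(u,v)\le d_H(u,v)\le d_G(u,v)+\beta$ for all $u,v\in V$, where $d$ denotes shortest-path distance. $\tilde O,\tilde\Omega,\tilde\Theta$ hide $\mathrm{poly}(\log n)$ factors. Standing assumption: $s\ll n$ (e.g. $s=O(n^{\varepsilon})$ for a small constant $\varepsilon>0$). *)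

theory Defs
  imports "HOL-Probability.Probability" "HOL-Library.Landau_Symbols"
begin

section \<open>Graphs and additive spanners\<close>

text \<open>The vertex set is \<open>{..<n}\<close>; a simple undirected graph on it is a set of
  two-element vertex sets.\<close>

type_synonym edges = "nat set set"

definition complete_edges :: "nat \<Rightarrow> edges" where
  "complete_edges n = {{u, v} | u v. u < n \<and> v < n \<and> u \<noteq> v}"

definition adjacency :: "edges \<Rightarrow> (nat \<times> nat) set" where
  "adjacency E = {(u, v). {u, v} \<in> E}"

text \<open>The least length of a walk, and \<open>\<infinity>\<close> (the infimum of the empty set) if \<open>u\<close> and \<open>v\<close> lie in
  different components.\<close>

definition graph_dist :: "edges \<Rightarrow> nat \<Rightarrow> nat \<Rightarrow> enat" where
  "graph_dist E u v = Inf {enat k | k. (u, v) \<in> adjacency E ^^ k}"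

definition additive_spanner :: "nat \<Rightarrow> nat \<Rightarrow> edges \<Rightarrow> edges \<Rightarrow> bool" where
  "additive_spanner n \<beta> G H \<longleftrightarrow>
     H \<subseteq> G \<and>
     (\<forall>u<n. \<forall>v<n. graph_dist G u v \<le> graph_dist H u v \<and>
                    graph_dist H u v \<le> graph_dist G u v + enat \<beta>)"

section \<open>The message-passing model\<close>

type_synonym bits = "bool list"

text \<open>In each round the coordinator sends a message to one player, and that player replies.
  A transcript lists the rounds \<open>(i, m, r)\<close>: addressed player, message, reply.\<close>

type_synonym transcript = "(nat \<times> bits \<times> bits) list"

datatype 'out action = Send nat bits | Output 'out

text \<open>A deterministic protocol. The next action of the coordinator is a function of the whole
  transcript. The reply of player \<open>i\<close> is a function of its input, of the earlier exchanges on its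
  own channel and of the message just received; it does not see the other channels.\<close>

datatype ('in, 'out) protocol = Protocol
  (coordinator: "transcript \<Rightarrow> 'out action")
  (player: "nat \<Rightarrow> 'in \<Rightarrow> (bits \<times> bits) list \<Rightarrow> bits \<Rightarrow> bits")

definition channel :: "nat \<Rightarrow> transcript \<Rightarrow> (bits \<times> bits) list" where
  "channel i t = map snd (filter (\<lambda>x. fst x = i) t)"

text \<open>Messages must be nonempty: otherwise the number of empty messages would convey information
  at no cost.\<close>

definition well_formed :: "nat \<Rightarrow> ('in, 'out) protocol \<Rightarrow> bool" where
  "well_formed s \<pi> \<longleftrightarrow>
     (\<forall>t i m. coordinator \<pi> t = Send i m \<longrightarrow> i < s \<and> m \<noteq> []) \<and>
     (\<forall>i<s. \<forall>x h m. player \<pi> i x h m \<noteq> [])"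

inductive reachable :: "('in, 'out) protocol \<Rightarrow> (nat \<Rightarrow> 'in) \<Rightarrow> transcript \<Rightarrow> bool"
  for \<pi> X where
  start: "reachable \<pi> X []"
| round: "reachable \<pi> X t \<Longrightarrow> coordinator \<pi> t = Send i m \<Longrightarrow>
            reachable \<pi> X (t @ [(i, m, player \<pi> i (X i) (channel i t) m)])"

definition halts_with :: "('in, 'out) protocol \<Rightarrow> (nat \<Rightarrow> 'in) \<Rightarrow> transcript \<Rightarrow> 'out \<Rightarrow> bool" where
  "halts_with \<pi> X t y \<longleftrightarrow> reachable \<pi> X t \<and> coordinator \<pi> t = Output y"

definition bits_exchanged :: "transcript \<Rightarrow> nat" where
  "bits_exchanged t = (\<Sum>(i, m, r)\<leftarrow>t. length m + length r)"

section \<open>Randomized communication cost of additive spanners\<close>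

text \<open>The players are \<open>0, \<dots>, s - 1\<close>. Their edge sets may overlap (duplication is allowed).\<close>

definition inputs :: "nat \<Rightarrow> nat \<Rightarrow> (nat \<Rightarrow> edges) set" where
  "inputs n s = {E. \<forall>i<s. E i \<subseteq> complete_edges n}"

definition input_graph :: "nat \<Rightarrow> (nat \<Rightarrow> edges) \<Rightarrow> edges" where
  "input_graph s E = (\<Union>i<s. E i)"

text \<open>A randomized (public-coin) protocol is a probability distribution on deterministic protocols.
  The bound \<open>C\<close> on the number of bits holds for all inputs and all outcomes of the coins.\<close>

definition spanner_protocol ::
  "nat \<Rightarrow> nat \<Rightarrow> nat \<Rightarrow> nat \<Rightarrow> (edges, edges) protocol pmf \<Rightarrow> bool" where
  "spanner_protocol n s \<beta> C p \<longleftrightarrow>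
     (\<forall>\<pi>\<in>set_pmf p. well_formed s \<pi> \<and>
        (\<forall>E\<in>inputs n s. \<exists>t H. halts_with \<pi> E t H \<and> bits_exchanged t \<le> C)) \<and>
     (\<forall>E\<in>inputs n s.
        measure_pmf.prob p
          {\<pi>. \<exists>t H. halts_with \<pi> E t H \<and> additive_spanner n \<beta> (input_graph s E) H} \<ge> 2 / 3)"

definition spanner_cost :: "nat \<Rightarrow> nat \<Rightarrow> nat \<Rightarrow> enat" where
  "spanner_cost n s \<beta> = Inf {enat C | C. \<exists>p. spanner_protocol n s \<beta> C p}"

end

theory Submission
  imports Defs "HOL-Real_Asymp.Real_Asymp" "HOL-Number_Theory.Cong"
begin

text \<open>Upper bound. From every player the coordinator collects up to about \<open>\<surd>n\<close> neighbours of every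
  vertex. This reveals all edges at a vertex of small degree, and it reveals about \<open>\<surd>n\<close> neighbours of
  any other vertex. A set of \<open>O(\<surd>n log n)\<close> centers meets all these large neighbourhoods, and a
  breadth-first search from a center costs \<open>O(s n log n)\<close> bits, because a player never reports a vertex
  twice. A shortest path which uses an edge that is not collected passes next to a center; the detour
  through the center costs \<open>2\<close>.

  Lower bound. The incidence graph of points and lines over a prime field has about \<open>n\<^sup>3\<^sup>/\<^sup>2\<close> edges and no
  cycle of length four, so an additive \<open>2\<close>-spanner of any of its subgraphs is the subgraph itself.
  Hence the coordinator has to compute the union of \<open>s\<close> subsets of these edges. For each player \<open>i\<close> the
  channel of \<open>i\<close> is a two-party protocol between \<open>i\<close> and all the others, who know the set \<open>Y\<close> of edges
  outside the union, while \<open>i\<close> does not. By Razborov's corruption argument for set disjointness, if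
  fewer bits than a small multiple of the number of edges pass through the channel, then
  planting one point of \<open>Y\<close> in the input of \<open>i\<close> mostly goes unnoticed. Averaging over \<open>i\<close> gives the
  factor \<open>s\<close>. When \<open>s\<close> is only logarithmic, counting the outputs suffices.\<close>

section \<open>Transcripts and their rectangles\<close>

text \<open>In two-party disjointness a second party holds \<open>Y\<close>; here nobody does. The
  other players only realise \<open>Y\<close>, as the complement of the union of their inputs, so a
  rectangle between player \<open>i\<close> and all the others stands in for a rectangle between the
  two sets. This reading fails only at points held by player \<open>i\<close> alone. With
  \<open>N\<close> edges their expected number is at most \<open>N * (2/3) ^ (s - 1)\<close>, which
  is why the argument asks for \<open>s\<close> above a multiple of \<open>ln n\<close> and a
  counting argument takes over below.

  Corruption compares two laws of the inputs, without and with a planted point. Success 2/3 under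
  both suffices and nothing has to be amplified, because \<open>9/10 * (2/3) + 2/3\<close> exceeds
  1. Each history costs an additive error exponentially small in \<open>N\<close>, and
  \<open>B\<close> bits allow at most \<open>4 ^ (B + 1)\<close> histories, so \<open>B\<close> may
  be a small multiple of \<open>N\<close>.\<close>

lemma reachable_take:
  assumes "reachable \<pi> X t"
  shows "reachable \<pi> X (take k t) \<and>
    (k < length t \<longrightarrow> (\<exists>i m. coordinator \<pi> (take k t) = Send i m))"
  using assms
proof (induction rule: reachable.induct)
  case start
  then show ?case by (simp add: reachable.start)
next
  case (round t i m)
  then show ?case
    by (cases "k < length t"; cases "k = length t")
       (auto intro: reachable.round reachable.intros)
qed

lemma reachable_unique:
  assumes "reachable \<pi> X t" "reachable \<pi> X t'" "length t = length t'"
  shows "t = t'"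
  using assms
proof (induction arbitrary: t' rule: reachable.induct)
  case start
  then show ?case by simp
next
  case (round t i m)
  from round.prems(1) show ?case
  proof cases
    case start
    then show ?thesis using round.prems(2) by simp
  next
    case (round u j m')
    then have "t = u" using \<open>length (t @ _) = length t'\<close> round.IH[of u] by simp
    then show ?thesis using round \<open>coordinator \<pi> t = Send i m\<close> by simp
  qed
qed

lemma halts_with_unique:
  assumes "halts_with \<pi> X t y" "halts_with \<pi> X t' y'"
  shows "t = t' \<and> y = y'"
proof -
  have le: "length t' \<le> length t"
    if "halts_with \<pi> X t y" "halts_with \<pi> X t' y'" for t t' y y'
  proof (rule ccontr)
    assume n: "\<not> ?thesis"
    have "reachable \<pi> X (take (length t) t')" "\<exists>i m. coordinator \<pi> (take (length t) t') = Send i m"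
      using reachable_take[of \<pi> X t' "length t"] that n by (auto simp: halts_with_def)
    moreover from this(1) have "take (length t) t' = t"
      using that n by (intro reachable_unique) (auto simp: halts_with_def)
    ultimately show False using that by (auto simp: halts_with_def)
  qed
  have "length t = length t'" using le[OF assms] le[OF assms(2,1)] by simp
  then have "t = t'" using assms reachable_unique by (auto simp: halts_with_def)
  then show ?thesis using assms by (simp add: halts_with_def)
qed

lemma reachable_reply:
  assumes "reachable \<pi> X t" "channel i t = h @ (m, r) # h'"
  shows "r = player \<pi> i (X i) h m"
  using assms
proof (induction arbitrary: h' rule: reachable.induct)
  case start
  then show ?case by (simp add: channel_def)
next
  case (round t j m')
  show ?case
  proof (cases "j = i \<and> h' = []")
    case True
    then show ?thesis using round.prems by (auto simp: channel_def)
  next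
    case False
    then obtain h'' where "channel i t = h @ (m, r) # h''"
      using round.prems by (cases h' rule: rev_cases) (auto simp: channel_def split: if_splits)
    then show ?thesis by (rule round.IH)
  qed
qed

text \<open>The rectangle property: a player may exchange its input for any other input with which
  its own channel has the same history, and the coordinator will not notice.\<close>

lemma reachable_fun_upd:
  assumes "reachable \<pi> X t" "reachable \<pi> X' t'" "channel i t' = channel i t @ h"
  shows "reachable \<pi> (X(i := X' i)) t"
  using assms(1,3)
proof (induction arbitrary: h rule: reachable.induct)
  case start
  show ?case by (rule reachable.start)
next
  case (round t j m)
  let ?r = "player \<pi> j (X j) (channel j t) m"
  have eq: "channel i (t @ [(j, m, ?r)]) = channel i t @ (if j = i then [(m, ?r)] else [])"
    by (simp add: channel_def)
  have r: "player \<pi> j ((X(i := X' i)) j) (channel j t) m = ?r"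
    using reachable_reply[OF assms(2), of i "channel i t" m ?r h] round.prems eq by auto
  have "reachable \<pi> (X(i := X' i)) t"
    using round.IH[of "(if j = i then [(m, ?r)] else []) @ h"] round.prems eq by (metis append.assoc)
  from reachable.round[OF this round.hyps(2)] show ?case
    by (simp only: r)
qed

lemma halts_with_fun_upd:
  assumes "halts_with \<pi> X t y" "halts_with \<pi> X' t' y'" "channel i t' = channel i t"
  shows "halts_with \<pi> (X(i := X' i)) t y"
  using assms reachable_fun_upd[of \<pi> X t X' t' i "[]"] by (simp add: halts_with_def)

section \<open>Counting the histories of a channel\<close>

definition history_bits :: "(bits \<times> bits) list \<Rightarrow> nat" where
  "history_bits h = (\<Sum>(m, r)\<leftarrow>h. length m + length r)"

lemma reachable_well_formed:
  assumes "reachable \<pi> X t" "well_formed s \<pi>"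
  shows "\<forall>(i, m, r)\<in>set t. i < s \<and> m \<noteq> [] \<and> r \<noteq> []"
  using assms(1)
  by (induction rule: reachable.induct) (use assms(2) in \<open>auto simp: well_formed_def\<close>)

lemma sum_history_bits_channel:
  assumes "\<forall>(i, m, r)\<in>set t. i < s"
  shows "(\<Sum>i<s. history_bits (channel i t)) = bits_exchanged t"
  using assms
proof (induction t)
  case Nil
  then show ?case by (simp add: history_bits_def channel_def bits_exchanged_def)
next
  case (Cons x t)
  obtain j m r where x: "x = (j, m, r)" by (cases x) auto
  have "history_bits (channel i (x # t)) =
      (if i = j then length m + length r else 0) + history_bits (channel i t)" for i
    by (simp add: history_bits_def channel_def x)
  then show ?case using Cons x by (simp add: sum.distrib bits_exchanged_def)
qed

text \<open>A flag on the first bit of every message makes a concatenation of nonempty messages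
  uniquely decodable. The price is an alphabet of four letters, hence the base 4 in every count of
  histories.\<close>

definition mark :: "'a list \<Rightarrow> (bool \<times> 'a) list" where
  "mark xs = (case xs of [] \<Rightarrow> [] | b # bs \<Rightarrow> (True, b) # map (Pair False) bs)"

lemma concat_mark_inject:
  assumes "concat (map mark xs) = concat (map mark ys)" "[] \<notin> set xs" "[] \<notin> set ys"
  shows "xs = ys"
  using assms
proof (induction xs arbitrary: ys)
  case Nil
  then show ?case by (cases ys) (auto simp: mark_def split: list.splits)
next
  case (Cons x xs)
  obtain y ys' where ys: "ys = y # ys'"
    using Cons.prems by (cases ys) (auto simp: mark_def split: list.splits)
  obtain b bs c cs where xy: "x = b # bs" "y = c # cs"
    using Cons.prems ys by (cases x; cases y) auto
  have tw: "takeWhile (\<lambda>z. \<not> fst z) (map (Pair False) as @ concat (map mark zs)) = map (Pair False) as"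
    if "[] \<notin> set zs" for as :: "'a list" and zs
    using that by (subst takeWhile_append2)
      (auto, cases zs, auto simp: mark_def split: list.splits)
  have eq: "map (Pair False) bs @ concat (map mark xs) = map (Pair False) cs @ concat (map mark ys')"
    and bc: "b = c"
    using Cons.prems(1) by (auto simp: ys xy mark_def[of "_ # _"])
  have m: "map (Pair False) bs = map (Pair False) cs"
    using tw[of xs bs] tw[of ys' cs] eq Cons.prems ys by auto
  then have "bs = cs" by (rule map_injective) (auto simp: inj_on_def)
  moreover have "xs = ys'" using eq m Cons ys by (intro Cons.IH) auto
  ultimately show ?case using ys xy bc by simp
qed

definition histories :: "nat \<Rightarrow> (bits \<times> bits) list set" where
  "histories B = {h. history_bits h \<le> B \<and> (\<forall>(m, r)\<in>set h. m \<noteq> [] \<and> r \<noteq> [])}"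

text \<open>Flattening a history to its alternating messages and replies and marking them is
  injective and preserves the number of bits. The histories thus embed into the words of length at
  most \<open>B\<close> over four letters.\<close>

lemma histories_finite_card: "finite (histories B) \<and> card (histories B) \<le> 4 ^ (B + 1)"
proof -
  define flat :: "(bits \<times> bits) list \<Rightarrow> bits list" where "flat h = concat (map (\<lambda>(m, r). [m, r]) h)" for h
  define enc where "enc h = concat (map mark (flat h))" for h
  have flat_inj: "flat h = flat h' \<Longrightarrow> h = h'" for h h'
    by (induction h arbitrary: h'; case_tac h') (auto simp: flat_def)
  have flat_ne: "[] \<notin> set (flat h)" if "h \<in> histories B" for h
    using that by (auto simp: flat_def histories_def)
  have inj: "inj_on enc (histories B)"
    using concat_mark_inject flat_inj flat_ne by (metis (no_types, lifting) enc_def inj_onI)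
  have "length (mark m) = length m" for m :: bits by (cases m) (auto simp: mark_def)
  then have len: "length (enc h) = history_bits h" for h
    by (induction h) (auto simp: enc_def flat_def history_bits_def)
  define L where "L = {xs :: (bool \<times> bool) list. set xs \<subseteq> UNIV \<and> length xs \<le> B}"
  have sub: "enc ` histories B \<subseteq> L" by (auto simp: len L_def histories_def)
  have finL: "finite L" unfolding L_def by (rule finite_lists_length_le) simp
  have "card L = (\<Sum>i\<le>B. 4 ^ i)" unfolding L_def
    by (subst card_lists_length_le) (simp_all add: UNIV_Times_UNIV[symmetric] card_cartesian_product del: UNIV_Times_UNIV)
  also have "\<dots> \<le> 4 ^ (B + 1)" by (induction B) auto
  finally have "card L \<le> 4 ^ (B + 1)" .
  moreover have "card (histories B) \<le> card L"
    using card_inj_on_le[OF inj sub finL] .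
  ultimately show ?thesis using inj_on_finite[OF inj sub finL] by simp
qed

section \<open>Averaging over the coins; the cost as an infimum\<close>

lemma integrable_of_bool_pmf:
  "integrable (measure_pmf p) (\<lambda>\<pi>. of_bool (P \<pi>) :: real)"
  by (rule measure_pmf.integrable_const_bound[where B=1]) auto

lemma expectation_of_bool:
  "measure_pmf.expectation p (\<lambda>\<pi>. of_bool (P \<pi>)) = measure_pmf.prob p {\<pi>. P \<pi>}"
proof -
  have "(\<lambda>\<pi>. of_bool (P \<pi>) :: real) = indicator {\<pi>. P \<pi>}" by (auto simp: indicator_def)
  then show ?thesis by simp
qed

text \<open>The easy half of Yao's principle: the weighted average of success probabilities is an
  expectation over the coins, so some outcome of the coins attains it.\<close>

lemma pmf_exists_sum_ge:
  fixes w :: "'b \<Rightarrow> real"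
  assumes A: "finite A" and w: "\<And>x. x \<in> A \<Longrightarrow> 0 \<le> w x"
    and q: "\<And>x. x \<in> A \<Longrightarrow> q \<le> measure_pmf.prob p {y. P y x}"
  shows "\<exists>y\<in>set_pmf p. q * sum w A \<le> (\<Sum>x\<in>A. w x * of_bool (P y x))"
proof (rule ccontr)
  assume "\<not> ?thesis"
  then have less: "AE y in measure_pmf p. (\<Sum>x\<in>A. w x * of_bool (P y x)) < q * sum w A"
    by (auto simp: AE_measure_pmf_iff not_le)
  have int: "integrable (measure_pmf p) (\<lambda>y. w x * of_bool (P y x))" for x
    by (intro integrable_mult_right integrable_of_bool_pmf)
  have "q * sum w A \<le> (\<Sum>x\<in>A. w x * measure_pmf.prob p {y. P y x})"
    using mult_left_mono[OF q w] by (auto simp: sum_distrib_left mult.commute intro!: sum_mono)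
  also have "\<dots> = measure_pmf.expectation p (\<lambda>y. \<Sum>x\<in>A. w x * of_bool (P y x))"
    using int by (subst Bochner_Integration.integral_sum) (auto simp: expectation_of_bool)
  also have "\<dots> < q * sum w A"
    using int less by (intro measure_pmf.expectation_less) auto
  finally show False by simp
qed

lemma enat_Inf_in:
  fixes A :: "enat set"
  assumes "A \<noteq> {}"
  shows "Inf A \<in> A"
proof -
  obtain a where "a \<in> A" using assms by blast
  then show ?thesis
    using LeastI[of "\<lambda>x. x \<in> A" a] assms unfolding Inf_enat_def by (simp only: if_False)
qed

lemma spanner_cost_geI:
  assumes "\<And>C p. spanner_protocol n s \<beta> C p \<Longrightarrow> x \<le> real C"
  shows "ereal x \<le> ereal_of_enat (spanner_cost n s \<beta>)"
proof (cases "spanner_cost n s \<beta>")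
  case (enat m)
  let ?A = "{enat C | C. \<exists>p. spanner_protocol n s \<beta> C p}"
  have "?A \<noteq> {}" using enat by (force simp: spanner_cost_def Inf_enat_def split: if_splits)
  then have "Inf ?A \<in> ?A" by (rule enat_Inf_in)
  then show ?thesis using enat assms by (auto simp: spanner_cost_def)
qed simp

lemma spanner_cost_leI:
  assumes "spanner_protocol n s \<beta> C p" "real C \<le> x"
  shows "ereal_of_enat (spanner_cost n s \<beta>) \<le> ereal x"
proof -
  have "spanner_cost n s \<beta> \<le> enat C"
    unfolding spanner_cost_def using assms(1) by (intro Inf_lower) auto
  then have "ereal_of_enat (spanner_cost n s \<beta>) \<le> ereal_of_enat (enat C)"
    by (simp only: ereal_of_enat_le_iff)
  also have "\<dots> \<le> ereal x" using assms(2) by simp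
  finally show ?thesis .
qed

section \<open>Corruption for set disjointness\<close>

definition cube_mean :: "'a set \<Rightarrow> ('a set \<Rightarrow> real) \<Rightarrow> real" where
  "cube_mean S f = (\<Sum>x\<in>Pow S. f x) / 2 ^ card S"

lemma sum_Pow_insert:
  fixes f :: "'a set \<Rightarrow> 'b::comm_monoid_add"
  assumes "finite S" "e \<notin> S"
  shows "(\<Sum>x\<in>Pow (insert e S). f x) = (\<Sum>x\<in>Pow S. f x) + (\<Sum>x\<in>Pow S. f (insert e x))"
proof -
  have "(\<Sum>x\<in>Pow (insert e S). f x) = (\<Sum>x\<in>Pow S. f x) + (\<Sum>x\<in>insert e ` Pow S. f x)"
    unfolding Pow_insert by (rule sum.union_disjoint) (use assms in auto)
  also have "(\<Sum>x\<in>insert e ` Pow S. f x) = (\<Sum>x\<in>Pow S. f (insert e x))"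
    using assms by (subst sum.reindex) (auto simp: inj_on_def)
  finally show ?thesis .
qed

text \<open>Generating function of \<open>card (x \<inter> J)\<close>: each element of
  \<open>J\<close> contributes a factor \<open>1 + u\<close>, each other element a factor 2.\<close>

lemma sum_Pow_power_card_Int:
  fixes u :: real
  assumes "finite S" "J \<subseteq> S"
  shows "(\<Sum>x\<in>Pow S. u ^ card (x \<inter> J)) = 2 ^ (card S - card J) * (1 + u) ^ card J"
  using assms
proof (induction S arbitrary: J rule: finite_induct)
  case empty
  then show ?case by simp
next
  case (insert a S)
  show ?case
  proof (cases "a \<in> J")
    case True
    define K where "K = J - {a}"
    have J: "J = insert a K" "a \<notin> K" "K \<subseteq> S" "finite K"
      using True insert by (auto simp: K_def intro: finite_subset)
    have "x \<inter> J = x \<inter> K" "insert a x \<inter> J = insert a (x \<inter> K)" if "x \<in> Pow S" for x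
      using that insert J by auto
    moreover have "card (insert a (x \<inter> K)) = Suc (card (x \<inter> K))" for x
      using J by simp
    ultimately have "(\<Sum>x\<in>Pow (insert a S). u ^ card (x \<inter> J))
        = (\<Sum>x\<in>Pow S. u ^ card (x \<inter> K)) + u * (\<Sum>x\<in>Pow S. u ^ card (x \<inter> K))"
      using insert by (simp add: sum_Pow_insert sum_distrib_left)
    also have "\<dots> = (1 + u) * (2 ^ (card S - card K) * (1 + u) ^ card K)"
      using insert.IH[OF J(3)] by (simp add: algebra_simps)
    finally show ?thesis using J insert by (simp add: algebra_simps)
  next
    case False
    then have J: "J \<subseteq> S" using insert by auto
    have "insert a x \<inter> J = x \<inter> J" for x using False by auto
    then have "(\<Sum>x\<in>Pow (insert a S). u ^ card (x \<inter> J)) = 2 * (\<Sum>x\<in>Pow S. u ^ card (x \<inter> J))"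
      using insert by (simp add: sum_Pow_insert)
    also have "\<dots> = 2 ^ (Suc (card S) - card J) * (1 + u) ^ card J"
      using insert.IH[OF J] card_mono[OF insert(1) J] by (simp add: Suc_diff_le)
    finally show ?thesis using insert by simp
  qed
qed

text \<open>For a random subset with density proportional to \<open>f\<close>, the ratio 19/20 says
  that \<open>e\<close> is a member with probability below 19/39 instead of 1/2;
  \<open>high_influence\<close> is the opposite bias, above 20/39.\<close>

definition low_influence :: "'a set \<Rightarrow> ('a set \<Rightarrow> real) \<Rightarrow> 'a set" where
  "low_influence S f =
     {e\<in>S. cube_mean (S - {e}) (\<lambda>x. f (insert e x)) < 19 / 20 * cube_mean (S - {e}) f}"

definition high_influence :: "'a set \<Rightarrow> ('a set \<Rightarrow> real) \<Rightarrow> 'a set" where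
  "high_influence S f =
     {e\<in>S. cube_mean (S - {e}) f < 19 / 20 * cube_mean (S - {e}) (\<lambda>x. f (insert e x))}"

lemma cube_mean_nonneg: "(\<And>x. 0 \<le> f x) \<Longrightarrow> 0 \<le> cube_mean S f"
  by (auto simp: cube_mean_def intro!: divide_nonneg_nonneg sum_nonneg)

lemma cube_mean_le_1:
  assumes "finite S" "\<And>x. f x \<le> 1"
  shows "cube_mean S f \<le> 1"
proof -
  have "(\<Sum>x\<in>Pow S. f x) \<le> (\<Sum>x\<in>Pow S. 1)" using assms by (intro sum_mono) auto
  then show ?thesis using assms by (simp add: cube_mean_def card_Pow)
qed

lemma cube_mean_split:
  assumes "finite S" "e \<in> S"
  shows "cube_mean S f =
    (cube_mean (S - {e}) f + cube_mean (S - {e}) (\<lambda>x. f (insert e x))) / 2"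
proof -
  have S: "S = insert e (S - {e})" using assms by auto
  have c: "(2::real) ^ card S = 2 * 2 ^ card (S - {e})" using assms
    by (metis card_Suc_Diff1 power_Suc)
  show ?thesis unfolding cube_mean_def
    by (subst S, subst sum_Pow_insert) (use assms c in \<open>auto simp: add_divide_distrib\<close>)
qed

text \<open>The exponential moment of \<open>card (x \<inter> J)\<close> under the density \<open>f\<close>, bounded from below by
  convexity and from above by dropping \<open>f \<le> 1\<close>; the base \<open>19/20\<close> makes the two bounds
  incompatible for a dense \<open>f\<close>.\<close>

lemma card_low_influence:
  assumes S: "finite S" and f: "\<And>x. 0 \<le> f x" "\<And>x. f x \<le> 1"
  shows "cube_mean S f ^ 39 \<le> ((39/40) ^ 39 / (19/20) ^ 19) ^ card (low_influence S f)"
proof -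
  define J where "J = low_influence S f"
  define M where "M = (\<Sum>x\<in>Pow S. f x)"
  define k where "k = 19 / 39 * real (card J)"
  \<comment> \<open>19/20 is the odds ratio of the frequency 19/39, and as such the minimizer
    \<open>u\<close> of the Chernoff factor \<open>(1 + u) / 2 * u powr (- 19/39)\<close>.\<close>
  define l where "l = - ln (19/20::real)"
  have l: "l > 0" unfolding l_def by simp
  have JS: "J \<subseteq> S" "finite J" using S by (auto simp: J_def low_influence_def intro: finite_subset)
  have M0: "M \<ge> 0" unfolding M_def using f by (intro sum_nonneg) auto
  have "(\<Sum>x\<in>Pow S. f x * (if e \<in> x then 1 else 0)) \<le> 19/39 * M" if "e \<in> J" for e
  proof -
    have e: "e \<in> S" using that JS by auto
    have Seq: "S = insert e (S - {e})" using e by auto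
    let ?a = "\<Sum>x\<in>Pow (S - {e}). f x" and ?b = "\<Sum>x\<in>Pow (S - {e}). f (insert e x)"
    have "(\<Sum>x\<in>Pow S. f x * (if e \<in> x then 1 else 0)) = ?b"
      by (subst Seq, subst sum_Pow_insert) (use S in \<open>auto intro!: sum.neutral\<close>)
    moreover have "M = ?a + ?b" unfolding M_def
      by (subst Seq, subst sum_Pow_insert) (use S in auto)
    moreover have "?b < 19/20 * ?a"
      using that by (auto simp: J_def low_influence_def cube_mean_def divide_simps)
    ultimately show ?thesis by simp
  qed
  then have "(\<Sum>e\<in>J. \<Sum>x\<in>Pow S. f x * (if e \<in> x then 1 else 0)) \<le> (\<Sum>e\<in>J. 19/39 * M)"
    by (intro sum_mono)
  also have "\<dots> = M * k" by (simp add: k_def)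
  also have "(\<Sum>e\<in>J. \<Sum>x\<in>Pow S. f x * (if e \<in> x then 1 else 0))
      = (\<Sum>x\<in>Pow S. f x * real (card (x \<inter> J)))"
    by (subst sum.swap)
       (use JS in \<open>auto simp: sum_distrib_left[symmetric] sum.If_cases Int_commute
          intro!: sum.cong arg_cong[where f="(*) _"]\<close>)
  finally have mean: "(\<Sum>x\<in>Pow S. f x * real (card (x \<inter> J))) \<le> M * k" .
  have pw: "(19/20::real) ^ m = exp (- l * real m)" for m
    unfolding l_def by (simp add: exp_of_nat_mult[symmetric] mult.commute) (simp add: exp_of_nat_mult)
  \<comment> \<open>Jensen's inequality in tangent form: \<open>exp (- l * z)\<close> lies above its
    tangent at \<open>z = k\<close>, and the linear term only helps since the mean of
    \<open>card (x \<inter> J)\<close> is at most \<open>k\<close>.\<close>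
  have "exp (- l * k) * M \<le> exp (- l * k) * (M - l * ((\<Sum>x\<in>Pow S. f x * real (card (x \<inter> J))) - M * k))"
    using mean l by (simp add: mult_le_0_iff)
  also have "\<dots> = (\<Sum>x\<in>Pow S. f x * (exp (- l * k) * (1 - l * (real (card (x \<inter> J)) - k))))"
    by (simp add: M_def algebra_simps sum_distrib_left sum_distrib_right sum.distrib sum_subtractf)
  also have "\<dots> \<le> (\<Sum>x\<in>Pow S. f x * (19/20) ^ card (x \<inter> J))"
  proof (intro sum_mono mult_left_mono f)
    fix x
    have "1 - l * (real (card (x \<inter> J)) - k) \<le> exp (- (l * (real (card (x \<inter> J)) - k)))"
      using exp_ge_add_one_self[of "- (l * (real (card (x \<inter> J)) - k))"] by simp
    then have "exp (- l * k) * (1 - l * (real (card (x \<inter> J)) - k)) \<le>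
       exp (- l * k) * exp (- (l * (real (card (x \<inter> J)) - k)))" by (intro mult_left_mono) auto
    also have "\<dots> = (19/20) ^ card (x \<inter> J)"
      unfolding pw exp_add[symmetric] by (simp add: algebra_simps)
    finally show "exp (- l * k) * (1 - l * (real (card (x \<inter> J)) - k)) \<le> (19/20) ^ card (x \<inter> J)" .
  qed
  also have "\<dots> \<le> (\<Sum>x\<in>Pow S. (19/20) ^ card (x \<inter> J))"
    using f by (intro sum_mono) (simp add: mult_left_le_one_le)
  also have "\<dots> = 2 ^ (card S - card J) * (39/20) ^ card J"
    using sum_Pow_power_card_Int[OF S JS(1), of "19/20"] by simp
  also have "\<dots> = 2 ^ card S * (39/40) ^ card J"
  proof -
    have "card S = (card S - card J) + card J" using card_mono[OF S JS(1)] by simp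
    then have "(2::real) ^ card S = 2 ^ (card S - card J) * 2 ^ card J" by (metis power_add)
    then show ?thesis by (simp add: power_divide field_simps power_mult_distrib[symmetric])
  qed
  finally have "exp (- l * k) * cube_mean S f \<le> (39/40) ^ card J"
    by (simp add: cube_mean_def M_def field_simps)
  \<comment> \<open>The power 39 clears the denominator of \<open>k\<close>. The factor 39/40 is the
    mean of 1 and 19/20.\<close>
  then have "(exp (- l * k) * cube_mean S f) ^ 39 \<le> ((39/40) ^ card J) ^ 39"
    by (intro power_mono mult_nonneg_nonneg cube_mean_nonneg f) auto
  moreover have "exp (- l * k) ^ 39 = ((19/20) ^ 19) ^ card J"
  proof -
    have "exp (- l * k) ^ 39 = exp (- l * real (19 * card J))"
      by (subst exp_of_nat_mult[symmetric]) (simp add: k_def)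
    then show ?thesis by (simp only: pw[symmetric] power_mult)
  qed
  moreover have "((39/40::real) ^ card J) ^ 39 = ((39/40) ^ 39) ^ card J"
    by (simp only: power_mult[symmetric] mult.commute)
  ultimately have "((19/20) ^ 19) ^ card J * cube_mean S f ^ 39 \<le> ((39/40) ^ 39) ^ card J"
    by (simp only: power_mult_distrib)
  moreover have "c \<le> (q / a) ^ m" if "a ^ m * c \<le> q ^ m" "a > 0" for a c q :: real and m
    using that by (simp add: power_divide field_simps)
  moreover have "(19/20::real) ^ 19 > 0" by (intro zero_less_power) simp
  ultimately show ?thesis
    unfolding J_def by blast
qed

lemma cube_mean_complement:
  assumes "finite S"
  shows "cube_mean S (\<lambda>x. f (S - x)) = cube_mean S f"
  unfolding cube_mean_def using assms
  by (intro arg_cong2[where f="(/)"] refl sum.reindex_bij_witness[where i="\<lambda>x. S - x" and j="\<lambda>x. S - x"])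
     (auto simp: double_diff)

text \<open>Passing from \<open>x\<close> to \<open>S - x\<close> preserves the mean and exchanges
  the two biases.\<close>

lemma card_high_influence:
  assumes S: "finite S" and f: "\<And>x. 0 \<le> f x" "\<And>x. f x \<le> 1"
  shows "cube_mean S f ^ 39 \<le> ((39/40) ^ 39 / (19/20) ^ 19) ^ card (high_influence S f)"
proof -
  have "cube_mean (S - {e}) (\<lambda>x. f (S - insert e x)) = cube_mean (S - {e}) f"
       "cube_mean (S - {e}) (\<lambda>x. f (S - x)) = cube_mean (S - {e}) (\<lambda>x. f (insert e x))"
    if "e \<in> S" for e
  proof -
    have "(\<lambda>x. f (S - insert e x)) = (\<lambda>x. f ((S - {e}) - x))"
      by (intro ext arg_cong[where f=f]) blast
    then show "cube_mean (S - {e}) (\<lambda>x. f (S - insert e x)) = cube_mean (S - {e}) f"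
      using cube_mean_complement[of "S - {e}" f] S by simp
    have "cube_mean (S - {e}) (\<lambda>x. f (S - x)) = cube_mean (S - {e}) (\<lambda>x. f (insert e ((S - {e}) - x)))"
      unfolding cube_mean_def using that
      by (intro arg_cong2[where f="(/)"] refl sum.cong arg_cong[where f=f]) auto
    also have "\<dots> = cube_mean (S - {e}) (\<lambda>x. f (insert e x))"
      using S by (intro cube_mean_complement) auto
    finally show "cube_mean (S - {e}) (\<lambda>x. f (S - x)) = cube_mean (S - {e}) (\<lambda>x. f (insert e x))" .
  qed
  then have "high_influence S f = low_influence S (\<lambda>x. f (S - x))"
    by (auto simp: high_influence_def low_influence_def)
  then show ?thesis
    using card_low_influence[OF S, of "\<lambda>x. f (S - x)"] f cube_mean_complement[OF S, of f] by simp
qed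

definition influential :: "'a set \<Rightarrow> ('a set \<Rightarrow> real) \<Rightarrow> 'a set" where
  "influential S f = low_influence S f \<union> high_influence S f"

text \<open>\<open>\<theta>\<close> solves \<open>(\<theta> ^ N) ^ 39 = q powr (N / 6400)\<close>,
  so a mean above \<open>\<theta> ^ N\<close> leaves room for at most \<open>N / 6400\<close>
  coordinates of each bias. The exponent \<open>N\<close> is not tied to \<open>card S\<close>,
  because \<open>S\<close> will be a random part of a ground set with \<open>N\<close> points. The
  value 3200 is what later turns \<open>(19/20)^2\<close> into 9/10.\<close>

lemma card_influential:
  obtains \<theta> :: real where "0 < \<theta>" "\<theta> < 1"
    "\<And>(S::'a set) f N. \<lbrakk>finite S; \<And>x. 0 \<le> f x; \<And>x. f x \<le> 1; \<theta> ^ N < cube_mean S f\<rbrakk>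
       \<Longrightarrow> real (card (influential S f)) \<le> real N / 3200"
proof -
  define q :: real where "q = (39/40) ^ 39 / (19/20) ^ 19"
  have q: "0 < q" "q < 1" unfolding q_def by (simp_all add: field_simps)
  define \<theta> where "\<theta> = q powr (1 / (39 * 6400))"
  have \<theta>: "0 < \<theta>" "\<theta> < 1" using q 
    using powr_less_mono'[of q 0 "1 / (39 * 6400)"] by (auto simp: \<theta>_def)
  have half: "real c \<le> real N / 6400" if F: "F ^ 39 \<le> q ^ c" "\<theta> ^ N < F" for c N and F :: real
  proof (rule ccontr)
    assume "\<not> ?thesis"
    then have "q powr real c \<le> q powr (real N / 6400)" using q by (intro powr_mono') auto
    moreover have "(\<theta> ^ N) ^ 39 = q powr (real N / 6400)"
    proof -
      have "(\<theta> ^ N) ^ 39 = \<theta> powr real (N * 39)"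
        using \<theta>(1) by (simp only: power_mult[symmetric] powr_realpow)
      then show ?thesis using q by (simp add: \<theta>_def powr_powr)
    qed
    ultimately have "F ^ 39 \<le> (\<theta> ^ N) ^ 39"
      using F(1) q by (simp only: powr_realpow)
    moreover have "(\<theta> ^ N) ^ 39 < F ^ 39" using F(2) \<theta> by (intro power_strict_mono) auto
    ultimately show False by linarith
  qed
  have "real (card (influential S f)) \<le> real N / 3200"
    if "finite S" "\<And>x. 0 \<le> f x" "\<And>x. f x \<le> 1" "\<theta> ^ N < cube_mean S f" for S :: "'a set" and f N
  proof -
    have "card (influential S f) \<le> card (low_influence S f) + card (high_influence S f)"
      unfolding influential_def by (rule card_Un_le)
    moreover have "real (card (low_influence S f)) \<le> real N / 6400"
      using card_low_influence[OF that(1-3)] that(4) unfolding q_def[symmetric] by (rule half)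
    moreover have "real (card (high_influence S f)) \<le> real N / 6400"
      using card_high_influence[OF that(1-3)] that(4) unfolding q_def[symmetric] by (rule half)
    ultimately show ?thesis by linarith
  qed
  with \<theta> that show thesis by blast
qed

text \<open>Razborov's law of disjoint pairs: \<open>S\<close> splits the ground set at random, and
  given \<open>S\<close> the two sets are independent, so a product weight has a product mean.
  \<open>planted_mean\<close> adds one random common point to such a pair on the remaining
  points.\<close>

definition disjoint_mean :: "'a set \<Rightarrow> ('a set \<Rightarrow> real) \<Rightarrow> ('a set \<Rightarrow> real) \<Rightarrow> real" where
  "disjoint_mean \<Omega> f g = cube_mean \<Omega> (\<lambda>S. cube_mean S f * cube_mean (\<Omega> - S) g)"

definition planted_mean :: "'a set \<Rightarrow> ('a set \<Rightarrow> real) \<Rightarrow> ('a set \<Rightarrow> real) \<Rightarrow> real" where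
  "planted_mean \<Omega> f g =
     (\<Sum>e\<in>\<Omega>. disjoint_mean (\<Omega> - {e}) (\<lambda>x. f (insert e x)) (\<lambda>y. g (insert e y))) / card \<Omega>"

text \<open>Double counting of the pairs with \<open>e \<in> S\<close>. It trades a point outside a
  random set for a member of a random set, where influential points can be counted.\<close>

lemma sum_pointed_subsets:
  fixes \<phi> :: "'a \<Rightarrow> 'a set \<Rightarrow> 'b::comm_monoid_add"
  assumes "finite \<Omega>"
  shows "(\<Sum>e\<in>\<Omega>. \<Sum>S\<in>Pow (\<Omega> - {e}). \<phi> e (insert e S)) = (\<Sum>S\<in>Pow \<Omega>. \<Sum>e\<in>S. \<phi> e S)"
proof -
  have fin: "finite S" if "S \<in> Pow \<Omega>" for S using that assms by (auto intro: finite_subset)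
  have "(\<Sum>e\<in>\<Omega>. \<Sum>S\<in>Pow (\<Omega> - {e}). \<phi> e (insert e S))
      = (\<Sum>(e,S)\<in>Sigma \<Omega> (\<lambda>e. Pow (\<Omega> - {e})). \<phi> e (insert e S))"
    using assms by (intro sum.Sigma) auto
  also have "\<dots> = (\<Sum>(S,e)\<in>Sigma (Pow \<Omega>) (\<lambda>S. S). \<phi> e S)"
    by (rule sum.reindex_bij_witness[where i="\<lambda>(S,e). (e, S - {e})" and j="\<lambda>(e,S). (insert e S, e)"])
       (auto simp: insert_absorb)
  also have "\<dots> = (\<Sum>S\<in>Pow \<Omega>. \<Sum>e\<in>S. \<phi> e S)"
    using assms fin by (intro sum.Sigma[symmetric]) auto
  finally show ?thesis .
qed

lemma cube_mean_mono: "(\<And>x. x \<subseteq> S \<Longrightarrow> f x \<le> g x) \<Longrightarrow> cube_mean S f \<le> cube_mean S g"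
  unfolding cube_mean_def by (intro divide_right_mono sum_mono) auto

lemma cube_mean_add: "cube_mean S (\<lambda>x. f x + g x) = cube_mean S f + cube_mean S g"
  by (simp add: cube_mean_def sum.distrib add_divide_distrib)

lemma cube_mean_cmult: "cube_mean S (\<lambda>x. c * f x) = c * cube_mean S f"
  by (simp add: cube_mean_def sum_distrib_left)

lemma cube_mean_divide: "cube_mean S (\<lambda>x. f x / c) = cube_mean S f / c"
  by (simp add: cube_mean_def sum_divide_distrib mult.commute)

lemma cube_mean_cong: "(\<And>x. x \<subseteq> S \<Longrightarrow> f x = g x) \<Longrightarrow> cube_mean S f = cube_mean S g"
  unfolding cube_mean_def by (intro arg_cong2[where f="(/)"] sum.cong) auto

lemma disjoint_mean_commute:
  assumes "finite \<Omega>"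
  shows "disjoint_mean \<Omega> f g = disjoint_mean \<Omega> g f"
  unfolding disjoint_mean_def
  by (subst cube_mean_complement[OF assms, symmetric])
     (intro cube_mean_cong, simp add: double_diff)

text \<open>Exceptional coordinates cost little for two different reasons. Where \<open>f\<close>
  has mean above \<open>\<theta> ^ card \<Omega>\<close> on \<open>S\<close>, they are few;
  elsewhere \<open>S\<close> carries so little weight that all its points may be
  exceptional.\<close>

lemma sum_influential:
  fixes \<theta> :: real
  assumes \<Omega>: "finite \<Omega>" and f: "\<And>x. 0 \<le> f x" "\<And>x. f x \<le> 1"
    and g: "\<And>x. 0 \<le> g x" "\<And>x. g x \<le> 1"
    and \<theta>: "0 < \<theta>" and bound: "\<And>S. \<lbrakk>finite S; \<theta> ^ card \<Omega> < cube_mean S f\<rbrakk>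
       \<Longrightarrow> real (card (influential S f)) \<le> real (card \<Omega>) / 3200"
  shows "(\<Sum>e\<in>\<Omega>. \<Sum>S\<in>Pow (\<Omega> - {e}). of_bool (e \<in> influential (insert e S) f) *
            (cube_mean (insert e S) f * cube_mean (\<Omega> - insert e S) g))
       \<le> real (card \<Omega>) * 2 ^ card \<Omega> * (disjoint_mean \<Omega> f g / 3200 + \<theta> ^ card \<Omega>)"
    (is "?L \<le> _")
proof -
  let ?N = "real (card \<Omega>)"
  define H where "H S = cube_mean S f * cube_mean (\<Omega> - S) g" for S
  have H0: "H S \<ge> 0" for S unfolding H_def by (intro mult_nonneg_nonneg cube_mean_nonneg f g)
  have "?L = (\<Sum>S\<in>Pow \<Omega>. \<Sum>e\<in>S. of_bool (e \<in> influential S f) * H S)"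
    unfolding H_def by (rule sum_pointed_subsets[OF \<Omega>])
  also have "\<dots> \<le> (\<Sum>S\<in>Pow \<Omega>. ?N / 3200 * H S + ?N * \<theta> ^ card \<Omega>)"
  proof (intro sum_mono)
    fix S assume S: "S \<in> Pow \<Omega>"
    then have fS: "finite S" using \<Omega> by (auto intro: finite_subset)
    have sub: "influential S f \<subseteq> S"
      by (auto simp: influential_def low_influence_def high_influence_def)
    have "(\<Sum>e\<in>S. of_bool (e \<in> influential S f) * H S) = real (card (influential S f)) * H S"
      using fS sub by (simp add: of_bool_def sum_distrib_right[symmetric] sum.If_cases inf_absorb2
        flip: Int_def)
    also have "\<dots> \<le> ?N / 3200 * H S + ?N * \<theta> ^ card \<Omega>"
    proof (cases "\<theta> ^ card \<Omega> < cube_mean S f")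
      case True
      have "real (card (influential S f)) * H S \<le> ?N / 3200 * H S"
        using bound[OF fS True] H0 by (intro mult_right_mono)
      moreover have "?N * \<theta> ^ card \<Omega> \<ge> 0" using \<theta> by simp
      ultimately show ?thesis by linarith
    next
      case False
      have "H S \<le> \<theta> ^ card \<Omega> * 1"
        unfolding H_def using False \<Omega> f g \<theta>
        by (intro mult_mono cube_mean_le_1 cube_mean_nonneg) auto
      moreover have "card (influential S f) \<le> card \<Omega>"
        using sub S \<Omega> by (intro card_mono) auto
      ultimately have "real (card (influential S f)) * H S \<le> ?N * \<theta> ^ card \<Omega>"
        using H0 by (intro mult_mono) auto
      moreover have "?N / 3200 * H S \<ge> 0" using H0 by simp
      ultimately show ?thesis by linarith
    qed
    finally show "(\<Sum>e\<in>S. of_bool (e \<in> influential S f) * H S) \<le> ?N / 3200 * H S + ?N * \<theta> ^ card \<Omega>" .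
  qed
  also have "\<dots> = ?N * 2 ^ card \<Omega> * (disjoint_mean \<Omega> f g / 3200 + \<theta> ^ card \<Omega>)"
    using \<Omega> unfolding disjoint_mean_def cube_mean_def[of \<Omega>] H_def[symmetric]
    by (simp add: sum.distrib sum_distrib_left[symmetric] sum_divide_distrib[symmetric] card_Pow
        distrib_left)
  finally show ?thesis .
qed

text \<open>Indices 0 and 1 stand for means over sets without and with a point \<open>e\<close>;
  \<open>P\<close> and \<open>Q\<close> say that \<open>e\<close> is exceptional for
  \<open>f\<close> or \<open>g\<close>. Without exceptions each factor moves from 0 to 1 at the
  price 19/20. Otherwise an error term absorbs the loss; in it the exceptional factor lives on the
  side that contains \<open>e\<close>, as \<open>sum_influential\<close> requires.\<close>

lemma corruption_pointwise:
  fixes f0 f1 g0 g1 :: real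
  assumes "0 \<le> f0" "0 \<le> f1" "0 \<le> g0" "0 \<le> g1"
    and P: "\<not> P \<Longrightarrow> 19/20 * f0 \<le> f1 \<and> 19/20 * f1 \<le> f0"
    and Q: "\<not> Q \<Longrightarrow> 19/20 * g0 \<le> g1 \<and> 19/20 * g1 \<le> g0"
  shows "361/400 * ((f0 * ((g0 + g1) / 2) + (f0 + f1) / 2 * g0) / 2)
    \<le> f1 * g1 + 2 * (of_bool P * ((f0 + f1) / 2 * g0)) + 2 * (of_bool Q * (f0 * ((g0 + g1) / 2)))"
proof -
  have nn: "0 \<le> f0 * g0" "0 \<le> f0 * g1" "0 \<le> f1 * g0" "0 \<le> f1 * g1" using assms by auto
  have l: "361/400 * ((f0 * ((g0 + g1) / 2) + (f0 + f1) / 2 * g0) / 2)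
      = 361/400 * (f0 * g0 / 2 + f0 * g1 / 4 + f1 * g0 / 4)"
    "(f0 + f1) / 2 * g0 = f0 * g0 / 2 + f1 * g0 / 2"
    "f0 * ((g0 + g1) / 2) = f0 * g0 / 2 + f0 * g1 / 2" by (simp_all add: field_simps)
  consider "P" "Q" | "P" "\<not> Q" | "\<not> P" "Q" | "\<not> P" "\<not> Q" by blast
  then show ?thesis
  proof cases
    case 1
    then show ?thesis unfolding l using nn by simp
  next
    case 2
    from Q[OF 2(2)] have "f0 * (19/20 * g1) \<le> f0 * g0" using assms by (intro mult_left_mono) auto
    then show ?thesis unfolding l using nn 2 by simp
  next
    case 3
    from P[OF 3(1)] have "(19/20 * f1) * g0 \<le> f0 * g0" using assms by (intro mult_right_mono) auto
    then show ?thesis unfolding l using nn 3 by simp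
  next
    case 4
    have a: "(19/20 * f0) * g1 \<le> f1 * g1" using P[OF 4(1)] assms by (intro mult_right_mono) auto
    have b: "f1 * (19/20 * g0) \<le> f1 * g1" using Q[OF 4(2)] assms by (intro mult_left_mono) auto
    have c: "(19/20 * f0) * g0 \<le> f1 * g0" using P[OF 4(1)] assms by (intro mult_right_mono) auto
    show ?thesis unfolding l using nn 4 a b c by simp
  qed
qed

text \<open>Razborov's argument for set disjointness: a combinatorial rectangle (here a product weight
  \<open>f x * g y\<close>) which is not exponentially small has nearly as much mass on the pairs meeting in
  one planted point as on the disjoint pairs. The coordinate \<open>e\<close> is exceptional for one of
  the factors on few \<open>e\<close> only, because the side \<open>S\<close> of that factor does not reveal \<open>e\<close>.\<close>

lemma corruption:
  obtains \<theta> :: real where "0 < \<theta>" "\<theta> < 1"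
    "\<And>(\<Omega>::'a set) f g. \<lbrakk>finite \<Omega>; \<Omega> \<noteq> {}; \<And>x. 0 \<le> f x; \<And>x. f x \<le> 1; \<And>x. 0 \<le> g x; \<And>x. g x \<le> 1\<rbrakk>
       \<Longrightarrow> 9/10 * disjoint_mean \<Omega> f g \<le> planted_mean \<Omega> f g + 8 * \<theta> ^ card \<Omega>"
proof -
  obtain \<theta> :: real where \<theta>: "0 < \<theta>" "\<theta> < 1"
    and infl: "\<And>(S::'a set) f N. \<lbrakk>finite S; \<And>x. 0 \<le> f x; \<And>x. f x \<le> 1; \<theta> ^ N < cube_mean S f\<rbrakk>
       \<Longrightarrow> real (card (influential S f)) \<le> real N / 3200"
    using card_influential[where 'a='a] by blast
  have "9/10 * disjoint_mean \<Omega> f g \<le> planted_mean \<Omega> f g + 8 * \<theta> ^ card \<Omega>"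
    if \<Omega>: "finite \<Omega>" "\<Omega> \<noteq> {}" and f: "\<And>x. 0 \<le> f x" "\<And>x. f x \<le> 1"
      and g: "\<And>x. 0 \<le> g x" "\<And>x. g x \<le> 1" for \<Omega> :: "'a set" and f g
  proof -
    define N where "N = card \<Omega>"
    have N: "N > 0" using \<Omega> by (simp add: N_def card_gt_0_iff)
    define D where "D = disjoint_mean \<Omega> f g"
    define Ef where "Ef e S = of_bool (e \<in> influential (insert e S) f) *
            (cube_mean (insert e S) f * cube_mean (\<Omega> - insert e S) g)" for e S
    define Eg where "Eg e S = of_bool (e \<in> influential (insert e S) g) *
            (cube_mean (insert e S) g * cube_mean (\<Omega> - insert e S) f)" for e S
    have split: "361/400 * D \<le>
        disjoint_mean (\<Omega> - {e}) (\<lambda>x. f (insert e x)) (\<lambda>y. g (insert e y))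
        + 2 * cube_mean (\<Omega> - {e}) (Ef e) + 2 * cube_mean (\<Omega> - {e}) (Eg e)" if e: "e \<in> \<Omega>" for e
    proof -
      define \<Omega>' where "\<Omega>' = \<Omega> - {e}"
      have \<Omega>': "finite \<Omega>'" "\<Omega> = insert e \<Omega>'" "e \<notin> \<Omega>'" using \<Omega> e by (auto simp: \<Omega>'_def)
      \<comment> \<open>Conditioning on whether the split deals \<open>e\<close> to the side of
        \<open>g\<close> or to the side of \<open>f\<close>.\<close>
      have D: "D = cube_mean \<Omega>' (\<lambda>S. (cube_mean S f * cube_mean (\<Omega> - S) g
          + cube_mean (insert e S) f * cube_mean (\<Omega> - insert e S) g) / 2)"
        unfolding D_def disjoint_mean_def cube_mean_split[OF \<Omega>(1) e] \<Omega>'_def[symmetric]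
        by (simp only: cube_mean_add cube_mean_divide)
      have "361/400 * D = cube_mean \<Omega>' (\<lambda>S. 361/400 * ((cube_mean S f * cube_mean (\<Omega> - S) g
          + cube_mean (insert e S) f * cube_mean (\<Omega> - insert e S) g) / 2))"
        unfolding D by (rule cube_mean_cmult[symmetric])
      also have "\<dots> \<le> cube_mean \<Omega>' (\<lambda>S.
          cube_mean S (\<lambda>x. f (insert e x)) * cube_mean (\<Omega>' - S) (\<lambda>y. g (insert e y))
          + 2 * Ef e S + 2 * Eg e (\<Omega>' - S))"
      proof (rule cube_mean_mono)
        fix S assume S: "S \<subseteq> \<Omega>'"
        define R where "R = \<Omega>' - S"
        have fin: "finite S" "finite R"
          using finite_subset[OF S \<Omega>'(1)] finite_Diff[OF \<Omega>'(1), of S] by (simp_all only: R_def)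
        have eS: "e \<notin> S" "e \<notin> R" using S \<Omega>' by (auto simp: R_def)
        have R: "\<Omega> - S = insert e R" "\<Omega> - insert e S = R" "\<Omega> - insert e R = S"
          using S \<Omega>' by (auto simp: R_def)
        have ins: "insert e S - {e} = S" "insert e R - {e} = R" using eS by auto
        have spl: "cube_mean (insert e S) f = (cube_mean S f + cube_mean S (\<lambda>x. f (insert e x))) / 2"
             "cube_mean (insert e R) g = (cube_mean R g + cube_mean R (\<lambda>x. g (insert e x))) / 2"
          using cube_mean_split[of "insert e S" e f] cube_mean_split[of "insert e R" e g] fin
          by (simp_all add: ins)
        have inflf: "19/20 * cube_mean S f \<le> cube_mean S (\<lambda>x. f (insert e x)) \<and>
          19/20 * cube_mean S (\<lambda>x. f (insert e x)) \<le> cube_mean S f"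
          if "\<not> e \<in> influential (insert e S) f"
          using that by (auto simp: influential_def low_influence_def high_influence_def ins)
        have inflg: "19/20 * cube_mean R g \<le> cube_mean R (\<lambda>x. g (insert e x)) \<and>
          19/20 * cube_mean R (\<lambda>x. g (insert e x)) \<le> cube_mean R g"
          if "\<not> e \<in> influential (insert e R) g"
          using that by (auto simp: influential_def low_influence_def high_influence_def ins)
        show "361/400 * ((cube_mean S f * cube_mean (\<Omega> - S) g
          + cube_mean (insert e S) f * cube_mean (\<Omega> - insert e S) g) / 2) \<le>
          cube_mean S (\<lambda>x. f (insert e x)) * cube_mean (\<Omega>' - S) (\<lambda>y. g (insert e y))
          + 2 * Ef e S + 2 * Eg e (\<Omega>' - S)"
          unfolding Ef_def Eg_def R R_def[symmetric] spl
          using corruption_pointwise[OF cube_mean_nonneg cube_mean_nonneg cube_mean_nonneg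
              cube_mean_nonneg inflf inflg] f g
          by (simp add: mult.commute)
      qed
      also have "\<dots> = disjoint_mean \<Omega>' (\<lambda>x. f (insert e x)) (\<lambda>y. g (insert e y))
        + 2 * cube_mean \<Omega>' (Ef e) + 2 * cube_mean \<Omega>' (\<lambda>S. Eg e (\<Omega>' - S))"
        by (simp add: cube_mean_add cube_mean_cmult disjoint_mean_def)
      finally show ?thesis
        using cube_mean_complement[OF \<Omega>'(1), of "Eg e"] by (simp add: \<Omega>'_def)
    qed
    have "real N * (361/400 * D) = (\<Sum>e\<in>\<Omega>. 361/400 * D)" by (simp add: N_def)
    also have "\<dots> \<le> (\<Sum>e\<in>\<Omega>. disjoint_mean (\<Omega> - {e}) (\<lambda>x. f (insert e x)) (\<lambda>y. g (insert e y))
        + 2 * cube_mean (\<Omega> - {e}) (Ef e) + 2 * cube_mean (\<Omega> - {e}) (Eg e))"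
      by (intro sum_mono split)
    also have "\<dots> = real N * planted_mean \<Omega> f g
        + 2 * (\<Sum>e\<in>\<Omega>. cube_mean (\<Omega> - {e}) (Ef e)) + 2 * (\<Sum>e\<in>\<Omega>. cube_mean (\<Omega> - {e}) (Eg e))"
      using N by (simp add: sum.distrib planted_mean_def N_def sum_distrib_left[symmetric])
    finally have main: "real N * (361/400 * D) \<le> real N * planted_mean \<Omega> f g
        + 2 * (\<Sum>e\<in>\<Omega>. cube_mean (\<Omega> - {e}) (Ef e)) + 2 * (\<Sum>e\<in>\<Omega>. cube_mean (\<Omega> - {e}) (Eg e))" .
    have norm: "(\<Sum>e\<in>\<Omega>. cube_mean (\<Omega> - {e}) (\<phi> e)) = (\<Sum>e\<in>\<Omega>. \<Sum>S\<in>Pow (\<Omega> - {e}). \<phi> e S) / 2 ^ (N - 1)"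
      for \<phi> :: "'a \<Rightarrow> 'a set \<Rightarrow> real"
      using \<Omega> by (simp add: cube_mean_def N_def sum_divide_distrib)
    have pow: "(2::real) ^ N = 2 * 2 ^ (N - 1)" using N by (cases N) auto
    have "(\<Sum>e\<in>\<Omega>. cube_mean (\<Omega> - {e}) (Ef e)) \<le> real N * 2 ^ N * (D / 3200 + \<theta> ^ N) / 2 ^ (N - 1)"
      unfolding norm Ef_def D_def N_def
      using sum_influential[OF \<Omega>(1) f g \<theta>(1) infl[OF _ f]] by (intro divide_right_mono) auto
    then have 1: "(\<Sum>e\<in>\<Omega>. cube_mean (\<Omega> - {e}) (Ef e)) \<le> real N * (2 * (D / 3200 + \<theta> ^ N))"
      by (simp add: pow)
    have "(\<Sum>e\<in>\<Omega>. cube_mean (\<Omega> - {e}) (Eg e))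
        \<le> real N * 2 ^ N * (disjoint_mean \<Omega> g f / 3200 + \<theta> ^ N) / 2 ^ (N - 1)"
      unfolding norm Eg_def N_def
      using sum_influential[OF \<Omega>(1) g f \<theta>(1) infl[OF _ g]] by (intro divide_right_mono) auto
    then have 2: "(\<Sum>e\<in>\<Omega>. cube_mean (\<Omega> - {e}) (Eg e)) \<le> real N * (2 * (D / 3200 + \<theta> ^ N))"
      by (simp add: pow D_def disjoint_mean_commute[OF \<Omega>(1)])
    \<comment> \<open>Two error sums, the factor 2 of the pointwise bound and the factor
      \<open>2 ^ N / 2 ^ (N - 1)\<close> give 8. The loss is \<open>8 * D / 3200 = D / 400\<close>,
      and 361/400 - 1/400 = 9/10.\<close>
    have "real N * (361/400 * D) \<le> real N * (planted_mean \<Omega> f g + D / 400 + 8 * \<theta> ^ N)"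
      using main 1 2 by (simp add: algebra_simps)
    then have "361/400 * D \<le> planted_mean \<Omega> f g + D / 400 + 8 * \<theta> ^ N"
      using N by simp
    then show ?thesis by (simp add: D_def N_def)
  qed
  with \<theta> that show thesis by blast
qed

section \<open>Unions of sets in the message-passing model\<close>

lemma sum_Pow_powers:
  fixes a b :: "'b::comm_semiring_1"
  assumes "finite S"
  shows "(\<Sum>x\<in>Pow S. a ^ card x * b ^ card (S - x)) = (a + b) ^ card S"
  using assms
proof (induction S rule: finite_induct)
  case empty
  then show ?case by simp
next
  case (insert e S)
  have 1: "card (insert e S - x) = Suc (card (S - x))" "card (insert e x) = Suc (card x)"
    "S - insert e x = S - x" if "x \<in> Pow S" for x
  proof -
    have "insert e S - x = insert e (S - x)" "e \<notin> x" "finite x"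
      using that insert finite_subset[of x S] by auto
    then show "card (insert e S - x) = Suc (card (S - x))" "card (insert e x) = Suc (card x)"
      "S - insert e x = S - x"
      using insert that by auto
  qed
  have "(\<Sum>x\<in>Pow (insert e S). a ^ card x * b ^ card (insert e S - x))
      = (\<Sum>x\<in>Pow S. b * (a ^ card x * b ^ card (S - x))) + (\<Sum>x\<in>Pow S. a * (a ^ card x * b ^ card (S - x)))"
    unfolding sum_Pow_insert[OF insert(1,2)]
    by (intro arg_cong2[where f="(+)"] sum.cong refl) (simp_all add: 1 mult_ac)
  also have "\<dots> = (a + b) ^ card (insert e S)"
    using insert by (simp add: sum_distrib_left[symmetric] distrib_right add.commute)
  finally show ?case .
qed

text \<open>The hard inputs avoid a hidden set \<open>Y\<close>, which contains each point with probability \<open>1/4\<close>; the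
  input of each player contains each of the other points with probability \<open>1/3\<close>. With these values
  the input of a single player and \<open>Y\<close> together follow the law of \<open>disjoint_mean\<close>, while the inputs of
  all the other players determine \<open>Y\<close> with high probability.\<close>

definition noise :: "'a set \<Rightarrow> 'a set \<Rightarrow> 'a set \<Rightarrow> real" where
  "noise \<Omega> Y x = of_bool (x \<subseteq> \<Omega> - Y) * ((1/3) ^ card x * (2/3) ^ card (\<Omega> - Y - x))"

definition hidden :: "'a set \<Rightarrow> 'a set \<Rightarrow> real" where
  "hidden \<Omega> Y = (1/4) ^ card Y * (3/4) ^ card (\<Omega> - Y)"

lemma noise_nonneg: "0 \<le> noise \<Omega> Y x" by (simp add: noise_def)
lemma hidden_nonneg: "0 \<le> hidden \<Omega> Y" by (simp add: hidden_def)

lemma sum_hidden: "finite \<Omega> \<Longrightarrow> (\<Sum>Y\<in>Pow \<Omega>. hidden \<Omega> Y) = 1"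
  unfolding hidden_def by (subst sum_Pow_powers) auto

lemma sum_noise_eq:
  assumes "finite \<Omega>"
  shows "(\<Sum>x\<in>Pow \<Omega>. noise \<Omega> Y x * f x)
    = (\<Sum>x\<in>Pow (\<Omega> - Y). (1/3) ^ card x * (2/3) ^ card (\<Omega> - Y - x) * f x)"
  using assms by (intro sum.mono_neutral_cong_right) (auto simp: noise_def)

lemma sum_noise:
  assumes "finite \<Omega>"
  shows "(\<Sum>x\<in>Pow \<Omega>. noise \<Omega> Y x) = 1"
  using sum_noise_eq[OF assms, of Y "\<lambda>_. 1"] assms by (simp add: sum_Pow_powers)

lemma sum_noise_notin:
  assumes "finite \<Omega>" "e \<in> \<Omega> - Y"
  shows "(\<Sum>x\<in>Pow \<Omega>. noise \<Omega> Y x * of_bool (e \<notin> x)) = 2/3"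
proof -
  define S where "S = \<Omega> - Y - {e}"
  have S: "finite S" "\<Omega> - Y = insert e S" "e \<notin> S" using assms by (auto simp: S_def)
  have c: "card (insert e S - x) = Suc (card (S - x))" if "x \<in> Pow S" for x
  proof -
    have "insert e S - x = insert e (S - x)" using that S by auto
    then show ?thesis using S by simp
  qed
  have "(\<Sum>x\<in>Pow \<Omega>. noise \<Omega> Y x * of_bool (e \<notin> x))
      = (\<Sum>x\<in>Pow S. 2/3 * ((1/3) ^ card x * (2/3) ^ card (S - x)))"
    unfolding sum_noise_eq[OF assms(1)] S(2) sum_Pow_insert[OF S(1,3)] using S(3)
    by (auto simp: c intro!: sum.cong)
  also have "\<dots> = 2/3" unfolding sum_distrib_left[symmetric] sum_Pow_powers[OF S(1)] by simp
  finally show ?thesis .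
qed

lemma sum_Sigma3:
  assumes "finite A" "\<And>a. a \<in> A \<Longrightarrow> finite (B a)" "\<And>a b. \<lbrakk>a \<in> A; b \<in> B a\<rbrakk> \<Longrightarrow> finite (C a b)"
  shows "(\<Sum>a\<in>A. \<Sum>b\<in>B a. \<Sum>c\<in>C a b. \<phi> a b c)
    = (\<Sum>(a,b,c)\<in>(SIGMA a:A. SIGMA b:B a. C a b). \<phi> a b c)"
proof -
  have "(\<Sum>b\<in>B a. \<Sum>c\<in>C a b. \<phi> a b c) = (\<Sum>(b,c)\<in>(SIGMA b:B a. C a b). \<phi> a b c)" if "a \<in> A" for a
    using that assms by (intro sum.Sigma) auto
  then have "(\<Sum>a\<in>A. \<Sum>b\<in>B a. \<Sum>c\<in>C a b. \<phi> a b c)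
      = (\<Sum>a\<in>A. \<Sum>(b,c)\<in>(SIGMA b:B a. C a b). \<phi> a b c)" by (intro sum.cong) auto
  also have "\<dots> = (\<Sum>(a,bc)\<in>(SIGMA a:A. SIGMA b:B a. C a b). case bc of (b,c) \<Rightarrow> \<phi> a b c)"
    using assms by (intro sum.Sigma) auto
  finally show ?thesis by (simp add: case_prod_unfold)
qed

text \<open>Sums out the split. Each point has four outcomes of weight 1/4: in \<open>x\<close>, in
  \<open>Y\<close>, or in neither set on one of the two sides. Drawing \<open>Y\<close> first leaves
  \<open>x\<close> the conditional probability (1/4) / (3/4) = 1/3.\<close>

lemma disjoint_mean_eq:
  assumes \<Omega>: "finite \<Omega>"
  shows "disjoint_mean \<Omega> f g
    = (\<Sum>Y\<in>Pow \<Omega>. hidden \<Omega> Y * (\<Sum>x\<in>Pow \<Omega>. noise \<Omega> Y x * (f x * g Y)))"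
proof -
  have fin: "finite S" if "S \<subseteq> \<Omega>" for S using that \<Omega> finite_subset by blast
  let ?\<phi> = "\<lambda>x Y. (1/4) ^ card \<Omega> * (f x * g Y)"
  have "disjoint_mean \<Omega> f g = (\<Sum>S\<in>Pow \<Omega>. \<Sum>x\<in>Pow S. \<Sum>Y\<in>Pow (\<Omega> - S). ?\<phi> x Y)"
  proof -
    have "cube_mean S f * cube_mean (\<Omega> - S) g / 2 ^ card \<Omega> = (\<Sum>x\<in>Pow S. \<Sum>Y\<in>Pow (\<Omega> - S). ?\<phi> x Y)"
      if "S \<in> Pow \<Omega>" for S
    proof -
      have "card S + card (\<Omega> - S) = card \<Omega>"
        using that \<Omega> fin by (metis Diff_disjoint Diff_partition PowD card_Un_disjoint finite_Diff)
      then have "(2::real) ^ card S * 2 ^ card (\<Omega> - S) * 2 ^ card \<Omega> = 4 ^ card \<Omega>"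
        using power_mult_distrib[of "2::real" 2 "card \<Omega>"] by (simp add: power_add[symmetric])
      then show ?thesis
        by (simp add: cube_mean_def sum_product sum_divide_distrib power_one_over field_simps)
    qed
    then show ?thesis unfolding disjoint_mean_def cube_mean_def[of \<Omega>] sum_divide_distrib
      by (intro sum.cong) auto
  qed
  also have "\<dots> = (\<Sum>(S,x,Y)\<in>(SIGMA S:Pow \<Omega>. SIGMA x:Pow S. Pow (\<Omega> - S)). ?\<phi> x Y)"
    using \<Omega> fin by (intro sum_Sigma3) auto
  also have "\<dots> = (\<Sum>(Y,x,U)\<in>(SIGMA Y:Pow \<Omega>. SIGMA x:Pow (\<Omega> - Y). Pow (\<Omega> - Y - x)). ?\<phi> x Y)"
    by (rule sum.reindex_bij_witness[where i="\<lambda>(Y,x,U). (x \<union> U, x, Y)" and j="\<lambda>(S,x,Y). (Y, x, S - x)"])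
       auto
  also have "\<dots> = (\<Sum>Y\<in>Pow \<Omega>. \<Sum>x\<in>Pow (\<Omega> - Y). \<Sum>U\<in>Pow (\<Omega> - Y - x). ?\<phi> x Y)"
    using \<Omega> fin by (intro sum_Sigma3[symmetric]) auto
  also have "\<dots> = (\<Sum>Y\<in>Pow \<Omega>. \<Sum>x\<in>Pow (\<Omega> - Y). hidden \<Omega> Y * ((1/3) ^ card x * (2/3) ^ card (\<Omega> - Y - x) * (f x * g Y)))"
  proof (intro sum.cong refl)
    fix Y x assume Y: "Y \<in> Pow \<Omega>" and x: "x \<in> Pow (\<Omega> - Y)"
    define k where "k = card (\<Omega> - Y - x)"
    have 1: "card (\<Omega> - Y) = card x + k" "card \<Omega> = card Y + (card x + k)"
    proof -
      have "finite Y" "finite x" using x Y fin by auto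
      then show "card (\<Omega> - Y) = card x + k" unfolding k_def
        using x \<Omega> by (subst card_Diff_subset[of x]) (auto simp: card_mono)
      then show "card \<Omega> = card Y + (card x + k)"
        using Y \<Omega> \<open>finite Y\<close> by (metis PowD card_Diff_subset card_mono le_add_diff_inverse)
    qed
    have "(1/4::real) ^ card \<Omega> * 2 ^ k = hidden \<Omega> Y * ((1/3) ^ card x * (2/3) ^ k)"
    proof -
      have "(1/4::real) ^ k * 2 ^ k = (3/4) ^ k * (2/3) ^ k"
        "(1/4::real) ^ card x = (3/4) ^ card x * (1/3) ^ card x"
        by (simp_all add: power_mult_distrib[symmetric])
      then show ?thesis by (simp add: hidden_def 1 power_add)
    qed
    then show "(\<Sum>U\<in>Pow (\<Omega> - Y - x). ?\<phi> x Y)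
        = hidden \<Omega> Y * ((1/3) ^ card x * (2/3) ^ card (\<Omega> - Y - x) * (f x * g Y))"
      using \<Omega> by (simp add: card_Pow k_def mult_ac)
  qed
  also have "\<dots> = (\<Sum>Y\<in>Pow \<Omega>. hidden \<Omega> Y * (\<Sum>x\<in>Pow \<Omega>. noise \<Omega> Y x * (f x * g Y)))"
    using \<Omega> by (simp add: sum_noise_eq sum_distrib_left)
  finally show ?thesis .
qed

section \<open>Independent players given the hidden set\<close>

definition noise_mean :: "nat \<Rightarrow> 'a set \<Rightarrow> 'a set \<Rightarrow> ((nat \<Rightarrow> 'a set) \<Rightarrow> real) \<Rightarrow> real" where
  "noise_mean s \<Omega> Y \<phi> = (\<Sum>X\<in>{..<s} \<rightarrow>\<^sub>E Pow \<Omega>. (\<Prod>k<s. noise \<Omega> Y (X k)) * \<phi> X)"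

lemma noise_mean_prod:
  assumes "finite \<Omega>"
  shows "noise_mean s \<Omega> Y (\<lambda>X. \<Prod>k<s. f k (X k)) = (\<Prod>k<s. \<Sum>x\<in>Pow \<Omega>. noise \<Omega> Y x * f k x)"
  unfolding noise_mean_def using assms
  by (subst prod_sum_PiE) (auto simp: prod.distrib)

lemma noise_mean_const:
  assumes "finite \<Omega>"
  shows "noise_mean s \<Omega> Y (\<lambda>_. c) = c"
proof -
  have "noise_mean s \<Omega> Y (\<lambda>_. 1) = 1"
    using noise_mean_prod[OF assms, of s Y "\<lambda>_ _. 1"] assms by (simp add: sum_noise)
  then show ?thesis by (simp add: noise_mean_def sum_distrib_right[symmetric])
qed

lemma noise_mean_mono:
  assumes "\<And>X. \<lbrakk>\<And>k. k < s \<Longrightarrow> X k \<subseteq> \<Omega> - Y\<rbrakk> \<Longrightarrow> \<phi> X \<le> \<psi> X"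
  shows "noise_mean s \<Omega> Y \<phi> \<le> noise_mean s \<Omega> Y \<psi>"
  unfolding noise_mean_def
proof (intro sum_mono)
  fix X :: "nat \<Rightarrow> 'a set"
  show "(\<Prod>k<s. noise \<Omega> Y (X k)) * \<phi> X \<le> (\<Prod>k<s. noise \<Omega> Y (X k)) * \<psi> X"
  proof (cases "\<forall>k<s. X k \<subseteq> \<Omega> - Y")
    case True
    then show ?thesis using assms by (intro mult_left_mono prod_nonneg ballI noise_nonneg) auto
  next
    case False
    then obtain k where "k < s" "noise \<Omega> Y (X k) = 0" by (auto simp: noise_def)
    then have "(\<Prod>k<s. noise \<Omega> Y (X k)) = 0" by (intro prod_zero) auto
    then show ?thesis by (simp only: mult_zero_left)
  qed
qed

lemma noise_mean_sum:
  "noise_mean s \<Omega> Y (\<lambda>X. \<Sum>a\<in>A. \<phi> a X) = (\<Sum>a\<in>A. noise_mean s \<Omega> Y (\<phi> a))"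
  unfolding noise_mean_def sum_distrib_left by (rule sum.swap)

text \<open>Overwriting coordinate \<open>i\<close> by a fresh sample changes nothing, since the
  noise of the discarded one sums to 1. This separates player \<open>i\<close> from the others while
  the index set stays the same.\<close>

lemma noise_mean_resample:
  assumes \<Omega>: "finite \<Omega>" and i: "i < s"
  shows "noise_mean s \<Omega> Y \<phi> = (\<Sum>x\<in>Pow \<Omega>. noise \<Omega> Y x * noise_mean s \<Omega> Y (\<lambda>Z. \<phi> (Z(i := x))))"
proof -
  define I where "I = {..<s} - {i}"
  have I: "{..<s} = insert i I" "i \<notin> I" "finite I" using i by (auto simp: I_def)
  define P where "P = I \<rightarrow>\<^sub>E Pow \<Omega>"
  have expand: "noise_mean s \<Omega> Y \<psi>
      = (\<Sum>x\<in>Pow \<Omega>. \<Sum>Z\<in>P. noise \<Omega> Y x * ((\<Prod>k\<in>I. noise \<Omega> Y (Z k)) * \<psi> (Z(i := x))))" for \<psi>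
  proof -
    have "noise_mean s \<Omega> Y \<psi> = (\<Sum>(x,Z)\<in>Pow \<Omega> \<times> P. (\<Prod>k<s. noise \<Omega> Y ((Z(i := x)) k)) * \<psi> (Z(i := x)))"
      unfolding noise_mean_def I(1) PiE_insert_eq P_def
      using inj_combinator[OF I(2), of "\<lambda>_. Pow \<Omega>"]
      by (subst sum.reindex) (auto simp: case_prod_unfold comp_def)
    moreover have "(\<Prod>k<s. noise \<Omega> Y ((Z(i := x)) k)) = noise \<Omega> Y x * (\<Prod>k\<in>I. noise \<Omega> Y (Z k))" for x Z
    proof -
      have "(\<Prod>k\<in>I. noise \<Omega> Y ((Z(i := x)) k)) = (\<Prod>k\<in>I. noise \<Omega> Y (Z k))"
        using I(2) by (intro prod.cong) auto
      then show ?thesis unfolding I(1) using I by (simp add: prod.insert)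
    qed
    ultimately show ?thesis by (simp add: sum.cartesian_product mult.assoc)
  qed
  have "noise_mean s \<Omega> Y (\<lambda>Z. \<phi> (Z(i := x))) = (\<Sum>Z\<in>P. (\<Prod>k\<in>I. noise \<Omega> Y (Z k)) * \<phi> (Z(i := x)))" for x
    unfolding expand using sum_noise[OF \<Omega>, of Y]
    by (simp add: sum_distrib_left[symmetric] sum_distrib_right[symmetric])
  then show ?thesis unfolding expand by (simp add: sum_distrib_left)
qed

definition hard_mean :: "nat \<Rightarrow> 'a set \<Rightarrow> ((nat \<Rightarrow> 'a set) \<Rightarrow> real) \<Rightarrow> real" where
  "hard_mean s \<Omega> \<phi> = (\<Sum>Y\<in>Pow \<Omega>. hidden \<Omega> Y * noise_mean s \<Omega> Y \<phi>)"

text \<open>The others draw with the hidden set \<open>insert e Y\<close>, so none of them holds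
  \<open>e\<close>; player \<open>i\<close> draws a set avoiding \<open>Y\<close> and
  \<open>e\<close> and then receives \<open>e\<close>. Thus \<open>e\<close> enters the union
  through player \<open>i\<close> alone.\<close>

definition hard_planted_at :: "nat \<Rightarrow> 'a set \<Rightarrow> nat \<Rightarrow> ((nat \<Rightarrow> 'a set) \<Rightarrow> real) \<Rightarrow> real" where
  "hard_planted_at s \<Omega> i \<phi> = (\<Sum>e\<in>\<Omega>. \<Sum>Y\<in>Pow (\<Omega> - {e}). hidden (\<Omega> - {e}) Y *
     (\<Sum>x\<in>Pow (\<Omega> - {e}). noise (\<Omega> - {e}) Y x *
        noise_mean s \<Omega> (insert e Y) (\<lambda>Z. \<phi> (Z(i := insert e x))))) / card \<Omega>"

definition hard_planted :: "nat \<Rightarrow> 'a set \<Rightarrow> ((nat \<Rightarrow> 'a set) \<Rightarrow> real) \<Rightarrow> real" where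
  "hard_planted s \<Omega> \<phi> = (\<Sum>i<s. hard_planted_at s \<Omega> i \<phi>) / s"

lemma hard_mean_mono:
  assumes "\<And>X. \<lbrakk>\<And>k. k < s \<Longrightarrow> X k \<subseteq> \<Omega>\<rbrakk> \<Longrightarrow> \<phi> X \<le> \<psi> X"
  shows "hard_mean s \<Omega> \<phi> \<le> hard_mean s \<Omega> \<psi>"
  unfolding hard_mean_def using assms
  by (intro sum_mono mult_left_mono hidden_nonneg noise_mean_mono) auto

lemma hard_mean_const: "finite \<Omega> \<Longrightarrow> hard_mean s \<Omega> (\<lambda>_. c) = c"
  by (simp add: hard_mean_def noise_mean_const sum_distrib_right[symmetric] sum_hidden)

lemma hard_mean_sum:
  "hard_mean s \<Omega> (\<lambda>X. \<Sum>a\<in>A. \<phi> a X) = (\<Sum>a\<in>A. hard_mean s \<Omega> (\<phi> a))"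
  unfolding hard_mean_def noise_mean_sum sum_distrib_left by (rule sum.swap)

lemma hard_mean_add: "hard_mean s \<Omega> (\<lambda>X. \<phi> X + \<psi> X) = hard_mean s \<Omega> \<phi> + hard_mean s \<Omega> \<psi>"
  by (simp add: hard_mean_def noise_mean_def sum.distrib distrib_left)

lemma hard_planted_at_mono:
  assumes i: "i < s" and le: "\<And>X. \<lbrakk>\<And>k. k < s \<Longrightarrow> X k \<subseteq> \<Omega>\<rbrakk> \<Longrightarrow> \<phi> X \<le> \<psi> X"
  shows "hard_planted_at s \<Omega> i \<phi> \<le> hard_planted_at s \<Omega> i \<psi>"
  unfolding hard_planted_at_def
  by (intro divide_right_mono sum_mono mult_left_mono hidden_nonneg noise_nonneg noise_mean_mono le) auto

lemma hard_planted_mono: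
  assumes "\<And>X. \<lbrakk>\<And>k. k < s \<Longrightarrow> X k \<subseteq> \<Omega>\<rbrakk> \<Longrightarrow> \<phi> X \<le> \<psi> X"
  shows "hard_planted s \<Omega> \<phi> \<le> hard_planted s \<Omega> \<psi>"
  unfolding hard_planted_def using assms
  by (intro divide_right_mono sum_mono hard_planted_at_mono) auto

lemma hard_planted_const:
  assumes "finite \<Omega>" "\<Omega> \<noteq> {}" "s > 0"
  shows "hard_planted s \<Omega> (\<lambda>_. c) = c"
  using assms by (simp add: hard_planted_def hard_planted_at_def noise_mean_const sum_noise sum_hidden
      sum_distrib_right[symmetric])

text \<open>The two-party argument for the channel of player \<open>i\<close>. For each history \<open>h\<close> of that channel the
  inputs producing \<open>h\<close> form a rectangle between player \<open>i\<close> and all the others. A transcript whose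
  output is the union of the inputs of the others errs as soon as a fresh point is planted in the
  input of player \<open>i\<close>.\<close>

lemma planted_error_player:
  fixes T :: "(nat \<Rightarrow> edges) \<Rightarrow> transcript" and out :: "(nat \<Rightarrow> edges) \<Rightarrow> edges"
  assumes \<Omega>: "finite \<Omega>" "\<Omega> \<noteq> {}" and i: "i < s" and wf: "well_formed s \<pi>"
    and halts: "\<And>X. (\<And>k. k < s \<Longrightarrow> X k \<subseteq> \<Omega>) \<Longrightarrow> halts_with \<pi> X (T X) (out X)"
    and corr: "\<And>f g. \<lbrakk>\<And>x. 0 \<le> f x; \<And>x. f x \<le> 1; \<And>x. 0 \<le> g x; \<And>x. g x \<le> 1\<rbrakk>
       \<Longrightarrow> 9/10 * disjoint_mean \<Omega> f g \<le> planted_mean \<Omega> f g + \<epsilon>"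
    and \<epsilon>: "0 \<le> \<epsilon>"
  shows "9/10 * hard_mean s \<Omega> (\<lambda>X. of_bool (history_bits (channel i (T X)) \<le> B \<and> (\<Union>k\<in>{..<s}-{i}. X k) = out X))
    \<le> hard_planted_at s \<Omega> i (\<lambda>X. of_bool (out X \<noteq> (\<Union>k<s. X k))) + 4 ^ (B + 1) * \<epsilon>"
proof -
  define adm where "adm X \<longleftrightarrow> (\<forall>k<s. X k \<subseteq> \<Omega>)" for X
  define hist where "hist X = channel i (T X)" for X
  define U where "U X = (\<Union>k\<in>{..<s}-{i}. X k)" for X :: "nat \<Rightarrow> edges"
  define good where "good h X \<longleftrightarrow> hist X = h \<and> U X = out X" for h X
  define f where "f h x = (of_bool (\<exists>X. adm X \<and> X i = x \<and> hist X = h) :: real)" for h x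
  define g where "g h Y = noise_mean s \<Omega> Y (\<lambda>Z. of_bool (\<exists>x\<subseteq>\<Omega>. good h (Z(i := x))))" for h Y
  have adm_halts: "halts_with \<pi> X (T X) (out X)" if "adm X" for X
    using that halts by (auto simp: adm_def)
  \<comment> \<open>The rectangle property: the others need not know which input of player
    \<open>i\<close> led to \<open>h\<close>, so the witness in \<open>g\<close> may be replaced by
    any \<open>x\<close> compatible with \<open>h\<close>. The condition \<open>U X = out X\<close>
    survives because \<open>U\<close> ignores player \<open>i\<close> and the transcript stays the
    same.\<close>
  have rect: "f h x * of_bool (\<exists>x\<subseteq>\<Omega>. good h (Z(i := x))) = of_bool (good h (Z(i := x)))"
    if x: "x \<subseteq> \<Omega>" and Z: "adm Z" for h x Z
  proof -
    have "good h (Z(i := x))" if X: "adm X" "X i = x" "hist X = h"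
      and x0: "x0 \<subseteq> \<Omega>" "good h (Z(i := x0))" for X x0
    proof -
      have a: "adm (Z(i := x0))" "adm (Z(i := x))" using x x0 Z by (auto simp: adm_def)
      have "halts_with \<pi> ((Z(i := x0))(i := X i)) (T (Z(i := x0))) (out (Z(i := x0)))"
        by (rule halts_with_fun_upd[OF adm_halts[OF a(1)] adm_halts[OF X(1)]])
           (use X x0 in \<open>auto simp: hist_def good_def\<close>)
      then have "T (Z(i := x)) = T (Z(i := x0)) \<and> out (Z(i := x)) = out (Z(i := x0))"
        using adm_halts[OF a(2)] halts_with_unique X(2) by (metis fun_upd_upd)
      moreover have "U (Z(i := y)) = U Z" for y by (auto simp: U_def)
      ultimately show ?thesis using x0 by (simp add: good_def hist_def)
    qed
    moreover have "\<exists>X. adm X \<and> X i = x \<and> hist X = h" if "good h (Z(i := x))"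
      using that x Z by (intro exI[of _ "Z(i := x)"]) (auto simp: adm_def good_def)
    ultimately show ?thesis using x by (auto simp: f_def)
  qed
  have fg: "f h x * g h Y = noise_mean s \<Omega> Y (\<lambda>Z. of_bool (good h (Z(i := x))))" if "x \<subseteq> \<Omega>" for h x Y
  proof -
    have "f h x * g h Y = noise_mean s \<Omega> Y (\<lambda>Z. f h x * of_bool (\<exists>x\<subseteq>\<Omega>. good h (Z(i := x))))"
      by (simp add: g_def noise_mean_def sum_distrib_left mult_ac)
    also have "\<dots> = noise_mean s \<Omega> Y (\<lambda>Z. of_bool (good h (Z(i := x))))"
      unfolding noise_mean_def
    proof (intro sum.cong refl arg_cong2[where f="(*)"])
      fix Z assume "Z \<in> {..<s} \<rightarrow>\<^sub>E Pow \<Omega>"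
      then have "adm Z" by (auto simp: adm_def)
      then show "f h x * of_bool (\<exists>x\<subseteq>\<Omega>. good h (Z(i := x))) = of_bool (good h (Z(i := x)))"
        by (rule rect[OF that])
    qed
    finally show ?thesis .
  qed
  have f01: "0 \<le> f h x" "f h x \<le> 1" for h x by (auto simp: f_def)
  have g01: "0 \<le> g h Y" "g h Y \<le> 1" for h Y
    using noise_mean_mono[of s \<Omega> Y "\<lambda>_. 0" "\<lambda>Z. of_bool (\<exists>x\<subseteq>\<Omega>. good h (Z(i := x)))"]
      noise_mean_mono[of s \<Omega> Y "\<lambda>Z. of_bool (\<exists>x\<subseteq>\<Omega>. good h (Z(i := x)))" "\<lambda>_. 1"]
    by (auto simp: g_def noise_mean_const[OF \<Omega>(1)])
  have fin: "finite (histories B)" and card: "real (card (histories B)) \<le> 4 ^ (B + 1)"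
    using histories_finite_card[of B] of_nat_mono[of "card (histories B)" "4 ^ (B + 1)", where 'a=real]
    by auto
  have hist: "hist X \<in> histories B \<longleftrightarrow> history_bits (hist X) \<le> B" if "adm X" for X
  proof -
    have "\<forall>(j, m, r)\<in>set (T X). j < s \<and> m \<noteq> [] \<and> r \<noteq> []"
      using reachable_well_formed[of \<pi> X "T X" s] wf adm_halts[OF that] by (simp add: halts_with_def)
    then show ?thesis by (auto simp: histories_def hist_def channel_def)
  qed
  have sum_good: "(\<Sum>h\<in>histories B. of_bool (good h X)) = (of_bool (history_bits (hist X) \<le> B \<and> U X = out X) :: real)"
    if "adm X" for X
  proof -
    have "(\<Sum>h\<in>histories B. of_bool (good h X)) = (\<Sum>h\<in>histories B. if hist X = h then of_bool (U X = out X) else 0 :: real)"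
      by (intro sum.cong) (auto simp: good_def)
    also have "\<dots> = of_bool (history_bits (hist X) \<le> B \<and> U X = out X)"
      using fin hist[OF that] by (simp add: sum.delta)
    finally show ?thesis .
  qed
  have "hard_mean s \<Omega> (\<lambda>X. of_bool (history_bits (hist X) \<le> B \<and> U X = out X))
      \<le> hard_mean s \<Omega> (\<lambda>X. \<Sum>h\<in>histories B. of_bool (good h X))"
    using sum_good by (intro hard_mean_mono) (auto simp: adm_def)
  also have "\<dots> = (\<Sum>h\<in>histories B. disjoint_mean \<Omega> (f h) (g h))"
    unfolding hard_mean_sum disjoint_mean_eq[OF \<Omega>(1)] hard_mean_def
    by (subst noise_mean_resample[OF \<Omega>(1) i]) (simp add: fg)
  finally have zero: "hard_mean s \<Omega> (\<lambda>X. of_bool (history_bits (hist X) \<le> B \<and> U X = out X))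
      \<le> (\<Sum>h\<in>histories B. disjoint_mean \<Omega> (f h) (g h))" .
  have "planted_mean \<Omega> (f h) (g h) = hard_planted_at s \<Omega> i (\<lambda>X. of_bool (good h X))" for h
  proof -
    have "disjoint_mean (\<Omega> - {e}) (\<lambda>x. f h (insert e x)) (\<lambda>y. g h (insert e y))
      = (\<Sum>Y\<in>Pow (\<Omega> - {e}). hidden (\<Omega> - {e}) Y *
     (\<Sum>x\<in>Pow (\<Omega> - {e}). noise (\<Omega> - {e}) Y x *
        noise_mean s \<Omega> (insert e Y) (\<lambda>Z. of_bool (good h (Z(i := insert e x))))))" if "e \<in> \<Omega>" for e
      using \<Omega> that by (subst disjoint_mean_eq) (auto intro!: sum.cong arg_cong2[where f="(*)"] fg)
    then show ?thesis unfolding planted_mean_def hard_planted_at_def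
      by (intro arg_cong2[where f="(/)"] sum.cong) auto
  qed
  then have "(\<Sum>h\<in>histories B. planted_mean \<Omega> (f h) (g h))
      = hard_planted_at s \<Omega> i (\<lambda>X. \<Sum>h\<in>histories B. of_bool (good h X))"
    unfolding hard_planted_at_def noise_mean_sum sum_distrib_left
    by (simp add: sum.swap[of _ _ "histories B"] sum_divide_distrib[symmetric])
  also have "\<dots> \<le> hard_planted_at s \<Omega> i (\<lambda>X. of_bool (out X \<noteq> (\<Union>k<s. X k)))"
    unfolding hard_planted_at_def
  proof (intro divide_right_mono sum_mono mult_left_mono hidden_nonneg noise_nonneg noise_mean_mono)
    fix e Y x Z
    assume e: "e \<in> \<Omega>" "Y \<in> Pow (\<Omega> - {e})" and x: "x \<in> Pow (\<Omega> - {e})"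
      and Z: "\<And>k. k < s \<Longrightarrow> Z k \<subseteq> \<Omega> - insert e Y"
    let ?X = "Z(i := insert e x)"
    have a: "adm ?X" using x Z e by (auto simp: adm_def)
    have "U ?X \<noteq> (\<Union>k<s. ?X k)"
    proof -
      have "e \<notin> U ?X" using Z by (fastforce simp: U_def)
      moreover have "e \<in> (\<Union>k<s. ?X k)" using i by auto
      ultimately show ?thesis by blast
    qed
    then show "(\<Sum>h\<in>histories B. of_bool (good h ?X)) \<le> (of_bool (out ?X \<noteq> (\<Union>k<s. ?X k)) :: real)"
      unfolding sum_good[OF a] by auto
  qed simp
  finally have one: "(\<Sum>h\<in>histories B. planted_mean \<Omega> (f h) (g h))
      \<le> hard_planted_at s \<Omega> i (\<lambda>X. of_bool (out X \<noteq> (\<Union>k<s. X k)))" .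
  have "9/10 * (\<Sum>h\<in>histories B. disjoint_mean \<Omega> (f h) (g h))
      \<le> (\<Sum>h\<in>histories B. planted_mean \<Omega> (f h) (g h) + \<epsilon>)"
    unfolding sum_distrib_left by (intro sum_mono corr f01 g01)
  also have "\<dots> \<le> (\<Sum>h\<in>histories B. planted_mean \<Omega> (f h) (g h)) + 4 ^ (B + 1) * \<epsilon>"
    using mult_right_mono[OF card \<epsilon>] by (simp add: sum.distrib)
  finally show ?thesis
    using zero one unfolding hist_def U_def by linarith
qed

text \<open>Union bound over the points held by player \<open>i\<close> alone: each of the other
  \<open>s - 1\<close> players misses a point outside \<open>Y\<close> with probability 2/3,
  independently given \<open>Y\<close>.\<close>

lemma hard_mean_union_others:
  assumes \<Omega>: "finite \<Omega>" and i: "i < s"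
  shows "hard_mean s \<Omega> (\<lambda>X. of_bool ((\<Union>k\<in>{..<s}-{i}. X k) \<noteq> (\<Union>k<s. X k)))
    \<le> card \<Omega> * (2/3) ^ (s - 1)"
proof -
  define \<psi> where "\<psi> e k x = (if k = i then of_bool (e \<in> x) else of_bool (e \<notin> x) :: real)" for e :: 'a and k x
  have \<psi>: "0 \<le> \<psi> e k x" "\<psi> e k x \<le> 1" for e k x by (auto simp: \<psi>_def)
  have noise: "noise_mean s \<Omega> Y (\<lambda>X. \<Prod>k<s. \<psi> e k (X k)) \<le> (2/3) ^ (s - 1)" if e: "e \<in> \<Omega>" for e Y
  proof -
    define F where "F k = (\<Sum>x\<in>Pow \<Omega>. noise \<Omega> Y x * \<psi> e k x)" for k
    have F: "0 \<le> F k" "F k \<le> 1" for k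
    proof -
      show "0 \<le> F k" unfolding F_def by (intro sum_nonneg mult_nonneg_nonneg noise_nonneg \<psi>)
      have "F k \<le> (\<Sum>x\<in>Pow \<Omega>. noise \<Omega> Y x * 1)"
        unfolding F_def by (intro sum_mono mult_left_mono noise_nonneg \<psi>)
      then show "F k \<le> 1" using sum_noise[OF \<Omega>] by simp
    qed
    have "(\<Prod>k<s. F k) = F i * (\<Prod>k\<in>{..<s}-{i}. F k)"
      using i by (intro prod.remove) auto
    also have "\<dots> \<le> (2/3) ^ (s - 1)"
    proof (cases "e \<in> Y")
      case True
      then have "F i = 0" unfolding F_def \<psi>_def noise_def by (intro sum.neutral) auto
      then show ?thesis by simp
    next
      case False
      then have "(\<Prod>k\<in>{..<s}-{i}. F k) = (\<Prod>k\<in>{..<s}-{i}. 2/3)"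
        unfolding F_def \<psi>_def using sum_noise_notin[OF \<Omega>, of e Y] e by (intro prod.cong) auto
      also have "\<dots> = (2/3) ^ (s - 1)" using i by simp
      finally show ?thesis using F[of i] by (simp add: mult_left_le_one_le)
    qed
    finally show ?thesis unfolding F_def noise_mean_prod[OF \<Omega>] .
  qed
  have *: "hard_mean s \<Omega> (\<lambda>X. \<Prod>k<s. \<psi> e k (X k)) \<le> (2/3) ^ (s - 1)" if "e \<in> \<Omega>" for e
  proof -
    have "hard_mean s \<Omega> (\<lambda>X. \<Prod>k<s. \<psi> e k (X k)) \<le> (\<Sum>Y\<in>Pow \<Omega>. hidden \<Omega> Y * (2/3) ^ (s - 1))"
      unfolding hard_mean_def by (intro sum_mono mult_left_mono hidden_nonneg noise that)
    then show ?thesis by (simp add: sum_distrib_right[symmetric] sum_hidden[OF \<Omega>])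
  qed
  have "hard_mean s \<Omega> (\<lambda>X. of_bool ((\<Union>k\<in>{..<s}-{i}. X k) \<noteq> (\<Union>k<s. X k)))
      \<le> hard_mean s \<Omega> (\<lambda>X. \<Sum>e\<in>\<Omega>. \<Prod>k<s. \<psi> e k (X k))"
  proof (rule hard_mean_mono)
    fix X :: "nat \<Rightarrow> 'a set" assume X: "\<And>k. k < s \<Longrightarrow> X k \<subseteq> \<Omega>"
    have nn: "0 \<le> (\<Sum>e\<in>\<Omega>. \<Prod>k<s. \<psi> e k (X k))" by (intro sum_nonneg prod_nonneg) (auto simp: \<psi>)
    show "of_bool ((\<Union>k\<in>{..<s}-{i}. X k) \<noteq> (\<Union>k<s. X k)) \<le> (\<Sum>e\<in>\<Omega>. \<Prod>k<s. \<psi> e k (X k))"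
    proof (cases "(\<Union>k\<in>{..<s}-{i}. X k) = (\<Union>k<s. X k)")
      case False
      then obtain e where e: "e \<in> X i" "\<And>k. k < s \<Longrightarrow> k \<noteq> i \<Longrightarrow> e \<notin> X k" by auto
      have "(\<Prod>k<s. \<psi> e k (X k)) = 1" using e by (intro prod.neutral) (auto simp: \<psi>_def)
      moreover have "(\<Prod>k<s. \<psi> e k (X k)) \<le> (\<Sum>e\<in>\<Omega>. \<Prod>k<s. \<psi> e k (X k))"
        using e(1) X[OF i] \<Omega> by (intro member_le_sum prod_nonneg) (auto simp: \<psi>)
      ultimately show ?thesis by simp
    qed (use nn in simp)
  qed
  also have "\<dots> \<le> (\<Sum>e\<in>\<Omega>. (2/3) ^ (s - 1))" unfolding hard_mean_sum by (intro sum_mono *)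
  finally show ?thesis by simp
qed

text \<open>The bound for a single channel, averaged over the players. By Markov's inequality at
  most \<open>C / (B + 1)\<close> channels carry more than \<open>B\<close> bits, so a random player
  has an expensive channel with probability at most \<open>C / (s * (B + 1))\<close>.\<close>

lemma planted_error:
  fixes T :: "(nat \<Rightarrow> edges) \<Rightarrow> transcript" and out :: "(nat \<Rightarrow> edges) \<Rightarrow> edges"
  assumes \<Omega>: "finite \<Omega>" "\<Omega> \<noteq> {}" and s: "0 < s" and wf: "well_formed s \<pi>"
    and halts: "\<And>X. (\<And>k. k < s \<Longrightarrow> X k \<subseteq> \<Omega>) \<Longrightarrow> halts_with \<pi> X (T X) (out X)"
    and bits: "\<And>X. (\<And>k. k < s \<Longrightarrow> X k \<subseteq> \<Omega>) \<Longrightarrow> bits_exchanged (T X) \<le> C"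
    and corr: "\<And>f g. \<lbrakk>\<And>x. 0 \<le> f x; \<And>x. f x \<le> 1; \<And>x. 0 \<le> g x; \<And>x. g x \<le> 1\<rbrakk>
       \<Longrightarrow> 9/10 * disjoint_mean \<Omega> f g \<le> planted_mean \<Omega> f g + \<epsilon>"
    and \<epsilon>: "0 \<le> \<epsilon>"
  shows "9/10 * (hard_mean s \<Omega> (\<lambda>X. of_bool (out X = (\<Union>k<s. X k)))
        - card \<Omega> * (2/3) ^ (s - 1) - C / (real s * real (B + 1)))
    \<le> hard_planted s \<Omega> (\<lambda>X. of_bool (out X \<noteq> (\<Union>k<s. X k))) + 4 ^ (B + 1) * \<epsilon>"
proof -
  define A where "A = hard_mean s \<Omega> (\<lambda>X. of_bool (out X = (\<Union>k<s. X k)))"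
  define \<delta> where "\<delta> = card \<Omega> * (2/3::real) ^ (s - 1)"
  define L where "L i = hard_mean s \<Omega> (\<lambda>X. of_bool (B < history_bits (channel i (T X))))" for i
  define R where "R i = hard_planted_at s \<Omega> i (\<lambda>X. of_bool (out X \<noteq> (\<Union>k<s. X k)))" for i
  have step: "9/10 * (A - \<delta> - L i) \<le> R i + 4 ^ (B + 1) * \<epsilon>" if i: "i < s" for i
  proof -
    have "A \<le> hard_mean s \<Omega> (\<lambda>X.
        (of_bool (history_bits (channel i (T X)) \<le> B \<and> (\<Union>k\<in>{..<s}-{i}. X k) = out X) +
         of_bool ((\<Union>k\<in>{..<s}-{i}. X k) \<noteq> (\<Union>k<s. X k))) +
         of_bool (B < history_bits (channel i (T X))))"
      unfolding A_def by (rule hard_mean_mono) (auto simp: not_less)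
    also have "\<dots> \<le> hard_mean s \<Omega> (\<lambda>X. of_bool (history_bits (channel i (T X)) \<le> B \<and>
        (\<Union>k\<in>{..<s}-{i}. X k) = out X)) + \<delta> + L i"
      unfolding hard_mean_add L_def \<delta>_def using hard_mean_union_others[OF \<Omega>(1) i] by simp
    finally have "9/10 * (A - \<delta> - L i) \<le> 9/10 * hard_mean s \<Omega> (\<lambda>X. of_bool
        (history_bits (channel i (T X)) \<le> B \<and> (\<Union>k\<in>{..<s}-{i}. X k) = out X))" by simp
    also have "\<dots> \<le> R i + 4 ^ (B + 1) * \<epsilon>"
      unfolding R_def
    proof (rule planted_error_player[OF \<Omega> i wf _ _ \<epsilon>])
      show "halts_with \<pi> X (T X) (out X)" if "\<And>k. k < s \<Longrightarrow> X k \<subseteq> \<Omega>" for X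
        using that by (rule halts)
    qed (rule corr)
    finally show ?thesis .
  qed
  have "(\<Sum>i<s. L i) \<le> C / (B + 1)"
  proof -
    have "(\<Sum>i<s. L i) = hard_mean s \<Omega> (\<lambda>X. \<Sum>i<s. of_bool (B < history_bits (channel i (T X))))"
      unfolding L_def hard_mean_sum ..
    also have "\<dots> \<le> hard_mean s \<Omega> (\<lambda>X. C / (B + 1))"
    proof (rule hard_mean_mono)
      fix X :: "nat \<Rightarrow> edges" assume X: "\<And>k. k < s \<Longrightarrow> X k \<subseteq> \<Omega>"
      have "\<forall>(j, m, r)\<in>set (T X). j < s"
        using reachable_well_formed[OF _ wf] halts[OF X] by (fastforce simp: halts_with_def)
      then have c: "(\<Sum>i<s. history_bits (channel i (T X))) \<le> C"
        using bits[OF X] by (simp add: sum_history_bits_channel)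
      have "(\<Sum>i<s. of_bool (B < history_bits (channel i (T X))) * (B + 1))
          \<le> (\<Sum>i<s. history_bits (channel i (T X)))" by (intro sum_mono) auto
      also note c
      finally have "(\<Sum>i<s. of_bool (B < history_bits (channel i (T X))) * (B + 1)) \<le> C" .
      then have "real ((\<Sum>i<s. of_bool (B < history_bits (channel i (T X)))) * (B + 1)) \<le> real C"
        by (simp only: sum_distrib_right of_nat_le_iff)
      then have "(\<Sum>i<s. of_bool (B < history_bits (channel i (T X)))) * real (B + 1) \<le> real C"
        by (simp only: of_nat_mult of_nat_sum of_nat_of_bool)
      then show "(\<Sum>i<s. of_bool (B < history_bits (channel i (T X)))) \<le> real C / real (B + 1)"
        by (subst pos_le_divide_eq) auto
    qed
    finally show ?thesis by (simp add: hard_mean_const[OF \<Omega>(1)])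
  qed
  then have "9/10 * (s * (A - \<delta>) - C / (B + 1)) \<le> 9/10 * (s * (A - \<delta>) - (\<Sum>i<s. L i))"
    by (intro mult_left_mono diff_left_mono) auto
  also have "\<dots> = (\<Sum>i<s. 9/10 * (A - \<delta> - L i))"
    unfolding sum_distrib_left[symmetric] sum_subtractf by (simp add: right_diff_distrib)
  also have "\<dots> \<le> (\<Sum>i<s. R i + 4 ^ (B + 1) * \<epsilon>)"
    by (intro sum_mono step) auto
  also have "\<dots> = (\<Sum>i<s. R i) + s * (4 ^ (B + 1) * \<epsilon>)"
    by (simp add: sum.distrib)
  finally have "9/10 * (s * (A - \<delta>) - C / (B + 1)) \<le> (\<Sum>i<s. R i) + s * (4 ^ (B + 1) * \<epsilon>)" .
  then have "9/10 * (s * (A - \<delta>) - C / (B + 1)) / s \<le> ((\<Sum>i<s. R i) + s * (4 ^ (B + 1) * \<epsilon>)) / s"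
    by (intro divide_right_mono) auto
  moreover have "9/10 * (s * a - D) / s = 9/10 * (a - D / s)" for a D :: real
    using s by (simp add: field_simps)
  moreover have "(r + s * a) / s = r / s + a" for a r :: real
    using s by (simp add: field_simps)
  moreover have "C / (real s * real (B + 1)) = C / (B + 1) / s"
    by (simp only: divide_divide_eq_left mult.commute)
  ultimately show ?thesis
    unfolding A_def[symmetric] \<delta>_def[symmetric] hard_planted_def R_def[symmetric]
    by (simp only:)
qed

section \<open>Exchanging means over the inputs with the expectation over the coins\<close>

context
  fixes p :: "'p pmf" and \<Phi> :: "'p \<Rightarrow> (nat \<Rightarrow> 'a set) \<Rightarrow> real"
  assumes int: "\<And>X. integrable (measure_pmf p) (\<lambda>\<pi>. \<Phi> \<pi> X)"
begin

lemma noise_mean_expectation: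
  "integrable (measure_pmf p) (\<lambda>\<pi>. noise_mean s \<Omega> Y (\<lambda>X. \<Phi> \<pi> (F X)))"
  "measure_pmf.expectation p (\<lambda>\<pi>. noise_mean s \<Omega> Y (\<lambda>X. \<Phi> \<pi> (F X)))
    = noise_mean s \<Omega> Y (\<lambda>X. measure_pmf.expectation p (\<lambda>\<pi>. \<Phi> \<pi> (F X)))"
  by (simp_all add: noise_mean_def int Bochner_Integration.integral_sum)

lemma hard_mean_expectation:
  "integrable (measure_pmf p) (\<lambda>\<pi>. hard_mean s \<Omega> (\<Phi> \<pi>))"
  "measure_pmf.expectation p (\<lambda>\<pi>. hard_mean s \<Omega> (\<Phi> \<pi>))
    = hard_mean s \<Omega> (\<lambda>X. measure_pmf.expectation p (\<lambda>\<pi>. \<Phi> \<pi> X))"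
  using noise_mean_expectation[where F="\<lambda>X. X"]
  by (simp_all add: hard_mean_def Bochner_Integration.integral_sum)

lemma hard_planted_expectation:
  "integrable (measure_pmf p) (\<lambda>\<pi>. hard_planted s \<Omega> (\<Phi> \<pi>))"
  "measure_pmf.expectation p (\<lambda>\<pi>. hard_planted s \<Omega> (\<Phi> \<pi>))
    = hard_planted s \<Omega> (\<lambda>X. measure_pmf.expectation p (\<lambda>\<pi>. \<Phi> \<pi> X))"
  by (simp_all add: hard_planted_def hard_planted_at_def Bochner_Integration.integral_sum
      noise_mean_expectation[where F="\<lambda>Z. Z(i := insert e x)" for i e x])

end

lemma hard_planted_not:
  assumes "finite \<Omega>" "\<Omega> \<noteq> {}" "s > 0"
  shows "hard_planted s \<Omega> (\<lambda>X. of_bool (\<not> P X)) = 1 - hard_planted s \<Omega> (\<lambda>X. of_bool (P X))"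
proof -
  have "hard_planted s \<Omega> (\<lambda>X. of_bool (\<not> P X)) + hard_planted s \<Omega> (\<lambda>X. of_bool (P X))
      = hard_planted s \<Omega> (\<lambda>X. of_bool (\<not> P X) + of_bool (P X))"
    by (simp only: hard_planted_def hard_planted_at_def noise_mean_def sum.distrib distrib_left
        add_divide_distrib)
  also have "(\<lambda>X. of_bool (\<not> P X) + of_bool (P X)) = (\<lambda>X. 1 :: real)" by auto
  finally show ?thesis using hard_planted_const[OF assms, of 1] by simp
qed

text \<open>Turns spanners into exact reconstruction: the only valid output is the input graph. All
  subgraphs count because the union of the inputs may be any of them.\<close>

definition rigid :: "nat \<Rightarrow> edges \<Rightarrow> bool" where
  "rigid n \<Omega> \<longleftrightarrow> \<Omega> \<subseteq> complete_edges n \<and> (\<forall>F\<subseteq>\<Omega>. \<forall>H. additive_spanner n 2 F H \<longrightarrow> H = F)"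

lemma finite_complete_edges: "finite (complete_edges n)"
proof -
  have "complete_edges n \<subseteq> Pow {..<n}" by (auto simp: complete_edges_def)
  then show ?thesis by (rule finite_subset) simp
qed

text \<open>\<open>4/15 = 9/10 * (2/3) + 2/3 - 1\<close> is the surplus of success over both laws,
  which the error terms have to cover. The comparison of the laws holds for every outcome of the
  coins and is then averaged over them.\<close>

lemma rigid_cost_many_players:
  assumes rigid: "rigid n \<Omega>" and ne: "\<Omega> \<noteq> {}" and s: "0 < s"
    and p: "spanner_protocol n s 2 C p"
    and corr: "\<And>f g. \<lbrakk>\<And>x. 0 \<le> f x; \<And>x. f x \<le> 1; \<And>x. 0 \<le> g x; \<And>x. g x \<le> 1\<rbrakk>
       \<Longrightarrow> 9/10 * disjoint_mean \<Omega> f g \<le> planted_mean \<Omega> f g + \<epsilon>"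
    and \<epsilon>: "0 \<le> \<epsilon>"
  shows "4/15 \<le> card \<Omega> * (2/3) ^ (s - 1) + C / (real s * real (B + 1)) + 4 ^ (B + 1) * \<epsilon>"
proof -
  have fin: "finite \<Omega>" using rigid finite_subset[OF _ finite_complete_edges] by (auto simp: rigid_def)
  define P where "P \<pi> X \<longleftrightarrow> (\<exists>t H. halts_with \<pi> X t H \<and> additive_spanner n 2 (input_graph s X) H)"
    for \<pi> :: "(edges, edges) protocol" and X
  define \<delta> where "\<delta> = card \<Omega> * (2/3::real) ^ (s - 1) + C / (real s * real (B + 1))"
  have inp: "X \<in> inputs n s" if "\<And>k. k < s \<Longrightarrow> X k \<subseteq> \<Omega>" for X
    using that rigid by (fastforce simp: inputs_def rigid_def)
  have det: "9/10 * hard_mean s \<Omega> (\<lambda>X. of_bool (P \<pi> X)) + hard_planted s \<Omega> (\<lambda>X. of_bool (P \<pi> X))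
      \<le> 1 + 4 ^ (B + 1) * \<epsilon> + 9/10 * \<delta>" if \<pi>: "\<pi> \<in> set_pmf p" for \<pi>
  proof -
    have wf: "well_formed s \<pi>"
      and "\<forall>E\<in>inputs n s. \<exists>tH. halts_with \<pi> E (fst tH) (snd tH) \<and> bits_exchanged (fst tH) \<le> C"
      using p \<pi> by (auto simp: spanner_protocol_def)
    then obtain tH where tH: "\<And>E. E \<in> inputs n s \<Longrightarrow>
        halts_with \<pi> E (fst (tH E)) (snd (tH E)) \<and> bits_exchanged (fst (tH E)) \<le> C"
      by metis
    define T where "T E = fst (tH E)" for E
    define out where "out E = snd (tH E)" for E
    have out: "out X = (\<Union>k<s. X k)" if X: "\<And>k. k < s \<Longrightarrow> X k \<subseteq> \<Omega>" and "P \<pi> X" for X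
    proof -
      have "additive_spanner n 2 (input_graph s X) (out X)"
      proof -
        obtain t H where "halts_with \<pi> X t H" "additive_spanner n 2 (input_graph s X) H"
          using \<open>P \<pi> X\<close> by (auto simp: P_def)
        moreover have "halts_with \<pi> X (T X) (out X)" using tH[OF inp[OF X]] by (simp add: T_def out_def)
        ultimately show ?thesis using halts_with_unique by metis
      qed
      moreover have "input_graph s X \<subseteq> \<Omega>" using X by (auto simp: input_graph_def)
      ultimately show ?thesis using rigid by (simp add: rigid_def input_graph_def)
    qed
    have "hard_mean s \<Omega> (\<lambda>X. of_bool (P \<pi> X)) \<le> hard_mean s \<Omega> (\<lambda>X. of_bool (out X = (\<Union>k<s. X k)))"
      using out by (intro hard_mean_mono) auto
    then have "9/10 * (hard_mean s \<Omega> (\<lambda>X. of_bool (P \<pi> X)) - \<delta>)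
        \<le> 9/10 * (hard_mean s \<Omega> (\<lambda>X. of_bool (out X = (\<Union>k<s. X k)))
           - card \<Omega> * (2/3) ^ (s - 1) - C / (real s * real (B + 1)))"
      by (simp add: \<delta>_def)
    also have "\<dots> \<le> hard_planted s \<Omega> (\<lambda>X. of_bool (out X \<noteq> (\<Union>k<s. X k))) + 4 ^ (B + 1) * \<epsilon>"
    proof (rule planted_error[where T=T and out=out and \<pi>=\<pi>])
      show "halts_with \<pi> X (T X) (out X)" "bits_exchanged (T X) \<le> C"
        if "\<And>k. k < s \<Longrightarrow> X k \<subseteq> \<Omega>" for X
        using tH[OF inp[OF that]] by (auto simp: T_def out_def)
    qed (use fin ne s wf corr \<epsilon> in auto)
    also have "hard_planted s \<Omega> (\<lambda>X. of_bool (out X \<noteq> (\<Union>k<s. X k)))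
        \<le> hard_planted s \<Omega> (\<lambda>X. of_bool (\<not> P \<pi> X))"
      using out by (intro hard_planted_mono) auto
    finally show ?thesis unfolding hard_planted_not[OF fin ne s] by (simp add: right_diff_distrib)
  qed
  have succ: "2/3 \<le> measure_pmf.prob p {\<pi>. P \<pi> X}" if "\<And>k. k < s \<Longrightarrow> X k \<subseteq> \<Omega>" for X
    using p inp[OF that] by (auto simp: spanner_protocol_def P_def)
  have "2/3 \<le> hard_mean s \<Omega> (\<lambda>X. measure_pmf.prob p {\<pi>. P \<pi> X})"
    using hard_mean_mono[of s \<Omega> "\<lambda>_. 2/3" "\<lambda>X. measure_pmf.prob p {\<pi>. P \<pi> X}"] succ
    by (simp add: hard_mean_const[OF fin])
  moreover have "2/3 \<le> hard_planted s \<Omega> (\<lambda>X. measure_pmf.prob p {\<pi>. P \<pi> X})"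
    using hard_planted_mono[of s \<Omega> "\<lambda>_. 2/3" "\<lambda>X. measure_pmf.prob p {\<pi>. P \<pi> X}"] succ
    by (simp add: hard_planted_const[OF fin ne s])
  moreover have "9/10 * hard_mean s \<Omega> (\<lambda>X. measure_pmf.prob p {\<pi>. P \<pi> X})
      + hard_planted s \<Omega> (\<lambda>X. measure_pmf.prob p {\<pi>. P \<pi> X}) \<le> 1 + 4 ^ (B + 1) * \<epsilon> + 9/10 * \<delta>"
  proof -
    define \<Phi> where "\<Phi> \<pi> X = (of_bool (P \<pi> X) :: real)" for \<pi> X
    have int: "integrable (measure_pmf p) (\<lambda>\<pi>. \<Phi> \<pi> X)" for X
      unfolding \<Phi>_def by (rule integrable_of_bool_pmf)
    have prob: "measure_pmf.expectation p (\<lambda>\<pi>. \<Phi> \<pi> X) = measure_pmf.prob p {\<pi>. P \<pi> X}" for X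
      unfolding \<Phi>_def by (rule expectation_of_bool)
    note hm = hard_mean_expectation[where \<Phi>=\<Phi> and p=p and s=s and \<Omega>=\<Omega>, OF int, unfolded prob]
    note hp = hard_planted_expectation[where \<Phi>=\<Phi> and p=p and s=s and \<Omega>=\<Omega>, OF int, unfolded prob]
    have "9/10 * hard_mean s \<Omega> (\<lambda>X. measure_pmf.prob p {\<pi>. P \<pi> X})
      + hard_planted s \<Omega> (\<lambda>X. measure_pmf.prob p {\<pi>. P \<pi> X})
      = measure_pmf.expectation p (\<lambda>\<pi>. 9/10 * hard_mean s \<Omega> (\<Phi> \<pi>) + hard_planted s \<Omega> (\<Phi> \<pi>))"
      using hm hp by simp
    also have "\<dots> \<le> measure_pmf.expectation p (\<lambda>\<pi>. 1 + 4 ^ (B + 1) * \<epsilon> + 9/10 * \<delta>)"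
      using hm(1) hp(1) det unfolding \<Phi>_def[abs_def]
      by (intro integral_mono_AE) (auto simp: AE_measure_pmf_iff)
    finally show ?thesis by simp
  qed
  moreover have "0 \<le> \<delta>" by (simp add: \<delta>_def)
  ultimately have "4/15 \<le> \<delta> + 4 ^ (B + 1) * \<epsilon>" by linarith
  then show ?thesis unfolding \<delta>_def .
qed

text \<open>All edges go to player 0. Some outcome of the coins reproduces at least 2/3 of all
  subgraphs, and each of these is determined by the history of that single channel.\<close>

lemma rigid_cost_any_players:
  assumes rigid: "rigid n \<Omega>" and s: "0 < s" and p: "spanner_protocol n s 2 C p"
  shows "2/3 * 2 ^ card \<Omega> \<le> (4::real) ^ (C + 1)"
proof -
  have fin: "finite \<Omega>" using rigid finite_subset[OF _ finite_complete_edges] by (auto simp: rigid_def)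
  define X where "X F k = (if k = 0 then F else {})" for F :: edges and k :: nat
  define P where "P \<pi> F \<longleftrightarrow> (\<exists>t H. halts_with \<pi> (X F) t H \<and> additive_spanner n 2 (input_graph s (X F)) H)"
    for \<pi> :: "(edges, edges) protocol" and F
  have inp: "X F \<in> inputs n s" if "F \<subseteq> \<Omega>" for F
    using that rigid by (auto simp: inputs_def rigid_def X_def)
  have graph: "input_graph s (X F) = F" for F
    using s by (auto simp: input_graph_def X_def split: if_splits)
  have "\<exists>\<pi>\<in>set_pmf p. 2/3 * sum (\<lambda>_. 1::real) (Pow \<Omega>) \<le> (\<Sum>F\<in>Pow \<Omega>. 1 * of_bool (P \<pi> F))"
  proof (rule pmf_exists_sum_ge)
    show "2/3 \<le> measure_pmf.prob p {\<pi>. P \<pi> F}" if "F \<in> Pow \<Omega>" for F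
      using p inp[of F] that by (auto simp: spanner_protocol_def P_def)
  qed (use fin in auto)
  then obtain \<pi> where \<pi>: "\<pi> \<in> set_pmf p" "2/3 * 2 ^ card \<Omega> \<le> (\<Sum>F\<in>Pow \<Omega>. of_bool (P \<pi> F) :: real)"
    using fin by (auto simp: card_Pow)
  define G where "G = {F \<in> Pow \<Omega>. P \<pi> F}"
  have "(\<Sum>F\<in>Pow \<Omega>. of_bool (P \<pi> F) :: real) = card G"
    using fin by (simp add: G_def Pow_def Collect_conj_eq Int_commute)
  with \<pi>(2) have G: "2/3 * 2 ^ card \<Omega> \<le> real (card G)" by simp
  have wf: "well_formed s \<pi>"
    and halts: "\<And>E. E \<in> inputs n s \<Longrightarrow> \<exists>t H. halts_with \<pi> E t H \<and> bits_exchanged t \<le> C"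
    using p \<pi> by (auto simp: spanner_protocol_def)
  have "\<exists>t. halts_with \<pi> (X F) t F \<and> bits_exchanged t \<le> C" if F: "F \<in> G" for F
  proof -
    obtain t H where tH: "halts_with \<pi> (X F) t H" "additive_spanner n 2 F H"
      using F by (auto simp: G_def P_def graph)
    moreover have "F \<subseteq> \<Omega>" using F by (simp add: G_def)
    moreover obtain t' H' where "halts_with \<pi> (X F) t' H'" "bits_exchanged t' \<le> C"
      using halts[OF inp[OF \<open>F \<subseteq> \<Omega>\<close>]] by blast
    moreover have "H = F" using tH(2) \<open>F \<subseteq> \<Omega>\<close> rigid by (simp add: rigid_def)
    ultimately show ?thesis using halts_with_unique[OF tH(1)] tH(1) by metis
  qed
  then obtain T where T: "\<And>F. F \<in> G \<Longrightarrow> halts_with \<pi> (X F) (T F) F \<and> bits_exchanged (T F) \<le> C"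
    by metis
  have "inj_on (\<lambda>F. channel 0 (T F)) G"
  proof (rule inj_onI)
    fix F F' assume F: "F \<in> G" "F' \<in> G" and eq: "channel 0 (T F) = channel 0 (T F')"
    have "halts_with \<pi> ((X F)(0 := X F' 0)) (T F) F"
      using T[OF F(1)] T[OF F(2)] eq by (intro halts_with_fun_upd[of _ "X F" _ _ "X F'" "T F'" F']) auto
    moreover have "(X F)(0 := X F' 0) = X F'" by (rule ext) (simp add: X_def)
    ultimately show "F = F'" using T[OF F(2)] halts_with_unique by metis
  qed
  moreover have "(\<lambda>F. channel 0 (T F)) ` G \<subseteq> histories C"
  proof safe
    fix F assume F: "F \<in> G"
    have wfT: "\<forall>(j, m, r)\<in>set (T F). j < s \<and> m \<noteq> [] \<and> r \<noteq> []"
      using reachable_well_formed[of \<pi> "X F" "T F" s] wf T[OF F] by (simp add: halts_with_def)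
    have "history_bits (channel 0 (T F)) \<le> (\<Sum>i<s. history_bits (channel i (T F)))"
      using s by (intro member_le_sum) auto
    also have "\<dots> = bits_exchanged (T F)" using wfT by (intro sum_history_bits_channel) auto
    also have "\<dots> \<le> C" using T[OF F] by simp
    finally show "channel 0 (T F) \<in> histories C"
      using wfT by (auto simp: histories_def channel_def)
  qed
  ultimately have "card G \<le> card (histories C)"
    using histories_finite_card by (intro card_inj_on_le) auto
  also have "\<dots> \<le> 4 ^ (C + 1)" using histories_finite_card by blast
  finally have "real (card G) \<le> 4 ^ (C + 1)"
    by (metis of_nat_le_iff of_nat_numeral of_nat_power)
  then show ?thesis using G by linarith
qed

section \<open>Dense graphs without short cycles\<close>

lemma Leibniz_triangle_Suc:
  assumes "k < n"
  shows "1 / (real (n + 1) * real (n choose Suc k))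
    = 1 / (real n * real (n - 1 choose k)) - 1 / (real (n + 1) * real (n choose k))"
proof -
  define c where "c = real (n choose k)"
  have c: "c > 0" using assms by (simp add: c_def)
  have k: "real n - real k > 0" using assms by simp
  have n1: "Suc k * (n choose Suc k) = (n - k) * (n choose k)"
    and n2: "n * (n - 1 choose k) = (n - k) * (n choose k)"
    using binomial_absorption[of k n] binomial_absorb_comp[of n k] by simp_all
  have 1: "(real k + 1) * real (n choose Suc k) = (real n - real k) * c"
    using arg_cong[OF n1, of real] assms by (simp add: c_def of_nat_diff distrib_right add.commute)
  have 2: "real n * real (n - 1 choose k) = (real n - real k) * c"
    using arg_cong[OF n2, of real] assms by (simp add: c_def of_nat_diff)
  have "1 / (real (n + 1) * real (n choose Suc k)) = (real k + 1) / (real (n + 1) * ((real n - real k) * c))"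
  proof -
    have "1 / (N * D) = a / (N * (a * D))" if "a \<noteq> 0" for N D a :: real
      using that by simp
    then show ?thesis unfolding 1[symmetric] by simp
  qed
  also have "\<dots> = 1 / ((real n - real k) * c) - 1 / (real (n + 1) * c)"
  proof -
    have "(N - a) / (N * (a * c)) = 1 / (a * c) - 1 / (N * c)" if "a > 0" "N > 0" for N a :: real
      using that c by (simp add: field_simps)
    from this[of "real n - real k" "real (n + 1)"] show ?thesis using k by (simp add: add.commute)
  qed
  finally show ?thesis unfolding 2 c_def .
qed

text \<open>By the recurrence of the Leibniz harmonic triangle every entry
  \<open>1 / ((n + 1) * (n choose k))\<close> is an integer combination of 1, 1/2, ..., 1/(M + 1),
  so their common denominator clears it.\<close>

lemma dvd_Lcm_binomial:
  assumes "k \<le> n" "n \<le> M"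
  shows "(n + 1) * (n choose k) dvd Lcm {1..M + 1}"
proof -
  define d where "d = Lcm {1..M + 1}"
  have "real d * (1 / (real (n + 1) * real (n choose k))) \<in> \<int>"
    using assms
  proof (induction k arbitrary: n)
    case 0
    then have "n + 1 dvd d" unfolding d_def by (intro dvd_Lcm) auto
    then obtain z where "d = (n + 1) * z" by blast
    then have "real d * (1 / (real (n + 1) * real (n choose 0))) = real z"
      by (simp add: field_simps)
    then show ?case by (metis Ints_of_nat)
  next
    case (Suc k)
    have "real d * (1 / (real (n - 1 + 1) * real (n - 1 choose k))) \<in> \<int>"
      "real d * (1 / (real (n + 1) * real (n choose k))) \<in> \<int>"
      using Suc by (intro Suc.IH; simp)+
    moreover have "n - 1 + 1 = n" "k < n" using Suc by simp_all
    ultimately show ?case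
      by (simp only: Leibniz_triangle_Suc right_diff_distrib Ints_diff)
  qed
  then obtain z :: int where "real d * (1 / (real (n + 1) * real (n choose k))) = z"
    by (auto elim: Ints_cases)
  moreover have "real (n + 1) * real (n choose k) \<noteq> 0" using assms by simp
  ultimately have "real d = of_int z * (real (n + 1) * real (n choose k))"
    by (simp add: field_simps)
  then have "real_of_int (int d) = real_of_int (z * int ((n + 1) * (n choose k)))"
    by (simp add: distrib_right)
  then have "int d = z * int ((n + 1) * (n choose k))" by (simp only: of_int_eq_iff)
  then show ?thesis unfolding d_def by (metis dvd_triv_right int_dvd_int_iff)
qed

text \<open>Row \<open>M\<close> of the triangle supplies \<open>M + 1\<close> divisors with sum
  \<open>(M + 1) * 2 ^ M\<close>, none of them larger than the least common multiple.\<close>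

lemma Lcm_ge_power2: "2 ^ M \<le> Lcm {1..M + 1 :: nat}"
proof -
  have pos: "Lcm {1..M + 1} > (0::nat)"
    using Lcm_0_iff[of "{1..M + 1 :: nat}"] by (intro Nat.gr0I) simp
  have "(M + 1) * 2 ^ M = (\<Sum>k\<le>M. (M + 1) * (M choose k))"
    by (simp only: choose_row_sum sum_distrib_left[symmetric])
  also have "\<dots> \<le> (\<Sum>k\<le>M. Lcm {1..M + 1})"
    using dvd_Lcm_binomial[of _ M M] pos by (intro sum_mono dvd_imp_le) auto
  also have "\<dots> = (M + 1) * Lcm {1..M + 1}" by simp
  finally have "(M + 1) * 2 ^ M \<le> (M + 1) * Lcm {1..M + 1}" .
  then show ?thesis by (simp only: nat_mult_le_cancel_disj)
qed

lemma prime_power_dvd_Lcm: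
  fixes p :: nat
  assumes "prime p" "finite A" "0 \<notin> A" "p ^ k dvd Lcm A" "k > 0"
  shows "\<exists>a\<in>A. p ^ k dvd a"
  using assms(2,3,4)
proof (induction A rule: finite_induct)
  case empty
  then show ?case using assms by (auto simp: prime_gt_0_nat dest: prime_gt_1_nat)
next
  case (insert a A)
  have nz: "a \<noteq> 0" "Lcm A \<noteq> 0" using insert by (auto simp: Lcm_0_iff)
  have "k \<le> multiplicity p (lcm a (Lcm A))"
    using insert.prems(2) assms(1) nz
    by (intro multiplicity_geI) (auto simp: lcm_eq_0_iff dest: prime_gt_1_nat)
  then have "k \<le> multiplicity p a \<or> k \<le> multiplicity p (Lcm A)"
    using assms nz by (auto simp: multiplicity_lcm)
  then have "p ^ k dvd a \<or> p ^ k dvd Lcm A" by (meson multiplicity_dvd')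
  then show ?case using insert by auto
qed

text \<open>Every prime power in the least common multiple is at most \<open>M + 1\<close>, and the
  number of primes is bounded crudely by the largest one, \<open>q\<close>. With
  \<open>Lcm_ge_power2\<close> this makes \<open>q\<close> at least of order
  \<open>M / ln M\<close>; the logarithm is affordable.\<close>

lemma Lcm_le_power_prime:
  assumes "M \<ge> 1"
  obtains q :: nat where "prime q" "q \<le> M + 1" "Lcm {1..M + 1} \<le> (M + 1) ^ q"
proof -
  define P where "P = {p::nat. prime p \<and> p \<le> M + 1}"
  have P: "finite P" "2 \<in> P" using assms by (auto simp: P_def)
  define q where "q = Max P"
  have q: "q \<in> P" "\<And>p. p \<in> P \<Longrightarrow> p \<le> q" using P by (auto simp: q_def intro: Max_in)
  define d where "d = Lcm {1..M + 1}"
  have d: "d \<noteq> 0" using Lcm_0_iff[of "{1..M + 1 :: nat}"] by (simp add: d_def)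
  have *: "p \<in> P \<and> p ^ multiplicity p d \<le> M + 1" if p: "p \<in> prime_factors d" for p
  proof -
    have "prime p" "p dvd d" using p by auto
    then have "multiplicity p d > 0" using d by (simp add: prime_multiplicity_gt_zero_iff)
    then obtain a where a: "a \<in> {1..M + 1}" "p ^ multiplicity p d dvd a"
      using prime_power_dvd_Lcm[of p "{1..M + 1}" "multiplicity p d"] \<open>prime p\<close>
      by (auto simp: d_def multiplicity_dvd)
    then have "p ^ multiplicity p d \<le> M + 1" by (auto dest!: dvd_imp_le)
    moreover have "p \<le> p ^ multiplicity p d"
      using \<open>multiplicity p d > 0\<close> \<open>prime p\<close> by (intro self_le_power prime_ge_1_nat)
    ultimately show ?thesis using \<open>prime p\<close> by (auto simp: P_def)
  qed
  have "d = (\<Prod>p\<in>prime_factors d. p ^ multiplicity p d)"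
    using d by (subst prod_prime_factors) auto
  also have "\<dots> \<le> (\<Prod>p\<in>prime_factors d. M + 1)" using * by (intro prod_mono) auto
  also have "\<dots> = (M + 1) ^ card (prime_factors d)" by simp
  also have "\<dots> \<le> (M + 1) ^ q"
  proof (rule power_increasing)
    have "prime_factors d \<subseteq> {1..q}"
    proof
      fix p assume "p \<in> prime_factors d"
      then show "p \<in> {1..q}" using *[of p] q(2)[of p] prime_ge_1_nat[of p] by (auto simp: P_def)
    qed
    then show "card (prime_factors d) \<le> q" using card_mono[of "{1..q}"] by fastforce
  qed simp
  finally show thesis using that[of q] q(1) by (auto simp: P_def d_def)
qed

section \<open>Rigid graphs from bipartite graphs without four-cycles\<close>

lemma graph_dist_le_iff: "graph_dist E u v \<le> enat k \<longleftrightarrow> (\<exists>j\<le>k. (u, v) \<in> adjacency E ^^ j)"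
proof
  assume le: "graph_dist E u v \<le> enat k"
  let ?A = "{enat k | k. (u, v) \<in> adjacency E ^^ k}"
  have "?A \<noteq> {}"
  proof
    assume "?A = {}"
    then have "graph_dist E u v = Inf {}" unfolding graph_dist_def by (simp only:)
    then have "graph_dist E u v = \<infinity>" by (simp add: Inf_enat_def)
    then show False using le by simp
  qed
  then have "Inf ?A \<in> ?A" by (rule enat_Inf_in)
  then show "\<exists>j\<le>k. (u, v) \<in> adjacency E ^^ j" using le by (auto simp: graph_dist_def)
next
  assume "\<exists>j\<le>k. (u, v) \<in> adjacency E ^^ j"
  then obtain j where j: "j \<le> k" "(u, v) \<in> adjacency E ^^ j" by blast
  then have "graph_dist E u v \<le> enat j" unfolding graph_dist_def by (intro Inf_lower) auto
  also have "\<dots> \<le> enat k" using j by simp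
  finally show "graph_dist E u v \<le> enat k" .
qed

text \<open>Without a cycle of length four, a bipartite graph loses distance at least four between the ends
  of a deleted edge.\<close>

lemma rigid_bipartite:
  assumes sub: "\<Omega> \<subseteq> complete_edges n"
    and bip: "\<And>u v. {u, v} \<in> \<Omega> \<Longrightarrow> u \<in> L \<longleftrightarrow> v \<notin> L"
    and C4: "\<And>u u' v v'. \<lbrakk>u \<in> L; u' \<in> L; {u, v} \<in> \<Omega>; {u, v'} \<in> \<Omega>; {u', v} \<in> \<Omega>; {u', v'} \<in> \<Omega>\<rbrakk>
       \<Longrightarrow> u = u' \<or> v = v'"
  shows "rigid n \<Omega>"
  unfolding rigid_def
proof (intro conjI allI impI sub)
  fix F H assume F: "F \<subseteq> \<Omega>" and H: "additive_spanner n 2 F H"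
  have HF: "H \<subseteq> F" using H by (simp add: additive_spanner_def)
  have "e \<in> H" if e: "e \<in> F" for e
  proof (rule ccontr)
    assume eH: "e \<notin> H"
    obtain u v where uv: "e = {u, v}" "u < n" "v < n" "u \<in> L"
    proof -
      obtain a b where ab: "e = {a, b}" "a < n" "b < n"
      proof -
        have "e \<in> complete_edges n" using e F sub by blast
        then show thesis using that unfolding complete_edges_def by blast
      qed
      then have "a \<in> L \<or> b \<in> L" using bip[of a b] e F by auto
      moreover have "e = {b, a}" using ab by auto
      ultimately show thesis using that ab by metis
    qed
    have "graph_dist F u v \<le> enat 1" using e uv by (auto simp: graph_dist_le_iff adjacency_def)
    then have "graph_dist F u v + enat 2 \<le> enat 1 + enat 2" by (rule add_right_mono)
    moreover have "graph_dist H u v \<le> graph_dist F u v + enat 2"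
      using H uv(2,3) unfolding additive_spanner_def by blast
    ultimately have "graph_dist H u v \<le> enat 1 + enat 2" by (rule order_trans[rotated])
    then have "graph_dist H u v \<le> enat 3" by (simp add: numeral_3_eq_3)
    then obtain k where k: "k \<le> 3" "(u, v) \<in> adjacency H ^^ k" by (auto simp: graph_dist_le_iff)
    have L: "u \<in> L" "v \<notin> L" using uv bip[of u v] e F by auto
    have adj: "{x, y} \<in> \<Omega> \<and> (x \<in> L \<longleftrightarrow> y \<notin> L)" if "{x, y} \<in> H" for x y
      using that HF F bip[of x y] by auto
    from k consider "k = 0" | "k = Suc 0" | "k = Suc (Suc 0)" | "k = Suc (Suc (Suc 0))" by linarith
    then show False
    proof cases
      case 1 then show False using k L by auto
    next
      case 2 then show False using k eH uv by (auto simp: adjacency_def)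
    next
      case 3
      then obtain w where "{u, w} \<in> H" "{w, v} \<in> H" using k by (auto simp: adjacency_def)
      then show False using adj[of u w] adj[of w v] L by auto
    next
      \<comment> \<open>Three edges from \<open>u\<close> to \<open>v\<close> together with
        \<open>e\<close> close a four-cycle, which degenerates only if the walk itself uses
        \<open>e\<close>.\<close>
      case 4
      then obtain w w' where w: "{u, w} \<in> H" "{w, w'} \<in> H" "{w', v} \<in> H"
        using k by (auto simp: adjacency_def)
      then have "w' \<in> L" using adj[of u w] adj[of w w'] L by auto
      moreover have "{w', w} \<in> \<Omega>" using adj[OF w(2)] by (simp add: insert_commute)
      ultimately have "u = w' \<or> w = v"
        using C4[of u w' w v] adj[OF w(1)] adj[OF w(3)] L e F uv by auto
      then show False using w eH uv by auto
    qed
  qed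
  then show "H = F" using HF by blast
qed

text \<open>Points \<open>(x, y)\<close> and non-vertical lines \<open>y = a * x + b\<close> of the
  affine plane, coded below and from \<open>p ^ 2\<close> on. An incidence is determined by
  \<open>x\<close>, \<open>a\<close>, \<open>b\<close>, whence \<open>p ^ 3\<close> edges; two
  points share at most one line, whence no four-cycle.\<close>

lemma rigid_incidence:
  fixes p :: nat
  assumes p: "prime p" and n: "2 * p ^ 2 \<le> n"
  obtains \<Omega> where "rigid n \<Omega>" "card \<Omega> = p ^ 3"
proof -
  have p0: "p > 0" using p by (simp add: prime_gt_0_nat)
  define pt where "pt x y = x * p + y" for x y
  define ln where "ln a b = p ^ 2 + (a * p + b)" for a b
  define on where "on x a b = (a * x + b) mod p" for x a b
  define edge where "edge = (\<lambda>(x, a, b). {pt x (on x a b), ln a b})"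
  define \<Omega> where "\<Omega> = edge ` ({..<p} \<times> {..<p} \<times> {..<p})"
  have on: "on x a b < p" for x a b using p0 by (simp add: on_def)
  have pt_lt: "pt x y < p ^ 2" if "x < p" "y < p" for x y
  proof -
    have "pt x y < (x + 1) * p" using that by (simp add: pt_def)
    also have "\<dots> \<le> p * p" using that by (intro mult_right_mono) auto
    finally show ?thesis by (simp add: power2_eq_square)
  qed
  have ln_bounds: "p ^ 2 \<le> ln a b" "a < p \<Longrightarrow> b < p \<Longrightarrow> ln a b < n" for a b
    using pt_lt[of a b] n by (auto simp: ln_def pt_def)
  have pt_inj: "x = x' \<and> y = y'" if "pt x y = pt x' y'" "y < p" "y' < p" for x y x' y'
  proof -
    have "pt x y div p = x \<and> pt x y mod p = y" if "y < p" for x y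
      using that by (simp add: pt_def)
    then show ?thesis using that by metis
  qed
  have ln_inj: "a = a' \<and> b = b'" if "ln a b = ln a' b'" "b < p" "b' < p" for a b a' b'
    using that pt_inj[of a b a' b'] by (auto simp: ln_def pt_def)
  have edge_iff: "{u, v} \<in> \<Omega> \<longleftrightarrow> (\<exists>x<p. \<exists>a<p. \<exists>b<p. v = ln a b \<and> u = pt x (on x a b))"
    if "u < p ^ 2" for u v
    using that ln_bounds(1) pt_lt on unfolding \<Omega>_def edge_def
    by (auto simp: doubleton_eq_iff image_iff Bex_def not_less[symmetric])
  have ends: "\<exists>x<p. \<exists>a<p. \<exists>b<p. e = {pt x (on x a b), ln a b}" if "e \<in> \<Omega>" for e
    using that by (auto simp: \<Omega>_def edge_def)
  have "rigid n \<Omega>"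
  proof (rule rigid_bipartite)
    show "\<Omega> \<subseteq> complete_edges n"
    proof
      fix e assume "e \<in> \<Omega>"
      then obtain x a b where *: "x < p" "a < p" "b < p" "e = {pt x (on x a b), ln a b}"
        using ends by blast
      have "pt x (on x a b) < p ^ 2" "ln a b < n" "p ^ 2 \<le> ln a b"
        using pt_lt[OF *(1) on] ln_bounds * by auto
      then show "e \<in> complete_edges n"
          unfolding complete_edges_def using *(4) n
        by (intro CollectI exI[of _ "pt x (on x a b)"] exI[of _ "ln a b"]) auto
    qed
  next
    fix u v assume "{u, v} \<in> \<Omega>"
    then obtain x a b where *: "x < p" "a < p" "b < p" "{u, v} = {pt x (on x a b), ln a b}"
      using ends by blast
    have "pt x (on x a b) < p ^ 2" "\<not> ln a b < p ^ 2"
      using pt_lt[OF *(1) on] ln_bounds(1)[of a b] by auto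
    then show "u \<in> {..<p ^ 2} \<longleftrightarrow> v \<notin> {..<p ^ 2}" using *(4) by (auto simp: doubleton_eq_iff)
  next
    fix u u' v v' assume u: "u \<in> {..<p ^ 2}" "u' \<in> {..<p ^ 2}"
      and e: "{u, v} \<in> \<Omega>" "{u, v'} \<in> \<Omega>" "{u', v} \<in> \<Omega>" "{u', v'} \<in> \<Omega>"
    obtain x a b where 1: "x < p" "a < p" "b < p" "v = ln a b" "u = pt x (on x a b)"
      using e(1) edge_iff u by auto
    obtain x1 a' b' where 2: "x1 < p" "a' < p" "b' < p" "v' = ln a' b'" "u = pt x1 (on x1 a' b')"
      using e(2) edge_iff u by auto
    obtain x' a2 b2 where 3: "x' < p" "a2 < p" "b2 < p" "v = ln a2 b2" "u' = pt x' (on x' a2 b2)"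
      using e(3) edge_iff u by auto
    obtain x2 a3 b3 where 4: "x2 < p" "a3 < p" "b3 < p" "v' = ln a3 b3" "u' = pt x2 (on x2 a3 b3)"
      using e(4) edge_iff u by auto
    have eqs: "x1 = x" "on x a' b' = on x a b" "a2 = a" "b2 = b" "a3 = a'" "b3 = b'" "x2 = x'"
      "on x' a' b' = on x' a b"
      using 1 2 3 4 pt_inj on ln_inj by metis+
    have "[int a * int x + int b = int a' * int x + int b'] (mod int p)"
      "[int a * int x' + int b = int a' * int x' + int b'] (mod int p)"
      using eqs(2,8) unfolding on_def cong_def by (metis of_nat_add of_nat_mult zmod_int)+
    then have "int p dvd (int a * int x + int b) - (int a' * int x + int b')"
       "int p dvd (int a * int x' + int b) - (int a' * int x' + int b')"
      by (simp_all add: cong_iff_dvd_diff)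
    \<comment> \<open>Subtracting the agreements of the two lines at \<open>x\<close> and at
      \<open>x'\<close> leaves a product of the differences of slopes and abscissas, and primality
      makes one of them vanish.\<close>
    from dvd_diff[OF this] have "int p dvd (int a - int a') * (int x - int x')"
      by (simp add: algebra_simps)
    then have "int p dvd int a - int a' \<or> int p dvd int x - int x'"
      using p by (simp add: prime_dvd_mult_iff)
    then have "a = a' \<or> x = x'"
      using 1 2 3 eqs cong_less_modulus_unique_nat[of a a' p] cong_less_modulus_unique_nat[of x x' p]
      by (auto simp: cong_iff_dvd_diff[symmetric] cong_int_iff)
    then show "u = u' \<or> v = v'"
    proof
      assume "x = x'" then show ?thesis using 1 3 eqs by simp
    next
      assume aa: "a = a'"
      have "[a * x + b = a * x + b'] (mod p)" using eqs(2) aa by (simp add: on_def cong_def)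
      then have "[b = b'] (mod p)" by (simp add: cong_add_lcancel_nat)
      then have "b = b'" using 1 2 by (simp add: cong_less_modulus_unique_nat)
      then show ?thesis using 1 2 aa by simp
    qed
  qed
  moreover have "inj_on edge ({..<p} \<times> {..<p} \<times> {..<p})"
  proof (rule inj_onI)
    fix t t' assume t: "t \<in> {..<p} \<times> {..<p} \<times> {..<p}" "t' \<in> {..<p} \<times> {..<p} \<times> {..<p}"
      and edges: "edge t = edge t'"
    obtain x a b x' a' b' where t_eq: "t = (x, a, b)" "t' = (x', a', b')" by (cases t; cases t') auto
    have lt: "x < p" "a < p" "b < p" "x' < p" "a' < p" "b' < p" using t t_eq by auto
    have eq: "edge (x, a, b) = edge (x', a', b')" using edges t_eq by simp
    have "pt x (on x a b) < p ^ 2" "pt x' (on x' a' b') < p ^ 2" "\<not> ln a b < p ^ 2" "\<not> ln a' b' < p ^ 2"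
      using pt_lt on lt ln_bounds(1) by (auto simp: not_less)
    then have "ln a b = ln a' b'" "pt x (on x a b) = pt x' (on x' a' b')"
      using eq by (auto simp: edge_def doubleton_eq_iff)
    then have "x = x' \<and> a = a' \<and> b = b'" using ln_inj lt pt_inj on by metis
    then show "t = t'" using t_eq by simp
  qed
  then have "card \<Omega> = p ^ 3"
    unfolding \<Omega>_def by (simp add: card_image card_cartesian_product power3_eq_cube)
  ultimately show thesis using that by blast
qed

text \<open>The prime is at least \<open>sqrt n / (2 * ln n)\<close>, so its cube loses
  \<open>8 * ln n ^ 3\<close>. The bound \<open>n ^ 2\<close> serves the union bound over the
  edges.\<close>

lemma eventually_dense_rigid:
  "\<forall>\<^sub>F n in sequentially. \<exists>\<Omega>. rigid n \<Omega> \<and>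
     real n powr (3/2) / (8 * ln (real n) ^ 3) \<le> real (card \<Omega>) \<and> card \<Omega> \<le> n ^ 2"
proof -
  have "\<forall>\<^sub>F n in sequentially. 1 \<le> ln (real n)" by real_asymp
  then show ?thesis
    using eventually_ge_at_top[of 100]
  proof (eventually_elim)
    case (elim n)
    \<comment> \<open>7/10 is a rational below the inverse of \<open>sqrt 2\<close>. For
      \<open>n\<close> at least 100 its excess over 1/2 is worth 2, which covers the rounding in
      \<open>r\<close> and the passage to \<open>r - 1\<close>.\<close>
    have "(7/10 * sqrt (real n))\<^sup>2 \<le> real n / 2" by (simp add: power_mult_distrib power2_eq_square)
    then have "7/10 * sqrt (real n) \<le> sqrt (real n / 2)" by (rule real_le_rsqrt)
    moreover have "10 \<le> sqrt (real n)" using elim by (intro real_le_rsqrt) simp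
    ultimately have half: "3 \<le> sqrt (real n / 2)" "sqrt (real n) / 2 \<le> sqrt (real n / 2) - 2"
      by linarith+
    define r where "r = nat \<lfloor>sqrt (real n / 2)\<rfloor>"
    have r: "real r \<le> sqrt (real n / 2)" "sqrt (real n / 2) - 1 \<le> real r" "2 \<le> r"
      using half(1) unfolding r_def by linarith+
    have n: "real n > 1" "sqrt (real n) > 0" using elim by auto
    have "real (2 * r ^ 2) \<le> 2 * (sqrt (real n / 2)) ^ 2"
      using power_mono[OF r(1), of 2] by simp
    also have "\<dots> = real n" by simp
    finally have r2: "2 * r ^ 2 \<le> n" by (simp only: of_nat_le_iff)
    obtain q where q: "prime q" "q \<le> r" "2 ^ (r - 1) \<le> r ^ q"
    proof (rule Lcm_le_power_prime[of "r - 1"])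
      show "1 \<le> r - 1" using r by simp
      fix q assume "prime q" "q \<le> r - 1 + 1" "Lcm {1..r - 1 + 1} \<le> (r - 1 + 1) ^ q"
      then show thesis using that[of q] Lcm_ge_power2[of "r - 1"] r by simp
    qed
    have "q ^ 2 \<le> r ^ 2" using q by (simp add: power_mono)
    then have "2 * q ^ 2 \<le> n" using r2 by linarith
    from rigid_incidence[OF q(1) this] obtain \<Omega> where \<Omega>: "rigid n \<Omega>" "card \<Omega> = q ^ 3" by blast
    have "real r \<le> sqrt (real n)" using r(1) by (rule order_trans) simp
    then have lnr: "ln (real r) \<le> ln (real n) / 2"
      using r(3) n by (simp add: ln_sqrt[symmetric])
    have "(2::real) ^ (r - 1) \<le> real r ^ q" using q(3) by (metis of_nat_le_iff of_nat_numeral of_nat_power)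
    then have "ln ((2::real) ^ (r - 1)) \<le> ln (real r ^ q)" using r by (subst ln_le_cancel_iff) auto
    then have "real (r - 1) * ln 2 \<le> real q * ln (real r)"
      using r by (simp add: ln_realpow)
    also have "\<dots> \<le> real q * (ln (real n) / 2)" using lnr by (intro mult_left_mono) auto
    finally have 1: "real (r - 1) * ln 2 \<le> real q * (ln (real n) / 2)" .
    have "1/2 \<le> ln (2::real)" using ln_le_minus_one[of "1/2::real"] by (simp add: ln_div)
    moreover have "sqrt (real n) / 2 \<le> real (r - 1)" using r half by (simp add: of_nat_diff)
    ultimately have "sqrt (real n) / 2 * (1/2) \<le> real (r - 1) * ln 2"
      using n by (intro mult_mono) auto
    with 1 have "sqrt (real n) / 2 \<le> real q * ln (real n)" by simp
    then have "sqrt (real n) / (2 * ln (real n)) \<le> real q" using elim by (simp add: field_simps)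
    then have "(sqrt (real n) / (2 * ln (real n))) ^ 3 \<le> real q ^ 3"
      using elim n by (intro power_mono) auto
    moreover have "(sqrt (real n) / (2 * ln (real n))) ^ 3 = real n powr (3/2) / (8 * ln (real n) ^ 3)"
    proof -
      have "sqrt (real n) ^ 3 = real n powr (3/2)"
        using n by (simp add: powr_half_sqrt[symmetric] powr_powr powr_realpow[symmetric])
      then show ?thesis by (simp add: power_divide power_mult_distrib)
    qed
    moreover have "q ^ 3 \<le> n ^ 2"
    proof -
      have "q \<le> q ^ 2" using prime_ge_1_nat[OF q(1)] by (intro self_le_power) auto
      also have "q ^ 2 \<le> n" using \<open>q ^ 2 \<le> r ^ 2\<close> r2 by linarith
      finally have "q * q ^ 2 \<le> n * n" using \<open>q ^ 2 \<le> n\<close> by (intro mult_mono) auto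
      then show ?thesis by (simp add: power3_eq_cube power2_eq_square mult.assoc)
    qed
    ultimately show ?case using \<Omega> by (intro exI[of _ \<Omega>]) simp
  qed
qed

text \<open>Three logarithms come from the size of the rigid graph. The fourth comes from few
  players: up to \<open>8 * ln n + 2\<close> of them only the counting bound is used, which lacks
  the factor \<open>s\<close>.\<close>

lemma lower_bound:
  obtains c :: real where "c > 0"
    "\<forall>\<^sub>F n in sequentially. \<forall>s\<ge>1. \<forall>C p. spanner_protocol n s 2 C p \<longrightarrow>
       c * (real s * real n powr (3/2)) / ln (real n) ^ 4 \<le> real C"
proof -
  obtain \<theta> :: real where \<theta>: "0 < \<theta>" "\<theta> < 1"
    and corr: "\<And>(\<Omega>::edges) f g. \<lbrakk>finite \<Omega>; \<Omega> \<noteq> {}; \<And>x. 0 \<le> f x; \<And>x. f x \<le> 1; \<And>x. 0 \<le> g x; \<And>x. g x \<le> 1\<rbrakk>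
       \<Longrightarrow> 9/10 * disjoint_mean \<Omega> f g \<le> planted_mean \<Omega> f g + 8 * \<theta> ^ card \<Omega>"
    using corruption[where 'a="nat set"] by blast
  define l where "l = - ln \<theta>"
  have l: "l > 0" using \<theta> by (simp add: l_def)
  \<comment> \<open>For \<open>B\<close> up to \<open>\<gamma> * N\<close> the factor
    \<open>4 ^ B\<close> is at most \<open>exp (l * N / 2)\<close>, half of the exponent gained by
    \<open>\<theta> ^ N = exp (- l * N)\<close>.\<close>
  define \<gamma> where "\<gamma> = l / (2 * ln 4)"
  have \<gamma>: "\<gamma> > 0" using l by (simp add: \<gamma>_def)
  \<comment> \<open>For few players 1/400 gives \<open>c * s / L \<le> 1/40\<close>, and
    \<open>8 * N / 40\<close> is below \<open>N / 4\<close>. For many players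
    \<open>\<gamma> / 40\<close> makes \<open>8 * c * s * N\<close> at most
    \<open>s * (B + 1) / 5\<close>.\<close>
  define c where "c = min (1/400) (\<gamma> / 40)"
  have c: "c > 0" "c \<le> 1/400" "c \<le> \<gamma> / 40" using \<gamma> by (auto simp: c_def)
  have ev: "\<forall>\<^sub>F n in sequentially. max 6 (2 * ln 3200 / l) \<le> real n powr (3/2) / (8 * ln (real n) ^ 3)"
  proof -
    have "filterlim (\<lambda>n. real n powr (3/2) / (8 * ln (real n) ^ 3)) at_top sequentially" by real_asymp
    then show ?thesis unfolding filterlim_at_top by blast
  qed
  have ev2: "\<forall>\<^sub>F n in sequentially. 2 \<le> ln (real n) \<and> 100 \<le> n" 
    by (intro eventually_conj eventually_ge_at_top) real_asymp
  have "\<forall>\<^sub>F n in sequentially. \<forall>s\<ge>1. \<forall>C p. spanner_protocol n s 2 C p \<longrightarrow>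
       c * (real s * real n powr (3/2)) / ln (real n) ^ 4 \<le> real C"
    using eventually_dense_rigid ev ev2
  proof eventually_elim
    case (elim n)
    define L where "L = ln (real n)"
    define A where "A = real n powr (3/2)"
    have L: "2 \<le> L" and n: "100 \<le> n" using elim by (auto simp: L_def)
    have A: "A \<ge> 0" by (simp add: A_def)
    obtain \<Omega> where \<Omega>: "rigid n \<Omega>" "A / (8 * L ^ 3) \<le> real (card \<Omega>)" "card \<Omega> \<le> n ^ 2"
      using elim(1) by (auto simp: A_def L_def)
    define N where "N = card \<Omega>"
    have N: "6 \<le> real N" "2 * ln 3200 / l \<le> real N" "A / L ^ 3 \<le> 8 * real N"
      using elim(2) \<Omega>(2) by (auto simp: A_def L_def N_def)
    have fin: "finite \<Omega>" and ne: "\<Omega> \<noteq> {}" using N(1) by (auto simp: N_def intro: card_ge_0_finite)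
    show ?case
    proof (intro allI impI)
      fix s C p assume s: "1 \<le> s" and p: "spanner_protocol n s 2 C p"
      have eq: "c * (real s * A) / L ^ 4 = c * real s / L * (A / L ^ 3)"
        by (simp add: power_numeral_reduce field_simps)
      show "c * (real s * real n powr (3/2)) / ln (real n) ^ 4 \<le> real C"
        unfolding A_def[symmetric] L_def[symmetric] eq
      proof (cases "real s \<le> 8 * L + 2")
        case True
        have "2/3 * 2 ^ N \<le> (4::real) ^ (C + 1)"
          using rigid_cost_any_players[OF \<Omega>(1) _ p] s by (simp add: N_def)
        moreover have "(0::real) \<le> 4 ^ (C + 1)" by simp
        ultimately have "(2::real) ^ N \<le> 2 * 4 ^ (C + 1)" by linarith
        also have "\<dots> = 2 ^ (2 * C + 3)"
          by (simp add: power_add power_mult power_numeral_reduce)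
        finally have "N \<le> 2 * C + 3" by simp
        then have C: "real N / 4 \<le> real C" using N(1) by linarith
        have "c * real s / L \<le> 1/400 * (10 * L) / L"
          using True L c by (intro divide_right_mono mult_mono) auto
        also have "\<dots> = 1/40" using L by simp
        finally have "c * real s / L * (A / L ^ 3) \<le> 1/40 * (8 * real N)"
          using N(3) A L by (intro mult_mono) auto
        then show "c * real s / L * (A / L ^ 3) \<le> real C" using C by simp
      next
        case False
        define B where "B = nat \<lfloor>\<gamma> * N\<rfloor>"
        have "0 \<le> \<gamma> * N" using \<gamma> by simp
        then have B: "real B \<le> \<gamma> * N" "\<gamma> * N \<le> real (B + 1)" unfolding B_def by linarith+
        \<comment> \<open>The threshold \<open>8 * L + 2\<close> is made for this:
          \<open>ln (2/3) \<le> - 3/8\<close> turns it into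
          \<open>(2/3) ^ (s - 1) \<le> 1 / n ^ 3\<close>, against at most \<open>n ^ 2\<close>
          edges.\<close>
        have 1: "real (card \<Omega>) * (2/3) ^ (s - 1) \<le> 1/100"
        proof -
          have "(2/3::real) ^ 8 \<le> exp (-3)"
          proof -
            have "exp (3::real) = exp 1 ^ 3" by (simp add: exp_of_nat_mult[symmetric])
            also have "\<dots> \<le> (2.72::real) ^ 3"
              using e_less_272 by (intro power_mono) auto
            also have "\<dots> \<le> (3/2) ^ 8" by (simp add: power_numeral_reduce)
            finally show ?thesis by (simp add: exp_minus field_simps)
          qed
          have "8 * ln (2/3::real) \<le> -3"
          proof -
            have "ln ((2/3::real) ^ 8) \<le> ln (exp (-3))"
              using \<open>(2/3::real) ^ 8 \<le> exp (-3)\<close> by (subst ln_le_cancel_iff) auto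
            then show ?thesis by (simp add: ln_realpow)
          qed
          then have ln23: "ln (2/3::real) \<le> -3/8" by simp
          have "(2/3::real) ^ (s - 1) = exp (real (s - 1) * ln (2/3))"
            by (simp add: exp_of_nat_mult)
          also have "\<dots> \<le> exp (- 3 * L)"
          proof -
            have "real (s - 1) * ln (2/3) \<le> real (s - 1) * (-3/8)"
              using ln23 by (intro mult_left_mono) auto
            also have "\<dots> \<le> - 3 * L" using False s by (simp add: of_nat_diff)
            finally show ?thesis by simp
          qed
          also have "\<dots> = 1 / real n ^ 3"
          proof -
            have "exp (3 * L) = exp L ^ 3" by (simp add: exp_of_nat_mult[symmetric])
            then show ?thesis using n by (simp add: exp_minus L_def field_simps)
          qed
          finally have "real (card \<Omega>) * (2/3) ^ (s - 1) \<le> real (n ^ 2) * (1 / real n ^ 3)"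
            using \<Omega>(3) by (intro mult_mono) (auto simp del: of_nat_power)
          also have "\<dots> = 1 / real n" using n by (simp add: power_numeral_reduce)
          also have "\<dots> \<le> 1/100" using n by (simp add: field_simps)
          finally show ?thesis .
        qed
        have 2: "4 ^ (B + 1) * (8 * \<theta> ^ card \<Omega>) \<le> 1/100"
        proof -
          have "(4::real) ^ B = exp (real B * ln 4)" by (simp add: exp_of_nat_mult)
          also have "\<dots> \<le> exp (l * N / 2)"
          proof -
            have "real B * ln 4 \<le> \<gamma> * N * ln 4" using B(1) by (intro mult_right_mono) auto
            then show ?thesis by (simp add: \<gamma>_def)
          qed
          finally have a: "(4::real) ^ B \<le> exp (l * N / 2)" .
          have b: "\<theta> ^ card \<Omega> = exp (- (l * N / 2)) * exp (- (l * N / 2))"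
          proof -
            have "\<theta> ^ card \<Omega> = exp (ln \<theta>) ^ card \<Omega>" using \<theta> by simp
            also have "\<dots> = exp (real (card \<Omega>) * ln \<theta>)" by (rule exp_of_nat_mult[symmetric])
            also have "real (card \<Omega>) * ln \<theta> = - (l * N / 2) + - (l * N / 2)"
              by (simp add: l_def N_def)
            finally show ?thesis by (simp only: exp_add)
          qed
          have "ln 3200 \<le> l * N / 2" using N(2) l by (simp add: field_simps)
          then have "exp (ln 3200) \<le> exp (l * N / 2)" by (simp only: exp_le_cancel_iff)
          then have d: "exp (- (l * N / 2)) \<le> 1 / 3200" by (simp add: exp_minus field_simps)
          have "4 ^ (B + 1) * (8 * \<theta> ^ card \<Omega>) = 32 * (4 ^ B * exp (- (l * N / 2))) * exp (- (l * N / 2))"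
            unfolding b by simp
          also have "\<dots> \<le> 32 * (exp (l * N / 2) * exp (- (l * N / 2))) * (1/3200)"
            using a d by (intro mult_mono) auto
          also have "\<dots> = 1/100" by (simp add: exp_minus)
          finally show ?thesis .
        qed
        have "4/15 \<le> card \<Omega> * (2/3) ^ (s - 1) + C / (real s * real (B + 1)) + 4 ^ (B + 1) * (8 * \<theta> ^ card \<Omega>)"
        proof (rule rigid_cost_many_players[OF \<Omega>(1) ne _ p])
          show "0 < s" using s by simp
          show "0 \<le> 8 * \<theta> ^ card \<Omega>" using \<theta> by simp
        qed (rule corr[OF fin ne])
        then have "1/5 \<le> C / (real s * real (B + 1))" using 1 2 by linarith
        then have C: "1/5 * (real s * real (B + 1)) \<le> C"
          using s by (simp add: pos_le_divide_eq del: of_nat_Suc)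
        have "c * real s / L * (A / L ^ 3) \<le> c * real s * (8 * real N)"
        proof (intro mult_mono N(3))
          have "c * real s / L \<le> c * real s / 1" using L c by (intro divide_left_mono) auto
          then show "c * real s / L \<le> c * real s" by simp
        qed (use c A L in auto)
        also have "\<dots> \<le> \<gamma> / 40 * real s * (8 * real N)"
          using c by (intro mult_right_mono) auto
        also have "\<dots> = 1/5 * (real s * (\<gamma> * N))" by simp
        also have "\<dots> \<le> 1/5 * (real s * real (B + 1))" using B(2) by (intro mult_left_mono) auto
        also note C
        finally show "c * real s / L * (A / L ^ 3) \<le> real C" .
      qed
    qed
  qed
  with c(1) that show thesis by blast
qed

section \<open>Distances and hitting sets\<close>

lemma graph_dist_cases:
  obtains "graph_dist E u v = \<infinity>" | l where "graph_dist E u v = enat l" "(u, v) \<in> adjacency E ^^ l"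
proof (cases "graph_dist E u v")
  case (enat l)
  then obtain j where j: "j \<le> l" "(u, v) \<in> adjacency E ^^ j"
    using graph_dist_le_iff[of E u v l] by auto
  then have "graph_dist E u v \<le> enat j" by (auto simp: graph_dist_le_iff)
  then have "j = l" using j enat by simp
  then show ?thesis using that(2) enat j by simp
qed (use that in simp)

lemma graph_dist_leI: "(u, v) \<in> adjacency E ^^ l \<Longrightarrow> graph_dist E u v \<le> enat l"
  by (auto simp: graph_dist_le_iff)

lemma graph_dist_self [simp]: "graph_dist E u u = 0"
  using graph_dist_leI[where E=E and l=0] by (simp add: zero_enat_def[symmetric])

lemma graph_dist_mono:
  assumes "E \<subseteq> E'"
  shows "graph_dist E' u v \<le> graph_dist E u v"
proof (cases rule: graph_dist_cases[of E u v])
  case (2 l)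
  have "adjacency E \<subseteq> adjacency E'" using assms by (auto simp: adjacency_def)
  then have "adjacency E ^^ l \<subseteq> adjacency E' ^^ l" by (induction l) (auto simp: relcomp_mono)
  then show ?thesis using 2 graph_dist_leI by (metis subsetD)
qed simp

lemma graph_dist_triangle: "graph_dist E u w \<le> graph_dist E u v + graph_dist E v w"
proof (cases rule: graph_dist_cases[of E u v])
  case 1: (2 l)
  show ?thesis
  proof (cases rule: graph_dist_cases[of E v w])
    case (2 l')
    have "(u, w) \<in> adjacency E ^^ (l + l')" using 1 2 by (auto simp: relpow_add)
    then show ?thesis using graph_dist_leI[where E=E and l="l + l'"] 1 2 by simp
  qed simp
qed simp

lemma graph_dist_commute: "graph_dist E u v = graph_dist E v u"
proof -
  have "graph_dist E v u \<le> graph_dist E u v" for u v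
  proof (cases rule: graph_dist_cases[of E u v])
    case (2 l)
    have "(v, u) \<in> adjacency E ^^ l" if "(u, v) \<in> adjacency E ^^ l" for l
      using that
    proof (induction l arbitrary: v)
      case (Suc l)
      then obtain z where "(u, z) \<in> adjacency E ^^ l" "(v, z) \<in> adjacency E"
        by (auto simp: adjacency_def insert_commute)
      then show ?case using Suc.IH relpow_Suc_I2 by metis
    qed simp
    then show ?thesis using graph_dist_leI 2 by metis
  qed simp
  then show ?thesis by (intro antisym)
qed

lemma graph_dist_edge: "{u, v} \<in> E \<Longrightarrow> graph_dist E u v \<le> 1"
  using graph_dist_leI[where E=E and l=1] by (simp add: adjacency_def one_enat_def)

text \<open>The induction behind breadth-first search: if every vertex found at distance less than \<open>L\<close> has
  only neighbours with correct distances, then all distances up to \<open>L\<close> are correct.\<close>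

lemma graph_dist_transfer:
  assumes step: "\<And>u w. \<lbrakk>graph_dist H k u < L; {u, w} \<in> G\<rbrakk> \<Longrightarrow> graph_dist H k w \<le> graph_dist G k w"
    and L: "graph_dist G k u \<le> L"
  shows "graph_dist H k u \<le> graph_dist G k u"
proof (cases rule: graph_dist_cases[of G k u])
  case (2 l)
  then show ?thesis using L
  proof (induction l arbitrary: u)
    case 0
    then show ?case by simp
  next
    case (Suc l)
    obtain v where v: "(k, v) \<in> adjacency G ^^ l" "{v, u} \<in> G"
      using Suc.prems(2) by (auto simp: adjacency_def)
    have le: "graph_dist G k v \<le> enat l" using v by (intro graph_dist_leI)
    have "\<not> graph_dist G k v < enat l"
    proof
      assume "graph_dist G k v < enat l"
      then obtain j where "graph_dist G k v = enat j" "j < l" by (cases "graph_dist G k v") auto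
      then have "graph_dist G k u \<le> enat j + 1"
        using graph_dist_triangle[of G k u v] graph_dist_edge[OF v(2)]
        by (metis add_left_mono order_trans)
      then show False using Suc.prems \<open>j < l\<close> by (simp add: one_enat_def)
    qed
    then have v_eq: "graph_dist G k v = enat l" using le by simp
    have "enat l < L" using Suc.prems by (metis Suc_ile_eq)
    then have "graph_dist H k v \<le> graph_dist G k v"
      using v v_eq by (intro Suc.IH) auto
    then have "graph_dist H k v < L" using v_eq \<open>enat l < L\<close> by simp
    then show ?case using step v(2) by blast
  qed
qed simp

text \<open>The first missing edge starts at a vertex \<open>x\<close> of the walk, which cuts the
  walk into two pieces of total length \<open>l\<close>.\<close>

lemma walk_or_missing_edge:
  assumes "(u, v) \<in> adjacency G ^^ l"
  shows "(u, v) \<in> adjacency H ^^ l \<or>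
    (\<exists>x y. {x, y} \<in> G - H \<and> graph_dist G u x + graph_dist G x v \<le> enat l)"
  using assms
proof (induction l arbitrary: v)
  case 0
  then show ?case by simp
next
  case (Suc l)
  obtain z where z: "(u, z) \<in> adjacency G ^^ l" "{z, v} \<in> G"
    using Suc.prems by (auto simp: adjacency_def)
  have zv: "graph_dist G z v \<le> 1" by (rule graph_dist_edge[OF z(2)])
  from Suc.IH[OF z(1)] show ?case
  proof
    assume H: "(u, z) \<in> adjacency H ^^ l"
    show ?thesis
    proof (cases "{z, v} \<in> H")
      case True
      then show ?thesis using H by (auto simp: adjacency_def)
    next
      case False
      have "graph_dist G u z + graph_dist G z v \<le> enat l + 1"
        using graph_dist_leI[OF z(1)] zv by (rule add_mono)
      then show ?thesis using False z(2) by (auto simp: one_enat_def)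
    qed
  next
    assume "\<exists>x y. {x, y} \<in> G - H \<and> graph_dist G u x + graph_dist G x z \<le> enat l"
    then obtain x y where xy: "{x, y} \<in> G - H" "graph_dist G u x + graph_dist G x z \<le> enat l" by blast
    have "graph_dist G u x + graph_dist G x v \<le> graph_dist G u x + (graph_dist G x z + graph_dist G z v)"
      by (intro add_left_mono graph_dist_triangle)
    also have "\<dots> \<le> enat l + 1" unfolding add.assoc[symmetric] using xy(2) zv by (rule add_mono)
    finally show ?thesis using xy(1) by (auto simp: one_enat_def)
  qed
qed

text \<open>Greedy choice: by double counting of memberships some vertex lies in at least a fraction
  \<open>r / n\<close> of the sets not yet met.\<close>

lemma hitting_set:
  fixes L :: "nat \<Rightarrow> nat set" and I :: "nat set"
  assumes L: "\<And>v. v \<in> I \<Longrightarrow> L v \<subseteq> {..<n}" "\<And>v. v \<in> I \<Longrightarrow> r \<le> card (L v)"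
    and I: "finite I" and n: "0 < n" "r \<le> n"
  shows "\<exists>D\<subseteq>{..<n}. card D \<le> j \<and>
    real (card {v \<in> I. L v \<inter> D = {}}) \<le> real (card I) * (1 - real r / real n) ^ j"
proof (induction j)
  case 0
  then show ?case by (intro exI[of _ "{}"]) auto
next
  case (Suc j)
  then obtain D where D: "D \<subseteq> {..<n}" "card D \<le> j"
    "real (card {v \<in> I. L v \<inter> D = {}}) \<le> real (card I) * (1 - real r / real n) ^ j" by blast
  define J where "J = {v \<in> I. L v \<inter> D = {}}"
  have J: "finite J" "J \<subseteq> I" using I by (auto simp: J_def)
  have "\<exists>x<n. real r * card J \<le> real n * card {v \<in> J. x \<in> L v}"
  proof (rule ccontr)
    assume "\<not> ?thesis"
    then have less: "real n * card {v \<in> J. x \<in> L v} < real r * card J" if "x < n" for x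
      using that by (auto simp: not_le)
    have "real n * (\<Sum>x<n. real (card {v \<in> J. x \<in> L v})) < (\<Sum>x<n. real r * card J)"
      unfolding sum_distrib_left using n less by (intro sum_strict_mono) auto
    moreover have "(\<Sum>x<n. real (card {v \<in> J. x \<in> L v})) = (\<Sum>v\<in>J. real (card (L v)))"
    proof -
      have "(\<Sum>x<n. real (card {v \<in> J. x \<in> L v})) = (\<Sum>x<n. \<Sum>v\<in>J. of_bool (x \<in> L v))"
        using J by (simp add: Int_def)
      also have "\<dots> = (\<Sum>v\<in>J. \<Sum>x<n. of_bool (x \<in> L v))" by (rule sum.swap)
      also have "\<dots> = (\<Sum>v\<in>J. real (card (L v)))"
      proof (intro sum.cong refl)
        fix v assume "v \<in> J"
        then have "{..<n} \<inter> {x. x \<in> L v} = L v" using L(1)[of v] J by auto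
        then show "(\<Sum>x<n. of_bool (x \<in> L v)) = real (card (L v))" by simp
      qed
      finally show ?thesis .
    qed
    moreover have "(\<Sum>v\<in>J. real r) \<le> (\<Sum>v\<in>J. real (card (L v)))"
      using L(2) J by (intro sum_mono) auto
    ultimately show False using n by (auto simp: mult.commute mult_le_cancel_left_pos algebra_simps)
  qed
  then obtain x where x: "x < n" "real r * card J \<le> real n * card {v \<in> J. x \<in> L v}" by blast
  have eq: "{v \<in> I. L v \<inter> insert x D = {}} = J - {v \<in> J. x \<in> L v}" by (auto simp: J_def)
  have "real (card (J - {v \<in> J. x \<in> L v})) = real (card J) - real (card {v \<in> J. x \<in> L v})"
    using J by (subst card_Diff_subset) (auto simp: of_nat_diff card_mono)
  also have "\<dots> \<le> real (card J) - real r * card J / real n"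
    using x n by (simp add: pos_divide_le_eq mult.commute)
  also have "\<dots> = real (card J) * (1 - real r / real n)" by (simp add: algebra_simps)
  also have "\<dots> \<le> real (card I) * (1 - real r / real n) ^ j * (1 - real r / real n)"
    using D(3) n unfolding J_def[symmetric] by (intro mult_right_mono) auto
  finally show ?case
    using D x eq by (intro exI[of _ "insert x D"])
      (auto simp: card_insert_if finite_subset[OF D(1)] mult_ac)
qed

text \<open>At this \<open>d\<close> the bound \<open>n * exp (- (r * d / n))\<close> on the number
  of sets not met is below 1.\<close>

lemma hitting_set_all:
  fixes L :: "nat \<Rightarrow> nat set"
  assumes L: "\<And>v. v < n \<Longrightarrow> L v \<subseteq> {..<n}" and n: "0 < n" "0 < r" "r \<le> n"
    and d: "real n / real r * ln (real n) < real d"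
  shows "\<exists>D\<subseteq>{..<n}. card D \<le> d \<and> (\<forall>v<n. r \<le> card (L v) \<longrightarrow> L v \<inter> D \<noteq> {})"
proof -
  define I where "I = {v. v < n \<and> r \<le> card (L v)}"
  have I: "finite I" "I \<subseteq> {..<n}" by (auto simp: I_def)
  have "\<exists>D\<subseteq>{..<n}. card D \<le> d \<and>
    real (card {v \<in> I. L v \<inter> D = {}}) \<le> real (card I) * (1 - real r / real n) ^ d"
    by (rule hitting_set) (use L n I in \<open>auto simp: I_def\<close>)
  then obtain D where D: "D \<subseteq> {..<n}" "card D \<le> d"
    "real (card {v \<in> I. L v \<inter> D = {}}) \<le> real (card I) * (1 - real r / real n) ^ d" by blast
  have "(1 - real r / real n) ^ d \<le> exp (- (real r / real n)) ^ d"
    using n exp_ge_add_one_self[of "- (real r / real n)"] by (intro power_mono) auto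
  also have "\<dots> = exp (- (real r / real n * real d))"
    by (simp add: exp_of_nat_mult[symmetric] mult.commute)
  also have "\<dots> < exp (- ln (real n))"
    using d n by (simp add: field_simps)
  also have "\<dots> = 1 / real n" using n by (simp add: exp_minus inverse_eq_divide)
  finally have small: "(1 - real r / real n) ^ d < 1 / real n" .
  have "card I \<le> n" using card_mono[OF _ I(2)] by simp
  then have "real (card I) * (1 - real r / real n) ^ d \<le> real n * (1 - real r / real n) ^ d"
    using n by (intro mult_right_mono) auto
  also have "\<dots> < 1" using small n by (simp add: field_simps)
  finally have "card {v \<in> I. L v \<inter> D = {}} = 0" using D(3) by linarith
  then have "{v \<in> I. L v \<inter> D = {}} = {}" using I by simp
  then show ?thesis using D by (intro exI[of _ D]) (auto simp: I_def)
qed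

section \<open>The exploration protocol\<close>

lemma halts_if_bounded:
  assumes "\<And>t. reachable \<pi> X t \<Longrightarrow> length t \<le> R"
  shows "\<exists>t y. halts_with \<pi> X t y"
proof (rule ccontr)
  assume no: "\<not> ?thesis"
  have "\<exists>t. reachable \<pi> X t \<and> length t = j" for j
  proof (induction j)
    case 0
    then show ?case by (intro exI[of _ "[]"]) (simp add: reachable.start)
  next
    case (Suc j)
    then obtain t where t: "reachable \<pi> X t" "length t = j" by blast
    then obtain i m where "coordinator \<pi> t = Send i m"
      using no by (cases "coordinator \<pi> t") (auto simp: halts_with_def)
    from reachable.round[OF t(1) this] show ?case using t(2) by fastforce
  qed
  then obtain t where "reachable \<pi> X t" "length t = Suc R" by blast
  then show False using assms[of t] by simp
qed

definition word :: "nat \<Rightarrow> nat \<Rightarrow> bits" where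
  "word w x = map (bit x) [0..<w]"

definition unword :: "bits \<Rightarrow> nat" where
  "unword = horner_sum of_bool 2"

lemma length_word [simp]: "length (word w x) = w"
  by (simp add: word_def)

lemma unword_word: "x < 2 ^ w \<Longrightarrow> unword (word w x) = x"
  by (simp add: word_def unword_def horner_sum_bit_eq_take_bit take_bit_nat_eq_self)

text \<open>A query is a pair \<open>(k, v)\<close> of a tag and a vertex, sent as one number. Its answer is the first
  neighbour of \<open>v\<close> which the player has not yet reported under the tag \<open>k\<close>, and \<open>n\<close> if there is none.
  The tags \<open>n + v\<close> serve to collect up to \<open>r\<close> neighbours of \<open>v\<close> from each player. The tags \<open>k < n\<close>
  serve for a breadth-first search from \<open>k\<close>; these searches start at the vertices of a set meeting
  every neighbourhood known to have at least \<open>r\<close> elements.\<close>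

locale exploration =
  fixes n s r d w :: nat
  assumes n: "0 < n"
    and w: "2 * n * n \<le> 2 ^ w" "n < 2 ^ w"
    and hit: "\<And>L. (\<And>v. v < n \<Longrightarrow> L v \<subseteq> {..<n}) \<Longrightarrow>
      \<exists>D\<subseteq>{..<n}. card D \<le> d \<and> (\<forall>v<n. r \<le> card (L v) \<longrightarrow> L v \<inter> D \<noteq> {})"
begin

definition tag :: "bits \<Rightarrow> nat" where "tag m = unword m div n"
definition vertex :: "bits \<Rightarrow> nat" where "vertex m = unword m mod n"

definition answer :: "edges \<Rightarrow> (bits \<times> bits) list \<Rightarrow> bits \<Rightarrow> nat" where
  "answer E h m =
     (let W = {x. x < n \<and> {vertex m, x} \<in> E \<and> (\<forall>(m', r')\<in>set h. tag m' = tag m \<longrightarrow> unword r' \<noteq> x)}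
      in if W = {} then n else Min W)"

definition events :: "transcript \<Rightarrow> (nat \<times> nat \<times> nat \<times> nat) set" where
  "events t = (\<lambda>(i, m, r). (i, tag m, vertex m, unword r)) ` set t"

definition reported :: "transcript \<Rightarrow> nat \<Rightarrow> nat \<Rightarrow> nat set" where
  "reported t i k = {x. x < n \<and> (\<exists>v. (i, k, v, x) \<in> events t)}"

definition known :: "transcript \<Rightarrow> nat \<Rightarrow> nat set" where
  "known t v = (\<Union>i<s. reported t i (n + v))"

text \<open>The choice depends only on the answers under the tags \<open>n + v\<close>, so it stays
  the same once the local queries have ended, and the coordinator can recompute it from the
  transcript in every round.\<close>

definition centers :: "transcript \<Rightarrow> nat set" where
  "centers t = (SOME D. D \<subseteq> {..<n} \<and> card D \<le> d \<and> (\<forall>v<n. r \<le> card (known t v) \<longrightarrow> known t v \<inter> D \<noteq> {}))"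

definition found :: "transcript \<Rightarrow> nat \<Rightarrow> edges" where
  "found t k = {{v, x} | i v x. (i, k, v, x) \<in> events t \<and> x < n}"

definition level :: "transcript \<Rightarrow> nat \<times> nat \<times> nat \<Rightarrow> enat" where
  "level t = (\<lambda>(i, k, v). graph_dist (found t k) k v)"

definition local_queries :: "transcript \<Rightarrow> (nat \<times> nat \<times> nat) set" where
  "local_queries t = {(i, k, v). i < s \<and> v < n \<and> k = n + v \<and> (i, k, v, n) \<notin> events t \<and>
     card (reported t i k) < r}"

definition search_queries :: "transcript \<Rightarrow> (nat \<times> nat \<times> nat) set" where
  "search_queries t = {(i, k, v). i < s \<and> k \<in> centers t \<and> v < n \<and> (i, k, v, n) \<notin> events t \<and>
     level t (i, k, v) < \<infinity>}"

text \<open>The searches from all centers are interleaved. A query of least level overall has least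
  level within its own search, which is all that breadth-first order requires.\<close>

definition next_query :: "transcript \<Rightarrow> nat \<times> nat \<times> nat" where
  "next_query t = (if local_queries t \<noteq> {} then SOME q. q \<in> local_queries t
     else arg_min_on (level t) (search_queries t))"

definition scout :: "transcript \<Rightarrow> edges action" where
  "scout t = (if local_queries t \<union> search_queries t = {} then Output (\<Union>k. found t k)
     else case next_query t of (i, k, v) \<Rightarrow> Send i (word w (k * n + v)))"

definition explore :: "(edges, edges) protocol" where
  "explore = Protocol scout (\<lambda>i E h m. word w (answer E h m))"

section \<open>Encoding and selection of queries\<close>

lemma w_pos: "w \<noteq> 0"
  using w n by (cases w) auto

lemma answer_le: "answer E h m \<le> n"
proof -
  define W where "W = {x. x < n \<and> {vertex m, x} \<in> E \<and> (\<forall>(m', r')\<in>set h. tag m' = tag m \<longrightarrow> unword r' \<noteq> x)}"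
  have "finite W" by (simp add: W_def)
  then have "W \<noteq> {} \<Longrightarrow> Min W \<in> W" by (rule Min_in)
  then show ?thesis by (auto simp: answer_def W_def[symmetric] Let_def) (auto simp: W_def)
qed

lemma reported_bound: "reported t i k \<subseteq> {..<n}"
  by (auto simp: reported_def)

lemma finite_reported: "finite (reported t i k)"
  using reported_bound by (rule finite_subset) simp

lemma centers:
  "centers t \<subseteq> {..<n}" "card (centers t) \<le> d"
  "\<lbrakk>v < n; r \<le> card (known t v)\<rbrakk> \<Longrightarrow> known t v \<inter> centers t \<noteq> {}"
proof -
  have "\<exists>D. D \<subseteq> {..<n} \<and> card D \<le> d \<and> (\<forall>v<n. r \<le> card (known t v) \<longrightarrow> known t v \<inter> D \<noteq> {})"
    using hit[of "known t"] by (auto simp: known_def reported_def)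
  from someI_ex[OF this] show "centers t \<subseteq> {..<n}" "card (centers t) \<le> d"
    "\<lbrakk>v < n; r \<le> card (known t v)\<rbrakk> \<Longrightarrow> known t v \<inter> centers t \<noteq> {}"
    unfolding centers_def by blast+
qed

lemma next_query:
  assumes "local_queries t \<union> search_queries t \<noteq> {}"
  shows "next_query t \<in> (if local_queries t \<noteq> {} then local_queries t else search_queries t)"
    and "\<lbrakk>local_queries t = {}; q \<in> search_queries t\<rbrakk> \<Longrightarrow> level t (next_query t) \<le> level t q"
proof -
  have "search_queries t \<subseteq> {..<s} \<times> {..<n} \<times> {..<n}"
    using centers(1) by (auto simp: search_queries_def)
  then have fin: "finite (search_queries t)" by (rule finite_subset) simp
  show "next_query t \<in> (if local_queries t \<noteq> {} then local_queries t else search_queries t)"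
    using assms arg_min_if_finite(1)[OF fin, of "level t"] some_in_eq[of "local_queries t"]
    by (auto simp: next_query_def)
  show "level t (next_query t) \<le> level t q" if "local_queries t = {}" "q \<in> search_queries t"
    using that arg_min_if_finite(2)[OF fin, of "level t"] by (auto simp: next_query_def not_less)
qed

lemma query_bounds:
  assumes "(i, k, v) \<in> local_queries t \<union> search_queries t"
  shows "i < s" "k < 2 * n" "v < n" "(i, k, v, n) \<notin> events t"
  using assms centers(1)[of t] by (auto simp: local_queries_def search_queries_def)

lemma decode_query:
  assumes "k < 2 * n" "v < n"
  shows "tag (word w (k * n + v)) = k" "vertex (word w (k * n + v)) = v"
proof -
  have "k * n + v < (k + 1) * n" using assms by simp
  also have "\<dots> \<le> 2 * n * n" using assms by (intro mult_right_mono) auto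
  finally have "unword (word w (k * n + v)) = k * n + v" using w(1) by (intro unword_word) simp
  then show "tag (word w (k * n + v)) = k" "vertex (word w (k * n + v)) = v"
    using assms by (simp_all add: tag_def vertex_def)
qed

lemma well_formed_explore: "well_formed s explore"
proof -
  have "i < s \<and> m \<noteq> []" if "scout t = Send i m" for t i m
  proof -
    obtain i' k v where q: "next_query t = (i', k, v)" by (cases "next_query t") auto
    have ne: "local_queries t \<union> search_queries t \<noteq> {}" using that by (auto simp: scout_def)
    then have "i' < s" using next_query(1)[OF ne] query_bounds(1)[of i' k v t] q by (auto split: if_splits)
    moreover have "word w x \<noteq> []" for x using w_pos by (metis length_word list.size(3))
    moreover have "scout t = Send i' (word w (k * n + v))"
      unfolding scout_def using ne q by (simp only: if_False case_prod_conv)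
    ultimately show ?thesis using that by simp
  qed
  moreover have "word w x \<noteq> []" for x using w_pos by (metis length_word list.size(3))
  ultimately show ?thesis by (simp add: well_formed_def explore_def)
qed

context
  fixes X :: "nat \<Rightarrow> edges"
  assumes X: "X \<in> inputs n s"
begin

lemma X_edge: "\<lbrakk>i < s; {v, u} \<in> X i\<rbrakk> \<Longrightarrow> v < n \<and> u < n"
proof -
  assume "i < s" "{v, u} \<in> X i"
  then have "{v, u} \<in> complete_edges n" using X by (auto simp: inputs_def)
  then show ?thesis by (auto simp: complete_edges_def doubleton_eq_iff)
qed

text \<open>One round in terms of the decoded query and answer, so that the invariants avoid the bit
  encoding and the choice made by \<open>next_query\<close>.\<close>

lemma explore_induct [consumes 1, case_names Nil query]:
  assumes "reachable explore X t" and "P []"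
    and query: "\<And>t i k v x m r. \<lbrakk>reachable explore X t; P t;
        (i, k, v) \<in> local_queries t \<union> search_queries t;
        local_queries t \<noteq> {} \<Longrightarrow> (i, k, v) \<in> local_queries t;
        \<And>q. \<lbrakk>local_queries t = {}; q \<in> search_queries t\<rbrakk> \<Longrightarrow> level t (i, k, v) \<le> level t q;
        x \<le> n; x < n \<Longrightarrow> {v, x} \<in> X i \<and> x \<notin> reported t i k;
        \<And>u. \<lbrakk>x = n; {v, u} \<in> X i\<rbrakk> \<Longrightarrow> u \<in> reported t i k;
        length m = w; length r = w; events (t @ [(i, m, r)]) = insert (i, k, v, x) (events t)\<rbrakk>
      \<Longrightarrow> P (t @ [(i, m, r)])"
  shows "P t"
  using assms(1)
proof (induction rule: reachable.induct)
  case start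
  show ?case by (rule assms(2))
next
  case (round t i m)
  have scout: "scout t = Send i m" using round.hyps(2) by (simp add: explore_def)
  obtain i' k v where q: "next_query t = (i', k, v)" by (cases "next_query t") auto
  have ne: "local_queries t \<union> search_queries t \<noteq> {}" using scout by (auto simp: scout_def)
  then have "scout t = Send i' (word w (k * n + v))"
    unfolding scout_def using q by (simp only: if_False case_prod_conv)
  then have iq: "i' = i" and m: "m = word w (k * n + v)" using scout by simp_all
  have mem: "(i, k, v) \<in> (if local_queries t \<noteq> {} then local_queries t else search_queries t)"
    using next_query(1)[OF ne] q iq by simp
  then have mem': "(i, k, v) \<in> local_queries t \<union> search_queries t" by (auto split: if_splits)
  note bounds = query_bounds[OF mem']
  have dec: "tag m = k" "vertex m = v" using decode_query bounds m by simp_all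
  define x where "x = answer (X i) (channel i t) m"
  have xn: "x \<le> n" unfolding x_def by (rule answer_le)
  define W where "W = {u. u < n \<and> {v, u} \<in> X i \<and> u \<notin> reported t i k}"
  have "(\<forall>(m', r')\<in>set (channel i t). tag m' = k \<longrightarrow> unword r' \<noteq> u) \<longleftrightarrow> u \<notin> reported t i k"
    if "u < n" for u
    using that by (force simp: reported_def events_def channel_def)
  then have "{u. u < n \<and> {vertex m, u} \<in> X i \<and>
      (\<forall>(m', r')\<in>set (channel i t). tag m' = tag m \<longrightarrow> unword r' \<noteq> u)} = W"
    unfolding W_def dec by blast
  then have x: "x = (if W = {} then n else Min W)" by (simp add: x_def answer_def Let_def)
  have finW: "finite W" by (simp add: W_def)
  have uw: "unword (word w x) = x" using xn w(2) by (intro unword_word) simp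
  have "P (t @ [(i, m, word w x)])"
  proof (rule query[OF round.hyps(1) round.IH mem'])
    show "(i, k, v) \<in> local_queries t" if "local_queries t \<noteq> {}" using mem that by simp
    show "level t (i, k, v) \<le> level t q" if "local_queries t = {}" "q \<in> search_queries t" for q
      using next_query(2)[OF ne that] q iq by simp
    show "{v, x} \<in> X i \<and> x \<notin> reported t i k" if "x < n"
      using that x Min_in[OF finW] by (auto simp: W_def split: if_splits)
    show "u \<in> reported t i k" if "x = n" "{v, u} \<in> X i" for u
    proof -
      have "W = {}" using that x Min_in[OF finW] by (auto simp: W_def split: if_splits)
      then show ?thesis using that X_edge[OF bounds(1)] by (auto simp: W_def)
    qed
    show "events (t @ [(i, m, word w x)]) = insert (i, k, v, x) (events t)"
      using dec uw by (simp add: events_def)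
  qed (use xn m in simp_all)
  then show ?case by (simp add: explore_def x_def)
qed

section \<open>Invariants of the exploration\<close>

lemma events_sound:
  assumes "reachable explore X t" "(i, k, v, x) \<in> events t"
  shows "i < s \<and> k < 2 * n \<and> v < n \<and> x \<le> n \<and> (x < n \<longrightarrow> {v, x} \<in> X i) \<and> (n \<le> k \<longrightarrow> k = n + v)"
  using assms
proof (induction arbitrary: i k v x rule: explore_induct)
  case Nil
  then show ?case by (simp add: events_def)
next
  case (query t i' k' v' x' m r)
  show ?case
  proof (cases "(i, k, v, x) \<in> events t")
    case True
    then show ?thesis by (rule query.IH)
  next
    case False
    then have "i = i'" "k = k'" "v = v'" "x = x'" using query.prems query.hyps(10) by auto
    then show ?thesis
      using query_bounds[OF query.hyps(2)] query.hyps(2,5,6) centers(1)[of t]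
      by (auto simp: local_queries_def search_queries_def)
  qed
qed

lemma reported_mono: "events t \<subseteq> events t' \<Longrightarrow> reported t i k \<subseteq> reported t' i k"
  by (auto simp: reported_def)

lemma found_mono: "events t \<subseteq> events t' \<Longrightarrow> found t k \<subseteq> found t' k"
  unfolding found_def by blast

text \<open>A player answers \<open>n\<close> only after all its neighbours of \<open>v\<close> have
  been reported under the tag. In a search \<open>u\<close> may have been reported from a vertex
  other than \<open>v\<close>: it is reached, although the edge itself need not be found.\<close>

lemma events_complete:
  assumes "reachable explore X t" "(i, k, v, n) \<in> events t" "{v, u} \<in> X i"
  shows "u \<in> reported t i k"
  using assms
proof (induction arbitrary: i k v u rule: explore_induct)
  case Nil
  then show ?case by (simp add: events_def)
next
  case (query t i' k' v' x m r)
  have "u \<in> reported t i k"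
    using query.IH[of i k v u] query.hyps(7)[of u] query.prems query.hyps(10) by auto
  then show ?case using reported_mono[of t "t @ [(i', m, r)]"] query.hyps(10) by blast
qed

text \<open>Charges every round to a key of its own: under one tag a player names a vertex
  \<open>x\<close> once (\<open>Inl x\<close>) and closes a vertex \<open>v\<close> once
  (\<open>Inr v\<close>).\<close>

definition key :: "nat \<times> nat \<times> nat \<times> nat \<Rightarrow> nat \<times> nat \<times> (nat + nat)" where
  "key = (\<lambda>(i, k, v, x). (i, k, if x < n then Inl x else Inr v))"

lemma length_eq_card_keys:
  assumes "reachable explore X t"
  shows "length t = card (key ` events t)"
  using assms
proof (induction rule: explore_induct)
  case Nil
  then show ?case by (simp add: events_def)
next
  case (query t i k v x m r)
  have fin: "finite (events t)" by (simp add: events_def)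
  have "key (i, k, v, x) \<notin> key ` events t"
  proof
    assume "key (i, k, v, x) \<in> key ` events t"
    then obtain v' x' where e: "(i, k, v', x') \<in> events t"
      and eq: "key (i, k, v, x) = key (i, k, v', x')"
      by (auto simp: key_def)
    show False
    proof (cases "x < n")
      case True
      then have "x' = x" using eq by (auto simp: key_def split: if_splits)
      then show False using e True query.hyps(6) by (auto simp: reported_def)
    next
      case False
      then have "v' = v" "x' = n" using eq events_sound[OF query.hyps(1) e]
        by (auto simp: key_def split: if_splits)
      then show False using e query_bounds(4)[OF query.hyps(2)] by simp
    qed
  qed
  then show ?case using fin query by simp
qed

lemma card_reported:
  assumes "reachable explore X t"
  shows "card (reported t i (n + u)) \<le> r"
  using assms
proof (induction rule: explore_induct)
  case Nil
  then show ?case by (simp add: events_def reported_def)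
next
  case (query t i' k v x m r')
  let ?t = "t @ [(i', m, r')]"
  show ?case
  proof (cases "i = i' \<and> k = n + u")
    case True
    then have "(i', k, v) \<in> local_queries t"
      using query.hyps(2) centers(1)[of t] by (auto simp: search_queries_def)
    then have "card (reported t i (n + u)) < r" using True by (auto simp: local_queries_def)
    moreover have "reported ?t i (n + u) \<subseteq> insert x (reported t i (n + u))"
      using query.hyps(10) by (auto simp: reported_def)
    then have "card (reported ?t i (n + u)) \<le> card (insert x (reported t i (n + u)))"
      using finite_reported by (intro card_mono) auto
    moreover have "\<dots> \<le> Suc (card (reported t i (n + u)))"
      using finite_reported by (simp add: card_insert_if)
    ultimately show ?thesis by simp
  next
    case False
    then have "reported ?t i (n + u) = reported t i (n + u)"
      using query.hyps(10) by (auto simp: reported_def)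
    then show ?thesis using query.IH by simp
  qed
qed

text \<open>Answers under tags below \<open>n\<close> alter neither \<open>known\<close> nor
  \<open>local_queries\<close>, so the search phase never ends in a return to local queries and its
  centers are fixed.\<close>

lemma search_phase:
  assumes "reachable explore X t" "(i, k, v, x) \<in> events t" "k < n"
  shows "local_queries t = {} \<and> k \<in> centers t"
  using assms
proof (induction arbitrary: i k v x rule: explore_induct)
  case Nil
  then show ?case by (simp add: events_def)
next
  case (query t i' k' v' x' m r')
  let ?t = "t @ [(i', m, r')]"
  have lq: "local_queries t = {}"
  proof (rule ccontr)
    assume ne: "local_queries t \<noteq> {}"
    then have "k' \<ge> n" using query.hyps(3) by (auto simp: local_queries_def)
    then have "(i, k, v, x) \<in> events t" using query.prems query.hyps(10) by auto
    then show False using query.IH query.prems(2) ne by blast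
  qed
  then have sq: "(i', k', v') \<in> search_queries t" using query.hyps(2) by simp
  then have k': "k' \<in> centers t" "k' < n" using centers(1)[of t] by (auto simp: search_queries_def)
  have ev: "(j, n + u, a, b) \<in> events ?t \<longleftrightarrow> (j, n + u, a, b) \<in> events t" for j u a b
    using k'(2) query.hyps(10) by auto
  then have rep: "reported ?t j (n + u) = reported t j (n + u)" for j u
    by (auto simp: reported_def)
  then have "known ?t = known t" by (intro ext) (simp add: known_def)
  then have c: "centers ?t = centers t" by (simp add: centers_def)
  have l: "local_queries ?t = local_queries t"
    using ev rep by (auto simp: local_queries_def)
  show ?case
    using query.prems query.IH[of i k v x] query.hyps(10) k' lq by (auto simp: c l)
qed

text \<open>Used twice: with \<open>L\<close> the level of the current query while a search runs,
  and with \<open>L\<close> infinite at the end, when every vertex reached is closed.\<close>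

lemma search_distance:
  assumes t: "reachable explore X t" and k: "k < n"
    and reported: "\<And>i v x. \<lbrakk>(i, k, v, x) \<in> events t; x < n\<rbrakk>
       \<Longrightarrow> graph_dist (found t k) k x \<le> graph_dist (input_graph s X) k x"
    and closed: "\<And>i v. \<lbrakk>i < s; v < n; graph_dist (found t k) k v < L\<rbrakk> \<Longrightarrow> (i, k, v, n) \<in> events t"
    and u: "graph_dist (input_graph s X) k u \<le> L"
  shows "graph_dist (found t k) k u \<le> graph_dist (input_graph s X) k u"
proof (rule graph_dist_transfer[OF _ u])
  fix a b assume a: "graph_dist (found t k) k a < L" and "{a, b} \<in> input_graph s X"
  then obtain i where i: "i < s" "{a, b} \<in> X i" by (auto simp: input_graph_def)
  then have "a < n" using X_edge by blast
  then have "b \<in> reported t i k" using events_complete[OF t closed[OF i(1) _ a] i(2)] by simp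
  then show "graph_dist (found t k) k b \<le> graph_dist (input_graph s X) k b"
    using reported by (auto simp: reported_def)
qed

text \<open>Let \<open>L\<close> be the level of the queried \<open>v\<close>. By minimality all
  smaller levels are closed. If the true distance of \<open>x\<close> is at most \<open>L\<close>,
  it was therefore correct before the query; otherwise the new edge yields at most
  \<open>L + 1\<close>, which does not exceed the true distance.\<close>

lemma reported_distance:
  assumes "reachable explore X t" "(i, k, v, x) \<in> events t" "k < n" "x < n"
  shows "graph_dist (found t k) k x \<le> graph_dist (input_graph s X) k x"
  using assms
proof (induction arbitrary: i k v x rule: explore_induct)
  case Nil
  then show ?case by (simp add: events_def)
next
  case (query t i' k' v' x' m r')
  let ?t = "t @ [(i', m, r')]"
  let ?G = "input_graph s X"
  have mono: "graph_dist (found ?t k) k u \<le> graph_dist (found t k) k u" for u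
    using query.hyps(10) by (intro graph_dist_mono found_mono) auto
  show ?case
  proof (cases "(i, k, v, x) \<in> events t")
    case True
    then show ?thesis using query.IH query.prems mono order_trans by blast
  next
    case False
    then have new: "i' = i" "k' = k" "v' = v" "x' = x" using query.prems query.hyps(10) by auto
    have phase: "local_queries t = {}"
      using query.hyps(3) new query.prems(2) by (auto simp: local_queries_def)
    define L where "L = graph_dist (found t k) k v"
    show ?thesis
    proof (cases "graph_dist ?G k x \<le> L")
      case True
      have "graph_dist (found t k) k x \<le> graph_dist ?G k x"
      proof (rule search_distance[OF query.hyps(1) query.prems(2) _ _ True])
        show "graph_dist (found t k) k y \<le> graph_dist ?G k y"
          if "(j, k, u, y) \<in> events t" "y < n" for j u y
          using query.IH that query.prems(2) by blast
        show "(j, k, u, n) \<in> events t" if "j < s" "u < n" "graph_dist (found t k) k u < L" for j u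
        proof (rule ccontr)
          assume "(j, k, u, n) \<notin> events t"
          moreover have "k \<in> centers t" using query.hyps(2) phase new by (auto simp: search_queries_def)
          moreover have "level t (j, k, u) < \<infinity>" 
            using that(3) by (cases "graph_dist (found t k) k u") (auto simp: level_def)
          ultimately have "(j, k, u) \<in> search_queries t" using that by (simp add: search_queries_def)
          then have "L \<le> graph_dist (found t k) k u"
            using query.hyps(4)[OF phase, of "(j, k, u)"] new by (simp add: level_def L_def)
          then show False using that(3) by simp
        qed
      qed
      then show ?thesis using mono order_trans by blast
    next
      case False
      have "{v, x} \<in> found ?t k" using query.prems by (auto simp: found_def)
      then have "graph_dist (found ?t k) k x \<le> graph_dist (found ?t k) k v + 1"
        using graph_dist_triangle[of "found ?t k" k x v] graph_dist_edge
        by (meson add_left_mono order_trans)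
      also have "\<dots> \<le> L + 1" unfolding L_def by (intro add_right_mono mono)
      also have "\<dots> \<le> graph_dist ?G k x" using False by (simp add: ileI1 plus_1_eSuc)
      finally show ?thesis .
    qed
  qed
qed

lemma output_correct:
  assumes t: "reachable explore X t" and none: "local_queries t \<union> search_queries t = {}"
  shows "additive_spanner n 2 (input_graph s X) (\<Union>k. found t k)"
proof -
  let ?G = "input_graph s X" and ?H = "\<Union>k. found t k"
  have sub: "?H \<subseteq> ?G"
    using events_sound[OF t] by (fastforce simp: found_def input_graph_def)
  have center: "graph_dist ?H k u \<le> graph_dist ?G k u" if k: "k \<in> centers t" for k u
  proof -
    have kn: "k < n" using centers(1) k by blast
    have "graph_dist (found t k) k u \<le> graph_dist ?G k u"
    proof (rule search_distance[OF t kn, of \<infinity>])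
      show "graph_dist (found t k) k x \<le> graph_dist ?G k x" if "(i, k, v, x) \<in> events t" "x < n" for i v x
        using reported_distance[OF t that(1) kn that(2)] .
      show "(i, k, v, n) \<in> events t" if "i < s" "v < n" "graph_dist (found t k) k v < \<infinity>" for i v
      proof -
        have "(i, k, v) \<notin> search_queries t" using none by blast
        then show ?thesis using that k by (auto simp: search_queries_def level_def)
      qed
    qed simp
    moreover have "graph_dist ?H k u \<le> graph_dist (found t k) k u" by (intro graph_dist_mono) auto
    ultimately show ?thesis by (rule order_trans[rotated])
  qed
  have near: "\<exists>c\<in>centers t. graph_dist ?G x c \<le> 1" if xy: "{x, y} \<in> ?G - ?H" for x y
  proof -
    obtain i where i: "i < s" "{x, y} \<in> X i" using xy by (auto simp: input_graph_def)
    then have xn: "x < n" "y < n" using X_edge by blast+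
    have found: "{x, z} \<in> found t (n + x)" if jz: "j < s" "z \<in> reported t j (n + x)" for j z
    proof -
      obtain v where v: "(j, n + x, v, z) \<in> events t" "z < n" using jz by (auto simp: reported_def)
      moreover have "v = x" using events_sound[OF t v(1)] by simp
      ultimately show ?thesis by (auto simp: found_def)
    qed
    \<comment> \<open>Under the tag \<open>n + x\<close> only neighbours of \<open>x\<close> are
      reported, each with its edge, so the answer \<open>n\<close> would put the missing edge into
      the output. Hence player \<open>i\<close> stopped at \<open>x\<close> because it had made
      \<open>r\<close> reports.\<close>
    have "(i, n + x, x, n) \<notin> events t"
    proof
      assume "(i, n + x, x, n) \<in> events t"
      from found[OF i(1) events_complete[OF t this i(2)]] show False using xy by blast
    qed
    moreover have "(i, n + x, x) \<notin> local_queries t" using none by blast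
    ultimately have "r \<le> card (reported t i (n + x))"
      using i xn by (simp add: local_queries_def)
    also have "\<dots> \<le> card (known t x)"
      using i finite_reported by (intro card_mono) (auto simp: known_def)
    finally obtain c where c: "c \<in> known t x" "c \<in> centers t" using centers(3)[OF xn(1)] by blast
    then obtain j where "j < s" "c \<in> reported t j (n + x)" by (auto simp: known_def)
    then have "{x, c} \<in> ?G" using found sub by blast
    then show ?thesis using c(2) graph_dist_edge by blast
  qed
  have "graph_dist ?H u v \<le> graph_dist ?G u v + enat 2" for u v
  proof (cases rule: graph_dist_cases[of ?G u v])
    case (2 l)
    from walk_or_missing_edge[OF 2(2), of ?H] show ?thesis
    proof
      assume "(u, v) \<in> adjacency ?H ^^ l"
      then have "graph_dist ?H u v \<le> enat l" by (rule graph_dist_leI)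
      also have "\<dots> \<le> enat l + enat 2" by simp
      finally show ?thesis using 2 by simp
    next
      assume "\<exists>x y. {x, y} \<in> ?G - ?H \<and> graph_dist ?G u x + graph_dist ?G x v \<le> enat l"
      then obtain x y where xy: "{x, y} \<in> ?G - ?H" "graph_dist ?G u x + graph_dist ?G x v \<le> enat l"
        by blast
      obtain c where c: "c \<in> centers t" "graph_dist ?G x c \<le> 1" using near[OF xy(1)] by blast
      have "graph_dist ?H u v \<le> graph_dist ?H c u + graph_dist ?H c v"
        using graph_dist_triangle[of ?H u v c] by (simp add: graph_dist_commute[of ?H u c])
      also have "\<dots> \<le> graph_dist ?G c u + graph_dist ?G c v" by (intro add_mono center c)
      also have "\<dots> \<le> (1 + graph_dist ?G u x) + (1 + graph_dist ?G x v)"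
      proof (intro add_mono)
        show "graph_dist ?G c u \<le> 1 + graph_dist ?G u x"
          using graph_dist_triangle[of ?G c u x] c(2)
          by (metis add_right_mono graph_dist_commute order_trans)
        show "graph_dist ?G c v \<le> 1 + graph_dist ?G x v"
          using graph_dist_triangle[of ?G c v x] c(2)
          by (metis add_right_mono graph_dist_commute order_trans)
      qed
      also have "\<dots> = (graph_dist ?G u x + graph_dist ?G x v) + enat 2"
      proof -
        have "(1 + a) + (1 + b) = (a + b) + enat 2" for a b :: enat
          by (cases a; cases b) (auto simp: one_enat_def)
        then show ?thesis .
      qed
      also have "\<dots> \<le> enat l + enat 2" using xy(2) by (rule add_right_mono)
      finally show ?thesis using 2 by simp
    qed
  qed simp
  then show ?thesis using sub graph_dist_mono[OF sub] by (simp add: additive_spanner_def)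
qed

text \<open>Per player, a vertex costs up to \<open>r\<close> reports and one final \<open>n\<close>
  in the local phase, and a center costs up to \<open>n\<close> reports and \<open>n\<close> final
  answers.\<close>

lemma length_bound:
  assumes t: "reachable explore X t"
  shows "length t \<le> s * (n * (r + 1) + d * (2 * n))"
proof -
  define A where "A = (\<lambda>((i, u), z). (i, n + u, z)) `
    (SIGMA (i, u):{..<s} \<times> {..<n}. Inl ` reported t i (n + u) \<union> {Inr u :: nat + nat})"
  define B where "B = {..<s} \<times> (centers t \<times> (Inl ` {..<n} \<union> Inr ` {..<n} :: (nat + nat) set))"
  have sub: "key ` events t \<subseteq> A \<union> B"
  proof
    fix z assume "z \<in> key ` events t"
    then obtain i k v x where e: "(i, k, v, x) \<in> events t" "z = key (i, k, v, x)" by auto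
    note sound = events_sound[OF t e(1)]
    show "z \<in> A \<union> B"
    proof (cases "k < n")
      case True
      then have "k \<in> centers t" using search_phase[OF t e(1)] by simp
      then show ?thesis using sound e(2) by (auto simp: B_def key_def)
    next
      case False
      then have k: "k = n + v" using sound by simp
      then have "z = (\<lambda>((i, u), z). (i, n + u, z)) ((i, v), if x < n then Inl x else Inr v)"
        by (simp add: e(2) key_def)
      moreover have "((i, v), if x < n then Inl x else Inr v) \<in>
          (SIGMA (i, u):{..<s} \<times> {..<n}. Inl ` reported t i (n + u) \<union> {Inr u :: nat + nat})"
        using sound e(1) k by (auto simp: reported_def)
      ultimately have "z \<in> A" unfolding A_def by (rule image_eqI)
      then show ?thesis by simp
    qed
  qed
  have finB: "finite B" using centers(1)[of t] by (auto simp: B_def intro: finite_subset)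
  have finS: "finite (Inl ` reported t i (n + u) \<union> {Inr u :: nat + nat})" for i u
    using finite_reported by simp
  have cardS: "card (Inl ` reported t i (n + u) \<union> {Inr u :: nat + nat}) \<le> r + 1" for i u
  proof -
    have "card (Inl ` reported t i (n + u) \<union> {Inr u :: nat + nat})
        \<le> card (Inl ` reported t i (n + u) :: (nat + nat) set) + card {Inr u :: nat + nat}"
      by (rule card_Un_le)
    also have "card (Inl ` reported t i (n + u) :: (nat + nat) set) = card (reported t i (n + u))"
      by (intro card_image) auto
    finally show ?thesis using card_reported[OF t, of i u] by simp
  qed
  have "card A \<le> card (SIGMA (i, u):{..<s} \<times> {..<n}. Inl ` reported t i (n + u) \<union> {Inr u :: nat + nat})"
    unfolding A_def using finS by (intro card_image_le finite_SigmaI) auto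
  also have "\<dots> = (\<Sum>(i, u)\<in>{..<s} \<times> {..<n}. card (Inl ` reported t i (n + u) \<union> {Inr u :: nat + nat}))"
    using finS by (subst card_SigmaI) (auto simp: case_prod_unfold)
  also have "\<dots> \<le> (\<Sum>(i, u)\<in>{..<s} \<times> {..<n}. r + 1)"
    using cardS by (intro sum_mono) auto
  also have "\<dots> = s * (n * (r + 1))" by (simp add: algebra_simps)
  finally have A: "card A \<le> s * (n * (r + 1))" .
  have "card (Inl ` {..<n} \<union> Inr ` {..<n} :: (nat + nat) set) = n + n"
    by (subst card_Un_disjoint) (auto simp: card_image)
  then have "card B = s * (card (centers t) * (n + n))"
    unfolding B_def by (simp only: card_cartesian_product card_lessThan)
  also have "\<dots> \<le> s * (d * (2 * n))" using centers(2)[of t] by (intro mult_le_mono) auto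
  finally have B: "card B \<le> s * (d * (2 * n))" .
  have finA: "finite A" unfolding A_def using finS by (intro finite_imageI finite_SigmaI) auto
  have "length t = card (key ` events t)" by (rule length_eq_card_keys[OF t])
  also have "\<dots> \<le> card (A \<union> B)" using sub finA finB by (intro card_mono) auto
  also have "\<dots> \<le> card A + card B" by (rule card_Un_le)
  finally show ?thesis using A B by (simp add: distrib_left)
qed

lemma bits_eq:
  assumes "reachable explore X t"
  shows "bits_exchanged t = 2 * w * length t"
  using assms
proof (induction rule: explore_induct)
  case Nil
  then show ?case by (simp add: bits_exchanged_def)
next
  case (query t i k v x m r)
  have "bits_exchanged (t @ [(i, m, r)]) = bits_exchanged t + (w + w)"
    using query.hyps(8,9) by (simp add: bits_exchanged_def)
  then show ?case using query.IH by simp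
qed

lemma explore_correct:
  "\<exists>t H. halts_with explore X t H \<and> bits_exchanged t \<le> 2 * w * (s * (n * (r + 1) + d * (2 * n))) \<and>
     additive_spanner n 2 (input_graph s X) H"
proof -
  obtain t H where tH: "halts_with explore X t H"
    using halts_if_bounded[of explore X, OF length_bound] by blast
  then have t: "reachable explore X t" "scout t = Output H"
    by (simp_all add: halts_with_def explore_def)
  then have "local_queries t \<union> search_queries t = {}" "H = (\<Union>k. found t k)"
    by (auto simp: scout_def split: if_splits prod.splits)
  then have "additive_spanner n 2 (input_graph s X) H" using output_correct[OF t(1)] by simp
  then show ?thesis using tH bits_eq[OF t(1)] length_bound[OF t(1)] by fastforce
qed

end

lemma spanner_protocol_explore:
  "spanner_protocol n s 2 (2 * w * (s * (n * (r + 1) + d * (2 * n)))) (return_pmf explore)"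
proof -
  have "measure_pmf.prob (return_pmf explore)
    {\<pi>. \<exists>t H. halts_with \<pi> E t H \<and> additive_spanner n 2 (input_graph s E) H} = 1"
    if "E \<in> inputs n s" for E
    using explore_correct[OF that] by (auto simp: measure_return_pmf indicator_def)
  moreover have "\<exists>t H. halts_with explore E t H \<and>
      bits_exchanged t \<le> 2 * w * (s * (n * (r + 1) + d * (2 * n)))" if "E \<in> inputs n s" for E
    using explore_correct[OF that] by blast
  ultimately show ?thesis
    using well_formed_explore by (simp add: spanner_protocol_def)
qed

end

lemma upper_bound:
  "\<forall>\<^sub>F n in sequentially. \<forall>s. \<exists>C p. spanner_protocol n s 2 C p \<and>
     real C \<le> 36 * (real s * real n powr (3/2)) * ln (real n) ^ 2"
proof -
  have "\<forall>\<^sub>F n in sequentially. 2 \<le> ln (real n)" by real_asymp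
  then show ?thesis
    using eventually_ge_at_top[of 16]
  proof eventually_elim
    case (elim n)
    define L where "L = ln (real n)"
    define q where "q = sqrt (real n)"
    have L: "2 \<le> L" using elim by (simp add: L_def)
    have q: "4 \<le> q" unfolding q_def using elim by (intro real_le_rsqrt) simp
    have qq: "q * q = real n" by (simp add: q_def)
    define r where "r = nat \<lceil>q\<rceil>"
    have r: "q \<le> real r" "real r \<le> q + 1" using q unfolding r_def by linarith+
    have "real r \<le> q * q"
    proof -
      have "q + 1 \<le> 4 * q" using q by simp
      also have "\<dots> \<le> q * q" using q by (intro mult_right_mono) auto
      finally show ?thesis using r by simp
    qed
    then have rn: "0 < r" "r \<le> n" using r q unfolding qq by linarith+
    define d where "d = nat \<lfloor>real n / real r * L\<rfloor> + 1"
    have nr: "real n / real r * L \<le> q * L"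
    proof -
      have "real n / real r \<le> real n / q" using r q by (intro divide_left_mono) auto
      also have "\<dots> = q" using q by (simp add: qq[symmetric])
      finally show ?thesis using L by (intro mult_right_mono) auto
    qed
    have "0 \<le> real n / real r * L" using L by simp
    then have d: "real n / real r * L < real d" "real d \<le> q * L + 1"
      using nr unfolding d_def by linarith+
    obtain j where j: "2 ^ j \<le> n" "n < 2 ^ (j + 1)"
      using ex_power_ivl1[of 2 n] elim by auto
    \<comment> \<open>Queries are numbers below \<open>2 * n * n\<close>, which is less than
      \<open>2 * 2 ^ (j + 1) * 2 ^ (j + 1)\<close>. As \<open>ln 2\<close> is at least 1/2,
      \<open>w\<close> is at most \<open>4 * L + 3\<close>, hence at most
      \<open>6 * L\<close>.\<close>
    define w where "w = 2 * j + 3"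
    have pow: "(2::nat) ^ w = 2 * 2 ^ (j + 1) * 2 ^ (j + 1)"
    proof -
      have "w = 1 + (j + 1) + (j + 1)" by (simp add: w_def)
      then show ?thesis by (simp only: power_add power_one_right)
    qed
    have w: "2 * n * n \<le> 2 ^ w" "n < 2 ^ w"
    proof -
      show "2 * n * n \<le> 2 ^ w" unfolding pow using j by (intro mult_le_mono) auto
      have "(2::nat) ^ (j + 1) \<le> 2 ^ w" unfolding w_def by (rule power_increasing) auto
      then show "n < 2 ^ w" using j by simp
    qed
    have "real j * (1/2) \<le> real j * ln 2"
      using ln_le_minus_one[of "1/2::real"] by (intro mult_left_mono) (auto simp: ln_div)
    also have "\<dots> = ln (2 ^ j)" by (simp add: ln_realpow)
    also have "\<dots> \<le> L"
    proof -
      have "real (2 ^ j) \<le> real n" using j(1) by (simp only: of_nat_le_iff)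
      then show ?thesis unfolding L_def using elim by (subst ln_le_cancel_iff) auto
    qed
    finally have wL: "real w \<le> 6 * L" using L by (simp add: w_def)
    interpret exploration n s r d w for s
    proof
      show "\<exists>D\<subseteq>{..<n}. card D \<le> d \<and> (\<forall>v<n. r \<le> card (M v) \<longrightarrow> M v \<inter> D \<noteq> {})"
        if "\<And>v. v < n \<Longrightarrow> M v \<subseteq> {..<n}" for M
        using that rn d(1) unfolding L_def by (intro hitting_set_all) auto
    qed (use rn w in auto)
    show ?case
    proof (intro allI exI conjI)
      fix s
      show "spanner_protocol n s 2 (2 * w * (s * (n * (r + 1) + d * (2 * n)))) (return_pmf (explore s))"
        by (rule spanner_protocol_explore)
      have "real (r + 1) + 2 * real d \<le> (q + 2) + 2 * (q * L + 1)" using r d by simp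
      also have "\<dots> \<le> q * L + 2 * (q * L)"
      proof -
        have "q + 4 \<le> q * 2" using q by simp
        also have "\<dots> \<le> q * L" using q L by (intro mult_left_mono) auto
        finally show ?thesis by (simp add: mult.commute)
      qed
      finally have rd: "real (r + 1) + 2 * real d \<le> 3 * q * L" by (simp add: mult_ac)
      have "real (2 * w * (s * (n * (r + 1) + d * (2 * n))))
          = 2 * real w * (real s * real n * (real (r + 1) + 2 * real d))"
        by (simp add: algebra_simps)
      also have "\<dots> \<le> 2 * (6 * L) * (real s * real n * (3 * q * L))"
        using wL rd L by (intro mult_mono) auto
      also have "\<dots> = 36 * (real s * (real n * q)) * L ^ 2" by (simp add: power2_eq_square mult_ac)
      also have "real n * q = real n powr (3/2)"
      proof -
        have "real n powr (3/2) = real n powr 1 * real n powr (1/2)"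
          by (subst powr_add[symmetric]) simp
        then show ?thesis using elim by (simp add: q_def powr_half_sqrt)
      qed
      finally show "real (2 * w * (s * (n * (r + 1) + d * (2 * n))))
          \<le> 36 * (real s * real n powr (3/2)) * ln (real n) ^ 2" by (simp add: L_def)
    qed
  qed
qed

theorem theorem3p2:
  "\<exists>c>0. \<exists>C>0. \<exists>k::nat. \<forall>s :: nat \<Rightarrow> nat.
     (\<forall>n. s n \<ge> 1) \<and> (\<lambda>n. real (s n)) \<in> o(\<lambda>n. real n) \<longrightarrow>
     (\<forall>\<^sub>F n in sequentially.
        ereal (c * (real (s n) * real n powr (3/2)) / ln (real n) ^ k)
          \<le> ereal_of_enat (spanner_cost n (s n) 2) \<and>
        ereal_of_enat (spanner_cost n (s n) 2)
          \<le> ereal (C * (real (s n) * real n powr (3/2)) * ln (real n) ^ k))"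
proof -
  obtain c :: real where c: "c > 0"
    and lower: "\<forall>\<^sub>F n in sequentially. \<forall>s\<ge>1. \<forall>C p. spanner_protocol n s 2 C p \<longrightarrow>
       c * (real s * real n powr (3/2)) / ln (real n) ^ 4 \<le> real C"
    by (rule lower_bound)
  have ln1: "\<forall>\<^sub>F n in sequentially. 1 \<le> ln (real n)" by real_asymp
  have "\<forall>\<^sub>F n in sequentially.
        ereal (c * (real (s n) * real n powr (3/2)) / ln (real n) ^ 4)
          \<le> ereal_of_enat (spanner_cost n (s n) 2) \<and>
        ereal_of_enat (spanner_cost n (s n) 2)
          \<le> ereal (36 * (real (s n) * real n powr (3/2)) * ln (real n) ^ 4)"
    if s: "\<forall>n. s n \<ge> 1" for s :: "nat \<Rightarrow> nat"
    using lower upper_bound ln1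
  proof eventually_elim
    case (elim n)
    obtain C p where p: "spanner_protocol n (s n) 2 C p"
      "real C \<le> 36 * (real (s n) * real n powr (3/2)) * ln (real n) ^ 2"
      using elim(2) by blast
    \<comment> \<open>The common exponent 4 is dictated by the lower bound, and the upper bound is
      relaxed to it.\<close>
    have "ln (real n) ^ 2 \<le> ln (real n) ^ 4" using elim(3) by (intro power_increasing) auto
    then have "36 * (real (s n) * real n powr (3/2)) * ln (real n) ^ 2
        \<le> 36 * (real (s n) * real n powr (3/2)) * ln (real n) ^ 4" by (intro mult_left_mono) auto
    with p(2) have "real C \<le> 36 * (real (s n) * real n powr (3/2)) * ln (real n) ^ 4" by simp
    then have "ereal_of_enat (spanner_cost n (s n) 2)
        \<le> ereal (36 * (real (s n) * real n powr (3/2)) * ln (real n) ^ 4)"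
      by (rule spanner_cost_leI[OF p(1)])
    moreover have "ereal (c * (real (s n) * real n powr (3/2)) / ln (real n) ^ 4)
          \<le> ereal_of_enat (spanner_cost n (s n) 2)"
      using elim(1) s by (intro spanner_cost_geI) blast
    ultimately show ?case by blast
  qed
  then show ?thesis using c by (intro exI[of _ c] exI[of _ 36] exI[of _ 4] conjI) auto
qed

end
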